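(* Assume $ZF+DC$. Let $\mu$ be a singular cardinal (an aleph) of uncountable cofinality such that $\mathcal{H}(\mu)$ has cardinality $\mu$. Then $\mu^+$ is a regular cardinal and $\mu^+$ is not measurable.
   Context: We work in ZF together with the axiom of dependent choice DC (no full choice). An aleph is the cardinality of a well-orderable set, identified with the least ordinal of that cardinality. For an ordinal $\alpha$, $\mathrm{cf}(\alpha)$ is the least order type of an unbounded subset of $\alpha$; $\mu$ is singular if $\mathrm{cf}(\mu)<\mu$ and regular otherwise. $\mathcal{H}(\mu)$ is the set of sets hereditarily of cardinality less than $\mu$. A cardinal $\lambda$ is measurable if there is a non-principal $\lambda$-complete ultrafilter on $\lambda$. *)

theory Defs
  imports Main
begin

text \<open>
  HOL has full choice, so ``working in ZF + DC'' is rendered semantically: the universe of sets is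
  an arbitrary first-order model of ZF + DC, i.e. a type \<open>'a\<close> with a binary relation \<open>\<epsilon>\<close>, not
  necessarily well-founded or standard. Separation and Replacement are the first-order schemas;
  allowing arbitrary HOL predicates in them would make the HOL axiom of choice true in the model.
  For the same reason every notion below is internal to the model: all quantifiers range over
  \<open>'a\<close>, and functions, families, ordinals and \<open>\<omega>\<close> are elements of the model.
\<close>

text \<open>First-order formulas of the language of set theory, with named variables.\<close>

datatype fm =
    Mem nat nat
  | Eq nat nat
  | Neg fm
  | Conj fm fm
  | Forall nat fm

locale membership =
  fixes mem :: "'a \<Rightarrow> 'a \<Rightarrow> bool"  (infix "\<epsilon>" 50)
begin

primrec sat :: "fm \<Rightarrow> (nat \<Rightarrow> 'a) \<Rightarrow> bool" where
  "sat (Mem i j) s \<longleftrightarrow> s i \<epsilon> s j"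
| "sat (Eq i j) s \<longleftrightarrow> s i = s j"
| "sat (Neg p) s \<longleftrightarrow> \<not> sat p s"
| "sat (Conj p q) s \<longleftrightarrow> sat p s \<and> sat q s"
| "sat (Forall i p) s \<longleftrightarrow> (\<forall>x. sat p (s(i := x)))"

definition is_empty :: "'a \<Rightarrow> bool" where
  "is_empty e \<longleftrightarrow> (\<forall>x. \<not> x \<epsilon> e)"

definition subset_of :: "'a \<Rightarrow> 'a \<Rightarrow> bool" where
  "subset_of A B \<longleftrightarrow> (\<forall>x. x \<epsilon> A \<longrightarrow> x \<epsilon> B)"

definition is_upair :: "'a \<Rightarrow> 'a \<Rightarrow> 'a \<Rightarrow> bool" where
  "is_upair p x y \<longleftrightarrow> (\<forall>z. z \<epsilon> p \<longleftrightarrow> z = x \<or> z = y)"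

text \<open>\<open>p\<close> is the Kuratowski pair \<open>(x, y) = {{x}, {x, y}}\<close>.\<close>
definition is_pair :: "'a \<Rightarrow> 'a \<Rightarrow> 'a \<Rightarrow> bool" where
  "is_pair p x y \<longleftrightarrow> (\<forall>z. z \<epsilon> p \<longleftrightarrow> is_upair z x x \<or> is_upair z x y)"

text \<open>\<open>(x, y) \<in> r\<close>; for a function \<open>r\<close> this says \<open>r(x) = y\<close>.\<close>
definition related :: "'a \<Rightarrow> 'a \<Rightarrow> 'a \<Rightarrow> bool" where
  "related r x y \<longleftrightarrow> (\<exists>p. p \<epsilon> r \<and> is_pair p x y)"

definition is_fun :: "'a \<Rightarrow> 'a \<Rightarrow> 'a \<Rightarrow> bool" where
  "is_fun f A B \<longleftrightarrow>
     (\<forall>p. p \<epsilon> f \<longrightarrow> (\<exists>x y. x \<epsilon> A \<and> y \<epsilon> B \<and> is_pair p x y)) \<and>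
     (\<forall>x. x \<epsilon> A \<longrightarrow> (\<exists>!y. related f x y))"

definition is_inj :: "'a \<Rightarrow> 'a \<Rightarrow> 'a \<Rightarrow> bool" where
  "is_inj f A B \<longleftrightarrow> is_fun f A B \<and>
     (\<forall>x x' y. related f x y \<and> related f x' y \<longrightarrow> x = x')"

definition is_bij :: "'a \<Rightarrow> 'a \<Rightarrow> 'a \<Rightarrow> bool" where
  "is_bij f A B \<longleftrightarrow> is_inj f A B \<and> (\<forall>y. y \<epsilon> B \<longrightarrow> (\<exists>x. x \<epsilon> A \<and> related f x y))"

definition equipollent :: "'a \<Rightarrow> 'a \<Rightarrow> bool" where
  "equipollent A B \<longleftrightarrow> (\<exists>f. is_bij f A B)"

text \<open>\<open>y = x \<union> {x}\<close>\<close>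
definition is_succ :: "'a \<Rightarrow> 'a \<Rightarrow> bool" where
  "is_succ x y \<longleftrightarrow> (\<forall>z. z \<epsilon> y \<longleftrightarrow> z \<epsilon> x \<or> z = x)"

definition is_inductive :: "'a \<Rightarrow> bool" where
  "is_inductive w \<longleftrightarrow>
     (\<exists>e. e \<epsilon> w \<and> is_empty e) \<and> (\<forall>x. x \<epsilon> w \<longrightarrow> (\<exists>y. y \<epsilon> w \<and> is_succ x y))"

definition is_omega :: "'a \<Rightarrow> bool" where
  "is_omega w \<longleftrightarrow> is_inductive w \<and> (\<forall>u. is_inductive u \<longrightarrow> subset_of w u)"

definition countable_set :: "'a \<Rightarrow> bool" where
  "countable_set A \<longleftrightarrow> (\<exists>w f. is_omega w \<and> is_inj f A w)"

text \<open>
  \<open>R\<close> strictly well-orders the set \<open>A\<close>. It is only ever instantiated with relations definable in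
  the model, and minimal elements are only required of subsets \<open>b\<close> that belong to the model.
\<close>
definition well_orders :: "('a \<Rightarrow> 'a \<Rightarrow> bool) \<Rightarrow> 'a \<Rightarrow> bool" where
  "well_orders R A \<longleftrightarrow>
     (\<forall>x. x \<epsilon> A \<longrightarrow> \<not> R x x) \<and>
     (\<forall>x y z. x \<epsilon> A \<and> y \<epsilon> A \<and> z \<epsilon> A \<and> R x y \<and> R y z \<longrightarrow> R x z) \<and>
     (\<forall>x y. x \<epsilon> A \<and> y \<epsilon> A \<longrightarrow> R x y \<or> x = y \<or> R y x) \<and>
     (\<forall>b. subset_of b A \<and> \<not> is_empty b \<longrightarrow> (\<exists>m. m \<epsilon> b \<and> (\<forall>y. y \<epsilon> b \<longrightarrow> m = y \<or> R m y)))"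

definition well_orderable :: "'a \<Rightarrow> bool" where
  "well_orderable A \<longleftrightarrow> (\<exists>r. well_orders (related r) A)"

definition transitive_set :: "'a \<Rightarrow> bool" where
  "transitive_set t \<longleftrightarrow> (\<forall>x. x \<epsilon> t \<longrightarrow> subset_of x t)"

definition ordinal :: "'a \<Rightarrow> bool" where
  "ordinal \<alpha> \<longleftrightarrow> transitive_set \<alpha> \<and> well_orders (\<epsilon>) \<alpha>"

text \<open>\<open>\<kappa>\<close> is the least ordinal equipollent to \<open>A\<close>, i.e. \<open>|A| = \<kappa>\<close>.\<close>
definition has_card :: "'a \<Rightarrow> 'a \<Rightarrow> bool" where
  "has_card A \<kappa> \<longleftrightarrow> ordinal \<kappa> \<and> equipollent A \<kappa> \<and> (\<forall>\<beta>. \<beta> \<epsilon> \<kappa> \<longrightarrow> \<not> equipollent A \<beta>)"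

definition card_less :: "'a \<Rightarrow> 'a \<Rightarrow> bool" where
  "card_less A \<mu> \<longleftrightarrow> (\<exists>\<nu>. \<nu> \<epsilon> \<mu> \<and> has_card A \<nu>)"

definition aleph :: "'a \<Rightarrow> bool" where
  "aleph \<kappa> \<longleftrightarrow> (\<exists>A. well_orderable A \<and> has_card A \<kappa>)"

definition is_card_succ :: "'a \<Rightarrow> 'a \<Rightarrow> bool" where
  "is_card_succ \<mu> \<kappa> \<longleftrightarrow>
     aleph \<kappa> \<and> \<mu> \<epsilon> \<kappa> \<and> (\<forall>\<nu>. aleph \<nu> \<and> \<mu> \<epsilon> \<nu> \<longrightarrow> \<kappa> = \<nu> \<or> \<kappa> \<epsilon> \<nu>)"

text \<open>\<open>A\<close> is a subset of the ordinal \<open>\<alpha>\<close> not strictly bounded by any element of \<open>\<alpha>\<close>.\<close>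
definition unbounded_in :: "'a \<Rightarrow> 'a \<Rightarrow> bool" where
  "unbounded_in A \<alpha> \<longleftrightarrow>
     subset_of A \<alpha> \<and> (\<forall>\<beta>. \<beta> \<epsilon> \<alpha> \<longrightarrow> (\<exists>\<gamma>. \<gamma> \<epsilon> A \<and> (\<beta> = \<gamma> \<or> \<beta> \<epsilon> \<gamma>)))"

text \<open>The order type of a set \<open>A\<close> of ordinals, ordered by \<open>\<epsilon>\<close>, is \<open>\<beta>\<close>.\<close>
definition has_order_type :: "'a \<Rightarrow> 'a \<Rightarrow> bool" where
  "has_order_type A \<beta> \<longleftrightarrow> ordinal \<beta> \<and>
     (\<exists>f. is_bij f \<beta> A \<and>
        (\<forall>x x' y y'. related f x y \<and> related f x' y' \<longrightarrow> (x \<epsilon> x' \<longleftrightarrow> y \<epsilon> y')))"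

text \<open>\<open>cf(\<alpha>) = \<kappa>\<close>\<close>
definition is_cf :: "'a \<Rightarrow> 'a \<Rightarrow> bool" where
  "is_cf \<alpha> \<kappa> \<longleftrightarrow>
     (\<exists>A. unbounded_in A \<alpha> \<and> has_order_type A \<kappa>) \<and>
     (\<forall>A \<beta>. unbounded_in A \<alpha> \<and> has_order_type A \<beta> \<longrightarrow> \<kappa> = \<beta> \<or> \<kappa> \<epsilon> \<beta>)"

definition singular :: "'a \<Rightarrow> bool" where
  "singular \<mu> \<longleftrightarrow> aleph \<mu> \<and> (\<exists>\<kappa>. is_cf \<mu> \<kappa> \<and> \<kappa> \<epsilon> \<mu>)"

definition regular :: "'a \<Rightarrow> bool" where
  "regular \<mu> \<longleftrightarrow> aleph \<mu> \<and> \<not> singular \<mu>"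

definition is_trans_closure :: "'a \<Rightarrow> 'a \<Rightarrow> bool" where
  "is_trans_closure x t \<longleftrightarrow> transitive_set t \<and> subset_of x t \<and>
     (\<forall>u. transitive_set u \<and> subset_of x u \<longrightarrow> subset_of t u)"

text \<open>
  \<open>h = H(\<mu>) = {x. |TC(x)| < \<mu>}\<close>, the usual definition of the sets hereditarily of cardinality less
  than \<open>\<mu>\<close>. For singular \<open>\<mu>\<close> this is strictly smaller than the class of those \<open>x\<close> such that \<open>x\<close> and
  all elements of \<open>TC(x)\<close> have cardinality less than \<open>\<mu>\<close>; the latter contains all subsets of \<open>\<mu>\<close> of
  cardinality \<open>cf(\<mu>)\<close> and hence, by a Koenig-style diagonal argument, never has cardinality \<open>\<mu>\<close>.
\<close>
definition is_H :: "'a \<Rightarrow> 'a \<Rightarrow> bool" where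
  "is_H \<mu> h \<longleftrightarrow> (\<forall>x. x \<epsilon> h \<longleftrightarrow> (\<exists>t. is_trans_closure x t \<and> card_less t \<mu>))"

definition ultrafilter_on :: "'a \<Rightarrow> 'a \<Rightarrow> bool" where
  "ultrafilter_on U S \<longleftrightarrow>
     (\<forall>X. X \<epsilon> U \<longrightarrow> subset_of X S) \<and>
     S \<epsilon> U \<and>
     (\<forall>X. X \<epsilon> U \<longrightarrow> \<not> is_empty X) \<and>
     (\<forall>X Y. X \<epsilon> U \<and> subset_of X Y \<and> subset_of Y S \<longrightarrow> Y \<epsilon> U) \<and>
     (\<forall>X Y Z. X \<epsilon> U \<and> Y \<epsilon> U \<and> (\<forall>z. z \<epsilon> Z \<longleftrightarrow> z \<epsilon> X \<and> z \<epsilon> Y) \<longrightarrow> Z \<epsilon> U) \<and>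
     (\<forall>X Y. subset_of X S \<and> (\<forall>z. z \<epsilon> Y \<longleftrightarrow> z \<epsilon> S \<and> \<not> z \<epsilon> X) \<longrightarrow> X \<epsilon> U \<or> Y \<epsilon> U)"

definition principal_on :: "'a \<Rightarrow> 'a \<Rightarrow> bool" where
  "principal_on U S \<longleftrightarrow>
     (\<exists>a. a \<epsilon> S \<and> (\<forall>X. X \<epsilon> U \<longleftrightarrow> subset_of X S \<and> a \<epsilon> X))"

text \<open>Intersections of nonempty families of fewer than \<open>\<kappa>\<close> members of \<open>U\<close> are in \<open>U\<close>.\<close>
definition complete_filter :: "'a \<Rightarrow> 'a \<Rightarrow> bool" where
  "complete_filter \<kappa> U \<longleftrightarrow>
     (\<forall>F Z. subset_of F U \<and> \<not> is_empty F \<and> card_less F \<kappa> \<and>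
        (\<forall>z. z \<epsilon> Z \<longleftrightarrow> (\<forall>X. X \<epsilon> F \<longrightarrow> z \<epsilon> X)) \<longrightarrow> Z \<epsilon> U)"

definition measurable :: "'a \<Rightarrow> bool" where
  "measurable \<kappa> \<longleftrightarrow>
     (\<exists>U. ultrafilter_on U \<kappa> \<and> \<not> principal_on U \<kappa> \<and> complete_filter \<kappa> U)"

end

text \<open>
  In the two schemas the assignment \<open>s\<close> supplies the parameters. Variable \<open>0\<close> is the argument;
  in Replacement, variable \<open>1\<close> is the value.
\<close>
locale ZF_DC = membership mem for mem :: "'a \<Rightarrow> 'a \<Rightarrow> bool"  (infix "\<epsilon>" 50) +
  assumes extensionality: "(\<forall>z. z \<epsilon> x \<longleftrightarrow> z \<epsilon> y) \<Longrightarrow> x = y"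
    and foundation: "\<not> is_empty x \<Longrightarrow> \<exists>y. y \<epsilon> x \<and> (\<forall>z. z \<epsilon> x \<longrightarrow> \<not> z \<epsilon> y)"
    and pairing: "\<exists>p. is_upair p x y"
    and union: "\<exists>u. \<forall>z. z \<epsilon> u \<longleftrightarrow> (\<exists>y. y \<epsilon> x \<and> z \<epsilon> y)"
    and power_set: "\<exists>P. \<forall>y. y \<epsilon> P \<longleftrightarrow> subset_of y x"
    and infinity: "\<exists>w. is_inductive w"
    and separation: "\<exists>b. \<forall>x. x \<epsilon> b \<longleftrightarrow> x \<epsilon> a \<and> sat p (s(0 := x))"
    and replacement:
      "(\<forall>x y y'. x \<epsilon> a \<and> sat p (s(0 := x, 1 := y)) \<and> sat p (s(0 := x, 1 := y')) \<longrightarrow> y = y') \<Longrightarrow>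
       \<exists>b. \<forall>y. y \<epsilon> b \<longleftrightarrow> (\<exists>x. x \<epsilon> a \<and> sat p (s(0 := x, 1 := y)))"
    and dependent_choice:
      "\<not> is_empty A \<Longrightarrow> (\<forall>x. x \<epsilon> A \<longrightarrow> (\<exists>y. y \<epsilon> A \<and> related r x y)) \<Longrightarrow>
       \<exists>w f. is_omega w \<and> is_fun f w A \<and>
         (\<forall>n n' x y. n \<epsilon> w \<and> is_succ n n' \<and> related f n x \<and> related f n' y \<longrightarrow> related r x y)"

end

theory Submission
  imports Defs
begin

text \<open>
  The theorem follows from a choice-free construction of injections \<open>E d : d \<rightarrow> \<mu>\<close>, simultaneously for all
  \<open>d < \<mu>\<^sup>+\<close>. Given \<open>E\<close>, a cofinal map from a smaller ordinal into \<open>\<mu>\<^sup>+\<close> would inject \<open>\<mu>\<^sup>+\<close> into \<open>\<mu>\<close>, and a measure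
  on \<open>\<mu>\<^sup>+\<close> would do the same by Ulam's argument.

  Let \<open>\<kappa> = cf(\<mu>)\<close>. Since \<open>H(\<mu>)\<close> is well-ordered in type \<open>\<mu>\<close>, one can choose among its elements, and by
  Koenig's argument \<open>|P(\<kappa>)| < \<mu>\<close>, so that there are at most \<open>\<mu>\<close> ideals on \<open>\<kappa>\<close>. By dependent choice, functions
  \<open>f : \<kappa> \<rightarrow> \<mu>\<close> have a rank modulo each normal ideal \<open>I\<close> (Galvin and Hajnal), and every ordinal below \<open>\<mu>\<^sup>+\<close> is the
  rank modulo the nonstationary ideal of some \<open>f\<close> with \<open>|f(i)| \<le> |m(i)|\<close>, where \<open>m\<close> is continuous and cofinal
  in \<open>\<mu>\<close>. The sets whose addition to the dual filter raises the rank of \<open>f\<close> form an ideal \<open>J[f, I]\<close>, and \<open>f\<close> is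
  determined modulo \<open>J[f, I]\<close> by its rank and \<open>J[f, I]\<close>. So from each nonempty set of functions
  one can choose an ideal and a function modulo this ideal. One does this for the functions of each rank
  \<open>x < d\<close>, and then for the common upper bounds of those chosen for the same ideal. Pressing down below
  the upper bound codes \<open>x\<close> by an ideal and a bounded function on a subset of \<open>\<kappa>\<close>, an element of \<open>H(\<mu>)\<close>.

  Pressing down needs \<open>J[f, I]\<close> to be normal. The usual proof of this chooses \<open>\<kappa>\<close> many functions; here
  it suffices to choose the codes in \<open>H(\<mu>)\<close> of their pieces.
\<close>

section \<open>Definable predicates\<close>

text \<open>That each single ordinal below the successor injects into \<open>mu\<close> is trivial;
  the content is the simultaneous selection. The obstacle is that \<open>F0\<close> maps onto the
  successor by taking ranks, so it cannot be injected into \<open>mu\<close> and the well-ordering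
  of \<open>H\<close> does not reach it. Selections are therefore confined to ordinals, members of
  \<open>H\<close> and ideals on \<open>kap\<close>. The hypotheses enter as follows. Uncountable
  cofinality makes normal ideals countably complete, hence ranks well-founded, and makes the
  nonstationary ideal proper; dependent choice serves exactly these two points. From
  \<open>kap < mu\<close> it follows that functions from \<open>kap\<close> to \<open>kap\<close>
  lie in \<open>H\<close>. The size of \<open>H\<close> provides the injection \<open>b\<close>. The
  metalogic has a choice operator that must not leak into the model. Every set former is therefore
  accompanied by a proof that its defining expression is a first-order formula with parameters,
  which is the purpose of \<open>dfn\<close>, \<open>dft\<close> and the rules \<open>dfns\<close>.
  Inside formulas the descriptions \<open>the1\<close>, \<open>leastO\<close>, \<open>leastH\<close>
  and \<open>leastN\<close> take the place of Hilbert choice.\<close>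

primrec ren :: "(nat \<Rightarrow> nat) \<Rightarrow> fm \<Rightarrow> fm" where
  "ren r (Mem i j) = Mem (r i) (r j)"
| "ren r (Eq i j) = Eq (r i) (r j)"
| "ren r (Neg p) = Neg (ren r p)"
| "ren r (Conj p q) = Conj (ren r p) (ren r q)"
| "ren r (Forall i p) = Forall (r i) (ren r p)"

text \<open>Variables live at the even positions of an assignment, parameters at the odd ones.\<close>

definition mix :: "(nat \<Rightarrow> 'b) \<Rightarrow> (nat \<Rightarrow> 'b) \<Rightarrow> nat \<Rightarrow> 'b" where
  "mix s e n = (if even n then s (n div 2) else e (n div 2))"

lemma mix_even [simp]: "mix s e (2 * n) = s n" "mix s e 0 = s 0" "mix s e (Suc (Suc (2 * n))) = s (Suc n)"
  and mix_odd [simp]: "mix s e (Suc (2 * n)) = e n"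
  by (auto simp: mix_def)

named_theorems dfns

context membership
begin

text \<open>Bound variables are renamed together with the free ones, so injectivity of
  \<open>r\<close> is what prevents capture.\<close>

lemma sat_ren: "inj r \<Longrightarrow> sat (ren r p) s \<longleftrightarrow> sat p (s \<circ> r)"
proof (induction p arbitrary: s)
  case (Forall i p)
  have "(s(r i := x)) \<circ> r = (s \<circ> r)(i := x)" for x
    using Forall.prems by (auto simp: fun_eq_iff inj_def)
  then show ?case using Forall by (simp only: ren.simps sat.simps simp_thms)
qed auto

text \<open>The existentially quantified \<open>e\<close> supplies the parameters. Arguments are
  read from an assignment with the innermost bound variable at position 0, in the manner of de
  Bruijn indices, so that closure rules can be applied by resolution.\<close>

definition dfn :: "((nat \<Rightarrow> 'a) \<Rightarrow> bool) \<Rightarrow> bool" where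
  "dfn P \<longleftrightarrow> (\<exists>p e. \<forall>s. P s \<longleftrightarrow> sat p (mix s e))"

text \<open>A term is definable when its graph is: the value sits at position 0 and the arguments
  are shifted up by one.\<close>

definition dft :: "((nat \<Rightarrow> 'a) \<Rightarrow> 'a) \<Rightarrow> bool" where
  "dft t \<longleftrightarrow> dfn (\<lambda>s. s 0 = t (\<lambda>n. s (Suc n)))"

lemma dfn_ren: "inj r \<Longrightarrow> dfn P \<Longrightarrow> dfn (\<lambda>s. P (\<lambda>n. s (r n)))"
proof -
  assume r: "inj r" and "dfn P"
  then obtain p e where p: "\<And>s. P s \<longleftrightarrow> sat p (mix s e)" unfolding dfn_def by blast
  define q where "q n = (if even n then 2 * r (n div 2) else n)" for n
  have q: "inj q"
  proof (rule injI)
    fix x y assume a: "q x = q y"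
    have "even (q z) \<longleftrightarrow> even z" for z by (simp add: q_def)
    with a have e: "even x \<longleftrightarrow> even y" by metis
    show "x = y"
    proof (cases "even x")
      case True
      with a e r have "x div 2 = y div 2" by (simp add: q_def inj_eq)
      with True e show ?thesis by (metis dvd_mult_div_cancel)
    qed (use a e in \<open>simp add: q_def\<close>)
  qed
  have "mix s e \<circ> q = mix (\<lambda>n. s (r n)) e" for s
    by (auto simp: fun_eq_iff q_def mix_def)
  then show ?thesis
    unfolding dfn_def by (intro exI[of _ "ren q p"] exI[of _ e]) (simp add: sat_ren q p)
qed

lemma dfn_const [dfns]: "dfn (\<lambda>s. Q)"
proof (cases Q)
  case True
  show ?thesis unfolding dfn_def by (rule exI[of _ "Eq 0 0"]) (simp add: True)
next
  case False
  show ?thesis unfolding dfn_def by (rule exI[of _ "Neg (Eq 0 0)"]) (simp add: False)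
qed

lemma dfn_not [dfns]: "dfn P \<Longrightarrow> dfn (\<lambda>s. \<not> P s)"
  unfolding dfn_def by (elim exE, rule_tac x = "Neg p" in exI, rule_tac x = e in exI) simp

lemma dfn_conj [dfns]:
  assumes "dfn P" "dfn Q" shows "dfn (\<lambda>s. P s \<and> Q s)"
proof -
  obtain p e where p: "\<And>s. P s \<longleftrightarrow> sat p (mix s e)" using assms unfolding dfn_def by blast
  obtain q e' where q: "\<And>s. Q s \<longleftrightarrow> sat q (mix s e')" using assms unfolding dfn_def by blast
  \<comment> \<open>Two parameter assignments have to be merged into one, \<open>mix e e'\<close>.
    Accordingly the odd position 2k+1 of \<open>p\<close> goes to 4k+1 and that of \<open>q\<close>
    to 4k+3, while variables stay in place.\<close>
  define r1 where "r1 n = (if even n then n else 2 * n - 1)" for n :: nat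
  define r2 where "r2 n = (if even n then n else 2 * n + 1)" for n :: nat
  have r: "inj r1" "inj r2"
    by (rule injI; simp add: r1_def r2_def split: if_splits; presburger)+
  have m: "mix s (mix e e') \<circ> r1 = mix s e" "mix s (mix e e') \<circ> r2 = mix s e'" for s
  proof -
    have "r1 n = Suc (2 * (2 * (n div 2)))" "r2 n = Suc (2 * Suc (2 * (n div 2)))" if "odd n" for n
      using that by (auto simp: r1_def r2_def elim!: oddE)
    then have "mix s (mix e e') (r1 n) = mix s e n" "mix s (mix e e') (r2 n) = mix s e' n" if "odd n" for n
      using that mix_def[of s e n] mix_def[of s e' n]
      by (simp_all only: mix_odd mix_even if_False simp_thms)
    moreover have "mix s (mix e e') (r1 n) = mix s e n" "mix s (mix e e') (r2 n) = mix s e' n" if "even n" for n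
      using that by (simp_all add: r1_def r2_def mix_def)
    ultimately have "mix s (mix e e') (r1 n) = mix s e n" "mix s (mix e e') (r2 n) = mix s e' n" for n
      by blast+
    then show "mix s (mix e e') \<circ> r1 = mix s e" "mix s (mix e e') \<circ> r2 = mix s e'"
      by (simp_all add: fun_eq_iff)
  qed
  show ?thesis unfolding dfn_def
    by (intro exI[of _ "Conj (ren r1 p) (ren r2 q)"] exI[of _ "mix e e'"]) (simp add: sat_ren r m p q)
qed

lemma dfn_disj [dfns]: "dfn P \<Longrightarrow> dfn Q \<Longrightarrow> dfn (\<lambda>s. P s \<or> Q s)"
  using dfn_not[OF dfn_conj[OF dfn_not dfn_not], of P Q] by simp

lemma dfn_imp [dfns]: "dfn P \<Longrightarrow> dfn Q \<Longrightarrow> dfn (\<lambda>s. P s \<longrightarrow> Q s)"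
  using dfn_disj[OF dfn_not, of P Q] by simp

lemma dfn_iff [dfns]: "dfn P \<Longrightarrow> dfn Q \<Longrightarrow> dfn (\<lambda>s. P s = Q s)"
proof -
  assume *: "dfn P" "dfn Q"
  have "(\<lambda>s. P s = Q s) = (\<lambda>s. (P s \<longrightarrow> Q s) \<and> (Q s \<longrightarrow> P s))" by blast
  then show ?thesis using dfn_conj[OF dfn_imp dfn_imp, of P Q Q P] * by simp
qed

lemma dfn_all [dfns]:
  assumes "dfn (\<lambda>s. P (\<lambda>n. s (Suc n)) (s 0))" shows "dfn (\<lambda>s. \<forall>x. P s x)"
proof -
  obtain p e where p: "\<And>s. P (\<lambda>n. s (Suc n)) (s 0) \<longleftrightarrow> sat p (mix s e)"
    using assms unfolding dfn_def by blast
  \<comment> \<open>The bound variable, at position 0 of the body, becomes the named variable 1.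
    This position is free because the parameters move up by one place; the other variables move down
    from 2n+2 to 2n.\<close>
  define r where "r n = (if n = 0 then 1 else if even n then n - 2 else n + 2)" for n :: nat
  have r: "inj r"
    by (rule injI) (simp add: r_def split: if_splits; presburger)
  have m: "(mix s (case_nat undefined e))(1 := x) \<circ> r = mix (case_nat x s) e" for s x
    by (auto simp: fun_eq_iff r_def mix_def split: nat.splits elim!: oddE evenE)
  have P: "P = (\<lambda>s x. sat p (mix (case_nat x s) e))"
    using p[of "case_nat x s" for x s] by (auto simp: fun_eq_iff)
  then show ?thesis unfolding dfn_def
    by (intro exI[of _ "Forall 1 (ren r p)"] exI[of _ "case_nat undefined e"]) (simp only: P sat.simps sat_ren[OF r] m simp_thms)
qed

lemma dfn_ex [dfns]: "dfn (\<lambda>s. P (\<lambda>n. s (Suc n)) (s 0)) \<Longrightarrow> dfn (\<lambda>s. \<exists>x. P s x)"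
  using dfn_not[OF dfn_all[of "\<lambda>s x. \<not> P s x"]] dfn_not[of "\<lambda>s. P (\<lambda>n. s (Suc n)) (s 0)"] by simp

lemma dft_var [dfns]: "dft (\<lambda>s. s i)"
  unfolding dft_def dfn_def by (rule exI[of _ "Eq 0 (2 * Suc i)"]) simp

lemma dft_const [dfns]: "dft (\<lambda>s. c)"
proof -
  have "s 0 = c \<longleftrightarrow> sat (Eq 0 1) (mix s (\<lambda>_. c))" for s by (simp add: mix_def)
  then show ?thesis unfolding dft_def dfn_def by blast
qed

lemma dfn_eq_idx: "dfn (\<lambda>s. s i = s j)"
  unfolding dfn_def by (rule exI[of _ "Eq (2 * i) (2 * j)"]) simp

lemma dfn_mem_idx: "dfn (\<lambda>s. s i \<epsilon> s j)"
  unfolding dfn_def by (rule exI[of _ "Mem (2 * i) (2 * j)"]) simp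

lemma dft_shift: "dft t \<Longrightarrow> dft (\<lambda>s. t (\<lambda>n. s (Suc n)))"
  unfolding dft_def
  using dfn_ren[of "\<lambda>n. if n = 0 then 0 else Suc n" "\<lambda>s. s 0 = t (\<lambda>n. s (Suc n))"]
  by (simp add: inj_def)

text \<open>A term enters a formula through a quantified variable that is required to equal its
  value.\<close>

lemma subst_last:
  assumes "dfn (\<lambda>s. P (\<lambda>n. s (Suc n)) (s 0))" "dft t" shows "dfn (\<lambda>s. P s (t s))"
proof -
  have "dfn (\<lambda>s. \<exists>x. x = t s \<and> P s x)"
    using assms by (intro dfns) (simp_all add: dft_def)
  then show ?thesis by simp
qed

text \<open>With this rule and its variants for more arguments each notion is unfolded once, applied
  to variables; its \<open>dfns\<close> rule for arbitrary terms follows.\<close>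

lemma subst1:
  assumes "\<And>i. dfn (\<lambda>s. P (s i))" "dft t" shows "dfn (\<lambda>s. P (t s))"
  by (rule subst_last[of "\<lambda>s. P"]) (rule assms)+

lemma subst2:
  assumes "\<And>i j. dfn (\<lambda>s. P (s i) (s j))" "dft t" "dft u" shows "dfn (\<lambda>s. P (t s) (u s))"
proof -
  have *: "dfn (\<lambda>s. P (s i) (t s))" if "dft t" for i t
    by (rule subst_last[of "\<lambda>s. P (s i)"]) (rule assms that)+
  show ?thesis
    by (rule subst_last[of "\<lambda>s x. P x (u s)"]) (rule * dft_shift assms)+
qed

lemma subst3:
  assumes "\<And>i j k. dfn (\<lambda>s. P (s i) (s j) (s k))" "dft t" "dft u" "dft v"
  shows "dfn (\<lambda>s. P (t s) (u s) (v s))"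
proof -
  have *: "dfn (\<lambda>s. P (s i) (t s) (u s))" if "dft t" "dft u" for i t u
    by (rule subst_last[of "\<lambda>s x. P (s i) x (u s)"], rule subst_last[of "\<lambda>s y. P (s (Suc i)) (s 0) y"])
      (rule assms dft_shift that)+
  show ?thesis
    by (rule subst_last[of "\<lambda>s x. P x (u s) (v s)"]) (rule * dft_shift assms)+
qed

lemma subst4:
  assumes "\<And>i j k l. dfn (\<lambda>s. P (s i) (s j) (s k) (s l))" "dft t" "dft u" "dft v" "dft w"
  shows "dfn (\<lambda>s. P (t s) (u s) (v s) (w s))"
proof -
  have 1: "dfn (\<lambda>s. P (s i) (s j) (u s) (v s))" if "dft u" "dft v" for i j u v
    by (rule subst_last[of "\<lambda>s x. P (s i) (s j) x (v s)"],
        rule subst_last[of "\<lambda>s y. P (s (Suc i)) (s (Suc j)) (s 0) y"])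
      (rule assms dft_shift that)+
  have 2: "dfn (\<lambda>s. P (s i) (t s) (u s) (v s))" if "dft t" "dft u" "dft v" for i t u v
    by (rule subst_last[of "\<lambda>s x. P (s i) x (u s) (v s)"]) (rule 1 assms dft_shift that)+
  show ?thesis
    by (rule subst_last[of "\<lambda>s x. P x (u s) (v s) (w s)"]) (rule 2 dft_shift assms)+
qed

lemma dfn_eq [dfns]: "dft t \<Longrightarrow> dft u \<Longrightarrow> dfn (\<lambda>s. t s = u s)"
  by (rule subst2[where P = "(=)"]) (rule dfn_eq_idx)

lemma dfn_mem [dfns]: "dft t \<Longrightarrow> dft u \<Longrightarrow> dfn (\<lambda>s. t s \<epsilon> u s)"
  by (rule subst2[where P = "(\<epsilon>)"]) (rule dfn_mem_idx)

lemma tsubst1: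
  assumes "\<And>i. dft (\<lambda>s. F (s i))" "dft t" shows "dft (\<lambda>s. F (t s))"
proof -
  have "dfn (\<lambda>s. s i = F (s j))" for i j by (intro dfns assms)
  then have "dfn (\<lambda>s. s 0 = F (t (\<lambda>n. s (Suc n))))"
    by (rule subst2[where P = "\<lambda>y x. y = F x"]) (intro dft_var dft_shift assms)+
  then show ?thesis by (simp add: dft_def)
qed

lemma tsubst2:
  assumes "\<And>i j. dft (\<lambda>s. F (s i) (s j))" "dft t" "dft u" shows "dft (\<lambda>s. F (t s) (u s))"
proof -
  have "dfn (\<lambda>s. s i = F (s j) (s k))" for i j k by (intro dfns assms)
  then have "dfn (\<lambda>s. s 0 = F (t (\<lambda>n. s (Suc n))) (u (\<lambda>n. s (Suc n))))"
    by (rule subst3[where P = "\<lambda>y x z. y = F x z"]) (intro dft_var dft_shift assms)+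
  then show ?thesis by (simp add: dft_def)
qed

lemma tsubst3:
  assumes "\<And>i j k. dft (\<lambda>s. F (s i) (s j) (s k))" "dft t" "dft u" "dft v"
  shows "dft (\<lambda>s. F (t s) (u s) (v s))"
proof -
  have "dfn (\<lambda>s. s i = F (s j) (s k) (s l))" for i j k l by (intro dfns assms)
  then have "dfn (\<lambda>s. s 0 = F (t (\<lambda>n. s (Suc n))) (u (\<lambda>n. s (Suc n))) (v (\<lambda>n. s (Suc n))))"
    by (rule subst4[where P = "\<lambda>y x z w. y = F x z w"]) (intro dft_var dft_shift assms)+
  then show ?thesis by (simp add: dft_def)
qed

end

section \<open>Basic set theory\<close>

context membership
begin

text \<open>Definability of a body is stated with its bound variable at position 0 and its context
  right after it. When an operator such as \<open>the1\<close> is unfolded, the body reappears below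
  further quantifiers, and this moves it there.\<close>

lemma dfn_body:
  assumes "dfn (\<lambda>s. P (\<lambda>n. s (Suc n)) (s 0))" "inj r" "\<And>n. r n \<noteq> j"
  shows "dfn (\<lambda>s. P (\<lambda>n. s (r n)) (s j))"
proof -
  have "inj (case_nat j r)"
    using assms(2) assms(3)[symmetric] by (intro injI) (auto simp: inj_eq assms(3) split: nat.splits)
  from dfn_ren[OF this assms(1)] show ?thesis by simp
qed

text \<open>The junk value is a fixed element, so that descriptions are definable with parameters.\<close>

definition the1 :: "('a \<Rightarrow> bool) \<Rightarrow> 'a" where
  "the1 P = (if \<exists>!x. P x then THE x. P x else undefined)"

lemma the1_equality: "P x \<Longrightarrow> (\<And>y. P y \<Longrightarrow> y = x) \<Longrightarrow> the1 P = x"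
  unfolding the1_def by (metis (mono_tags, lifting) the_equality)

lemma dft_the1 [dfns]:
  assumes "dfn (\<lambda>s. P (\<lambda>n. s (Suc n)) (s 0))" shows "dft (\<lambda>s. the1 (P s))"
proof -
  have *: "y = the1 Q \<longleftrightarrow> (Q y \<and> (\<forall>z. Q z \<longrightarrow> z = y)) \<or>
      (\<not> (\<exists>x. Q x \<and> (\<forall>z. Q z \<longrightarrow> z = x)) \<and> y = undefined)" for y :: 'a and Q
  proof (cases "\<exists>x. Q x \<and> (\<forall>z. Q z \<longrightarrow> z = x)")
    case True
    then obtain x where x: "Q x" "\<And>z. Q z \<Longrightarrow> z = x" by blast
    then have "the1 Q = x" by (rule the1_equality)
    with x show ?thesis by blast
  next
    case False
    then have "the1 Q = undefined" unfolding the1_def by auto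
    with False show ?thesis by (simp only: \<open>the1 Q = undefined\<close>) blast
  qed
  have "inj (\<lambda>n. Suc (Suc n))" "inj (\<lambda>n. Suc (Suc (Suc n)))" by (simp_all add: inj_def)
  then show ?thesis
    unfolding dft_def *
    by (intro dfns assms dfn_body[of P "\<lambda>n. Suc (Suc n)" 0]
        dfn_body[of P "\<lambda>n. Suc (Suc (Suc n))" 0] dfn_body[of P "\<lambda>n. Suc (Suc n)" "Suc 0"]) simp_all
qed

lemma dft_if [dfns]:
  assumes "dfn P" "dft t" "dft u" shows "dft (\<lambda>s. if P s then t s else u s)"
proof -
  have *: "(y = (if Q then a else b)) \<longleftrightarrow> (Q \<and> y = a) \<or> (\<not> Q \<and> y = b)" for y a b :: 'a and Q by simp
  show ?thesis unfolding dft_def *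
    by (intro dfns dft_shift assms dfn_ren[of Suc P]) simp_all
qed

text \<open>The class may fail to be a set, and then the value is junk; \<open>coll_iff\<close>
  therefore asks for existence.\<close>

definition coll :: "('a \<Rightarrow> bool) \<Rightarrow> 'a" where
  "coll P = the1 (\<lambda>b. \<forall>x. x \<epsilon> b \<longleftrightarrow> P x)"

lemma dft_coll [dfns]:
  assumes "dfn (\<lambda>s. P (\<lambda>n. s (Suc n)) (s 0))" shows "dft (\<lambda>s. coll (P s))"
  unfolding coll_def
  by (intro dfns dfn_body[of P "\<lambda>n. Suc (Suc n)" 0] assms) (simp_all add: inj_def)

definition Sep :: "'a \<Rightarrow> ('a \<Rightarrow> bool) \<Rightarrow> 'a" where
  "Sep a P = coll (\<lambda>x. x \<epsilon> a \<and> P x)"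

lemma dft_Sep [dfns]:
  "dft a \<Longrightarrow> dfn (\<lambda>s. P (\<lambda>n. s (Suc n)) (s 0)) \<Longrightarrow> dft (\<lambda>s. Sep (a s) (P s))"
  unfolding Sep_def by (intro dfns dft_shift)

lemma dft_body:
  assumes "dft (\<lambda>s. F (\<lambda>n. s (Suc n)) (s 0))" shows "dft (\<lambda>s. F (\<lambda>n. s (Suc (Suc n))) (s 0))"
proof -
  have "inj (case_nat 0 (\<lambda>n. Suc (case_nat 0 (\<lambda>n. Suc (Suc n)) n)))"
    by (auto simp: inj_def split: nat.splits)
  from dfn_ren[OF this assms[unfolded dft_def]] show ?thesis
    unfolding dft_def by simp
qed

definition Rep :: "'a \<Rightarrow> ('a \<Rightarrow> 'a) \<Rightarrow> 'a" where
  "Rep a F = coll (\<lambda>y. \<exists>x. x \<epsilon> a \<and> y = F x)"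

lemma dft_Rep [dfns]:
  assumes "dft a" "dft (\<lambda>s. F (\<lambda>n. s (Suc n)) (s 0))" shows "dft (\<lambda>s. Rep (a s) (F s))"
  unfolding Rep_def by (intro dfns dft_shift dft_body assms)

definition emp :: 'a where "emp = coll (\<lambda>x. False)"
definition upr :: "'a \<Rightarrow> 'a \<Rightarrow> 'a" where "upr x y = coll (\<lambda>z. z = x \<or> z = y)"
definition pr :: "'a \<Rightarrow> 'a \<Rightarrow> 'a" where "pr x y = upr (upr x x) (upr x y)"
definition Uni :: "'a \<Rightarrow> 'a" where "Uni x = coll (\<lambda>z. \<exists>y. y \<epsilon> x \<and> z \<epsilon> y)"
definition pow :: "'a \<Rightarrow> 'a" where "pow x = coll (\<lambda>y. subset_of y x)"
definition un :: "'a \<Rightarrow> 'a \<Rightarrow> 'a" where "un x y = coll (\<lambda>z. z \<epsilon> x \<or> z \<epsilon> y)"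
definition suc :: "'a \<Rightarrow> 'a" where "suc x = coll (\<lambda>z. z \<epsilon> x \<or> z = x)"
definition fs :: "'a \<Rightarrow> 'a" where "fs p = the1 (\<lambda>x. \<exists>y. p = pr x y)"
definition sn :: "'a \<Rightarrow> 'a" where "sn p = the1 (\<lambda>y. \<exists>x. p = pr x y)"
definition prod :: "'a \<Rightarrow> 'a \<Rightarrow> 'a" where
  "prod A B = coll (\<lambda>p. \<exists>x y. x \<epsilon> A \<and> y \<epsilon> B \<and> p = pr x y)"
definition app :: "'a \<Rightarrow> 'a \<Rightarrow> 'a" where "app f x = the1 (\<lambda>y. pr x y \<epsilon> f)"
definition lam :: "'a \<Rightarrow> ('a \<Rightarrow> 'a) \<Rightarrow> 'a" where
  "lam A F = coll (\<lambda>p. \<exists>x. x \<epsilon> A \<and> p = pr x (F x))"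

lemma dfn_subset_of [dfns]: "dft t \<Longrightarrow> dft u \<Longrightarrow> dfn (\<lambda>s. subset_of (t s) (u s))"
  by (rule subst2[where P = subset_of], unfold subset_of_def, intro dfns)

lemma dft_upr [dfns]: "dft t \<Longrightarrow> dft u \<Longrightarrow> dft (\<lambda>s. upr (t s) (u s))"
  by (rule tsubst2[where F = upr], unfold upr_def, intro dfns)

lemma dft_pr [dfns]: "dft t \<Longrightarrow> dft u \<Longrightarrow> dft (\<lambda>s. pr (t s) (u s))"
  by (rule tsubst2[where F = pr], unfold pr_def, intro dfns)

lemma dft_Uni [dfns]: "dft t \<Longrightarrow> dft (\<lambda>s. Uni (t s))"
  by (rule tsubst1[where F = Uni], unfold Uni_def, intro dfns)

lemma dft_pow [dfns]: "dft t \<Longrightarrow> dft (\<lambda>s. pow (t s))"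
  by (rule tsubst1[where F = pow], unfold pow_def, intro dfns)

lemma dft_un [dfns]: "dft t \<Longrightarrow> dft u \<Longrightarrow> dft (\<lambda>s. un (t s) (u s))"
  by (rule tsubst2[where F = un], unfold un_def, intro dfns)

lemma dft_suc [dfns]: "dft t \<Longrightarrow> dft (\<lambda>s. suc (t s))"
  by (rule tsubst1[where F = suc], unfold suc_def, intro dfns)

lemma dft_fs [dfns]: "dft t \<Longrightarrow> dft (\<lambda>s. fs (t s))"
  by (rule tsubst1[where F = fs], unfold fs_def, intro dfns)

lemma dft_sn [dfns]: "dft t \<Longrightarrow> dft (\<lambda>s. sn (t s))"
  by (rule tsubst1[where F = sn], unfold sn_def, intro dfns)

lemma dft_prod [dfns]: "dft t \<Longrightarrow> dft u \<Longrightarrow> dft (\<lambda>s. prod (t s) (u s))"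
  by (rule tsubst2[where F = prod], unfold prod_def, intro dfns)

lemma dft_app [dfns]: "dft t \<Longrightarrow> dft u \<Longrightarrow> dft (\<lambda>s. app (t s) (u s))"
  by (rule tsubst2[where F = app], unfold app_def, intro dfns)

lemma dft_lam [dfns]:
  assumes "dft a" "dft (\<lambda>s. F (\<lambda>n. s (Suc n)) (s 0))" shows "dft (\<lambda>s. lam (a s) (F s))"
  unfolding lam_def by (intro dfns dft_shift dft_body assms)

text \<open>Unlike \<open>is_inj\<close>, this does not restrict the domain of the set \<open>f\<close>.\<close>

definition injf :: "'a \<Rightarrow> 'a \<Rightarrow> 'a \<Rightarrow> bool" where
  "injf f A B \<longleftrightarrow> (\<forall>x. x \<epsilon> A \<longrightarrow> app f x \<epsilon> B) \<and>
     (\<forall>x y. x \<epsilon> A \<and> y \<epsilon> A \<and> app f x = app f y \<longrightarrow> x = y)"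

definition lep :: "'a \<Rightarrow> 'a \<Rightarrow> bool" (infix "\<lesssim>" 50) where
  "A \<lesssim> B \<longleftrightarrow> (\<exists>f. injf f A B)"

lemma dfn_injf [dfns]: "dft t \<Longrightarrow> dft u \<Longrightarrow> dft v \<Longrightarrow> dfn (\<lambda>s. injf (t s) (u s) (v s))"
  by (rule subst3[where P = injf], unfold injf_def, intro dfns)

lemma dfn_lep [dfns]: "dft t \<Longrightarrow> dft u \<Longrightarrow> dfn (\<lambda>s. t s \<lesssim> u s)"
  by (rule subst2[where P = lep], unfold lep_def, intro dfns)

lemma subset_of_refl [simp]: "subset_of a a"
  and subset_of_trans: "subset_of a b \<Longrightarrow> subset_of b c \<Longrightarrow> subset_of a c"
  and subset_ofD: "subset_of a b \<Longrightarrow> x \<epsilon> a \<Longrightarrow> x \<epsilon> b"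
  by (auto simp: subset_of_def)

end

section \<open>Set formation from the axioms\<close>

context ZF_DC
begin

lemma ext: "(\<And>z. z \<epsilon> x \<longleftrightarrow> z \<epsilon> y) \<Longrightarrow> x = y"
  using extensionality by blast

lemma subset_antisym: "subset_of a b \<Longrightarrow> subset_of b a \<Longrightarrow> a = b"
  by (rule ext) (auto simp: subset_of_def)

lemma coll_iff: "\<exists>b. \<forall>x. x \<epsilon> b \<longleftrightarrow> P x \<Longrightarrow> x \<epsilon> coll P \<longleftrightarrow> P x"
proof -
  assume "\<exists>b. \<forall>x. x \<epsilon> b \<longleftrightarrow> P x"
  then obtain b where b: "\<And>x. x \<epsilon> b \<longleftrightarrow> P x" by blast
  have "coll P = b" unfolding coll_def
    by (rule the1_equality) (auto simp: b intro: ext)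
  then show ?thesis using b by simp
qed

text \<open>The definability hypothesis turns the predicate into an instance of the first-order
  schema, with its parameters at the odd positions of the assignment.\<close>

lemma Sep_iff:
  assumes "dfn (\<lambda>s. P (s 0))" shows "x \<epsilon> Sep a P \<longleftrightarrow> x \<epsilon> a \<and> P x"
proof -
  obtain p e where p: "\<And>s. P (s 0) \<longleftrightarrow> sat p (mix s e)" using assms unfolding dfn_def by blast
  have "(mix (\<lambda>_. undefined) e)(0 := x) = mix ((\<lambda>_. undefined)(0 := x)) e" for x
    by (auto simp: fun_eq_iff mix_def)
  then have "sat p ((mix (\<lambda>_. undefined) e)(0 := x)) \<longleftrightarrow> P x" for x
    using p[of "(\<lambda>_. undefined)(0 := x)"] by simp
  with separation[of a p "mix (\<lambda>_. undefined) e"] show ?thesis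
    unfolding Sep_def by (intro coll_iff) simp
qed

lemma Rep_iff:
  assumes "dft (\<lambda>s. F (s 0))" shows "y \<epsilon> Rep a F \<longleftrightarrow> (\<exists>x. x \<epsilon> a \<and> y = F x)"
proof -
  have "dfn (\<lambda>s. s 1 = F (s 0))" by (intro dfns assms)
  then obtain p e where p: "\<And>s. s 1 = F (s 0) \<longleftrightarrow> sat p (mix s e)" unfolding dfn_def by blast
  \<comment> \<open>The value is variable 1, which \<open>mix\<close> stores at position 2, whereas
    the replacement axiom expects it at position 1, a parameter position. Hence the two positions
    are swapped.\<close>
  define r :: "nat \<Rightarrow> nat" where "r n = (if n = 1 then 2 else if n = 2 then 1 else n)" for n
  have r: "inj r" by (rule inj_on_inverseI[of _ r]) (simp add: r_def)
  define S where "S = mix (\<lambda>_. undefined) e \<circ> r"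
  have "S(0 := x, 1 := y) \<circ> r = mix ((\<lambda>_. undefined)(0 := x, 1 := y)) e" for x y
  proof
    fix n :: nat
    consider "n = 0" | "n = 1" | "n = 2" | "n > 2" by linarith
    then show "(S(0 := x, 1 := y) \<circ> r) n = mix ((\<lambda>_. undefined)(0 := x, 1 := y)) e n"
      by cases (auto simp: mix_def S_def r_def)
  qed
  then have *: "sat (ren r p) (S(0 := x, 1 := y)) \<longleftrightarrow> y = F x" for x y
    using p[of "(\<lambda>_. undefined)(0 := x, 1 := y)"] by (simp add: sat_ren[OF r])
  have "\<exists>b. \<forall>y. y \<epsilon> b \<longleftrightarrow> (\<exists>x. x \<epsilon> a \<and> sat (ren r p) (S(0 := x, 1 := y)))"
    by (rule replacement) (simp only: *, simp)
  then show ?thesis unfolding Rep_def * by (rule coll_iff)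
qed

lemma emp_iff [simp]: "\<not> x \<epsilon> emp"
proof -
  have "x \<epsilon> Sep a (\<lambda>x. False) \<longleftrightarrow> False" for x a by (subst Sep_iff) (intro dfns, simp)
  then have "x \<epsilon> emp \<longleftrightarrow> False" unfolding emp_def by (intro coll_iff) blast
  then show ?thesis by simp
qed

lemma is_empty_iff: "is_empty x \<longleftrightarrow> x = emp"
  unfolding is_empty_def using ext emp_iff by metis

lemma upr_iff [simp]: "z \<epsilon> upr x y \<longleftrightarrow> z = x \<or> z = y"
  unfolding upr_def by (rule coll_iff) (use pairing in \<open>simp add: is_upair_def\<close>)

lemma Uni_iff [simp]: "z \<epsilon> Uni x \<longleftrightarrow> (\<exists>y. y \<epsilon> x \<and> z \<epsilon> y)"
  unfolding Uni_def by (rule coll_iff) (rule union)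

lemma pow_iff [simp]: "z \<epsilon> pow x \<longleftrightarrow> subset_of z x"
  unfolding pow_def by (rule coll_iff) (rule power_set)

lemma un_iff [simp]: "z \<epsilon> un x y \<longleftrightarrow> z \<epsilon> x \<or> z \<epsilon> y"
  unfolding un_def by (rule coll_iff, rule exI[of _ "Uni (upr x y)"]) auto

lemma suc_iff [simp]: "z \<epsilon> suc x \<longleftrightarrow> z \<epsilon> x \<or> z = x"
  unfolding suc_def by (rule coll_iff, rule exI[of _ "un x (upr x x)"]) auto

lemma upr_eq: "upr a b = upr c d \<longleftrightarrow> (a = c \<and> b = d) \<or> (a = d \<and> b = c)"
proof
  assume "upr a b = upr c d"
  then have "z = a \<or> z = b \<longleftrightarrow> z = c \<or> z = d" for z by (metis upr_iff)
  then show "(a = c \<and> b = d) \<or> (a = d \<and> b = c)" by metis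
qed (auto intro: ext)

lemma pr_eq [simp]: "pr a b = pr c d \<longleftrightarrow> a = c \<and> b = d"
  unfolding pr_def upr_eq by auto

lemma is_upair_iff: "is_upair p x y \<longleftrightarrow> p = upr x y"
  unfolding is_upair_def by (auto intro: ext)

lemma is_pair_iff: "is_pair p x y \<longleftrightarrow> p = pr x y"
  unfolding is_pair_def is_upair_iff pr_def by (auto intro: ext)

lemma related_iff: "related r x y \<longleftrightarrow> pr x y \<epsilon> r"
  unfolding related_def is_pair_iff by blast

lemma is_succ_iff: "is_succ x y \<longleftrightarrow> y = suc x"
  unfolding is_succ_def by (auto intro: ext)

lemma fs_pr [simp]: "fs (pr x y) = x" and sn_pr [simp]: "sn (pr x y) = y"
  unfolding fs_def sn_def by (rule the1_equality; auto)+

lemma prod_iff: "p \<epsilon> prod A B \<longleftrightarrow> (\<exists>x y. x \<epsilon> A \<and> y \<epsilon> B \<and> p = pr x y)"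
proof -
  have 1: "p \<epsilon> Rep A (\<lambda>x. pr x y) \<longleftrightarrow> (\<exists>x. x \<epsilon> A \<and> p = pr x y)" for p y
    by (rule Rep_iff) (intro dfns)
  have 2: "q \<epsilon> Rep B (\<lambda>y. Rep A (\<lambda>x. pr x y)) \<longleftrightarrow> (\<exists>y. y \<epsilon> B \<and> q = Rep A (\<lambda>x. pr x y))" for q
    by (rule Rep_iff) (intro dfns)
  show ?thesis unfolding prod_def
    by (rule coll_iff, rule exI[of _ "Uni (Rep B (\<lambda>y. Rep A (\<lambda>x. pr x y)))"]) (auto simp: 1 2)
qed

lemma pr_prod [simp]: "pr x y \<epsilon> prod A B \<longleftrightarrow> x \<epsilon> A \<and> y \<epsilon> B"
  by (auto simp: prod_iff)

lemma lam_iff: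
  assumes "dft (\<lambda>s. F (s 0))" shows "p \<epsilon> lam A F \<longleftrightarrow> (\<exists>x. x \<epsilon> A \<and> p = pr x (F x))"
proof -
  have "p \<epsilon> Rep A (\<lambda>x. pr x (F x)) \<longleftrightarrow> (\<exists>x. x \<epsilon> A \<and> p = pr x (F x))" for p
    by (rule Rep_iff) (intro dfns assms)
  then show ?thesis unfolding lam_def by (intro coll_iff) blast
qed

lemma app_eq: "pr x y \<epsilon> f \<Longrightarrow> (\<And>z. pr x z \<epsilon> f \<Longrightarrow> z = y) \<Longrightarrow> app f x = y"
  unfolding app_def by (rule the1_equality)

lemma app_lam:
  assumes "dft (\<lambda>s. F (s 0))" "x \<epsilon> A" shows "app (lam A F) x = F x"
  by (rule app_eq) (auto simp: lam_iff[OF assms(1)] assms(2))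

lemma dfn_is_fun [dfns]: "dft t \<Longrightarrow> dft u \<Longrightarrow> dft v \<Longrightarrow> dfn (\<lambda>s. is_fun (t s) (u s) (v s))"
  by (rule subst3[where P = is_fun])
    (unfold is_fun_def Ex1_def related_iff is_pair_iff, intro dfns)

lemma lam_is_fun:
  assumes "dft (\<lambda>s. F (s 0))" "\<And>x. x \<epsilon> A \<Longrightarrow> F x \<epsilon> B" shows "is_fun (lam A F) A B"
  unfolding is_fun_def related_iff is_pair_iff using assms(2) by (auto simp: lam_iff[OF assms(1)])

lemma is_fun_related: "is_fun f A B \<Longrightarrow> related f x y \<longleftrightarrow> x \<epsilon> A \<and> y = app f x"
proof -
  assume f: "is_fun f A B"
  have a: "x \<epsilon> A" if "pr x y \<epsilon> f" for x y
    using f that unfolding is_fun_def is_pair_iff by fastforce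
  have b: "app f x = y" if "pr x y \<epsilon> f" for y
    using f a[OF that] that unfolding is_fun_def related_iff by (intro app_eq) auto
  have "pr x (app f x) \<epsilon> f" if "x \<epsilon> A"
    using f that b unfolding is_fun_def related_iff by blast
  then show ?thesis unfolding related_iff using a b by blast
qed

lemma is_fun_app: "is_fun f A B \<Longrightarrow> x \<epsilon> A \<Longrightarrow> app f x \<epsilon> B"
proof -
  assume f: "is_fun f A B" and x: "x \<epsilon> A"
  have "pr x (app f x) \<epsilon> f" using is_fun_related[OF f] x by (simp add: related_iff)
  then show ?thesis using f unfolding is_fun_def is_pair_iff by fastforce
qed

lemma is_inj_injf: "is_inj f A B \<Longrightarrow> injf f A B"
  unfolding is_inj_def injf_def using is_fun_app is_fun_related by metis

lemma injf_is_inj: "injf f A B \<Longrightarrow> is_inj (lam A (app f)) A B"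
proof -
  assume f: "injf f A B"
  have d: "dft (\<lambda>s. app f (s 0))" by (intro dfns)
  have "is_fun (lam A (app f)) A B" by (rule lam_is_fun[OF d]) (use f in \<open>simp add: injf_def\<close>)
  from is_fun_related[OF this] this f show ?thesis
    unfolding is_inj_def injf_def using app_lam[OF d] by metis
qed

lemma lepI:
  assumes "dft (\<lambda>s. F (s 0))" "\<And>x. x \<epsilon> A \<Longrightarrow> F x \<epsilon> B"
    "\<And>x y. x \<epsilon> A \<Longrightarrow> y \<epsilon> A \<Longrightarrow> F x = F y \<Longrightarrow> x = y"
  shows "A \<lesssim> B"
  unfolding lep_def injf_def
  by (rule exI[of _ "lam A F"]) (use assms in \<open>auto simp: app_lam\<close>)

lemma lep_trans [trans]: "A \<lesssim> B \<Longrightarrow> B \<lesssim> C \<Longrightarrow> A \<lesssim> C"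
proof -
  assume "A \<lesssim> B" "B \<lesssim> C"
  then obtain f g where "injf f A B" "injf g B C" unfolding lep_def by blast
  note f = this(1)[unfolded injf_def] and g = this(2)[unfolded injf_def]
  show ?thesis
  proof (rule lepI[of "\<lambda>x. app g (app f x)"])
    show "dft (\<lambda>s. app g (app f (s 0)))" by (intro dfns)
    show "app g (app f x) \<epsilon> C" if "x \<epsilon> A" for x using f g that by blast
    show "x = y" if "x \<epsilon> A" "y \<epsilon> A" "app g (app f x) = app g (app f y)" for x y
      using f g that by blast
  qed
qed

lemma subset_lep: "subset_of A B \<Longrightarrow> A \<lesssim> B"
  by (rule lepI[where F = "\<lambda>x. x"]) (intro dfns, auto simp: subset_of_def)

lemma equipollent_lep: "equipollent A B \<Longrightarrow> A \<lesssim> B"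
  unfolding equipollent_def is_bij_def lep_def using is_inj_injf by blast

lemma equipollentI:
  assumes "dft (\<lambda>s. F (s 0))" "\<And>x. x \<epsilon> A \<Longrightarrow> F x \<epsilon> B"
    "\<And>x y. x \<epsilon> A \<Longrightarrow> y \<epsilon> A \<Longrightarrow> F x = F y \<Longrightarrow> x = y" "\<And>y. y \<epsilon> B \<Longrightarrow> \<exists>x. x \<epsilon> A \<and> F x = y"
  shows "equipollent A B"
proof -
  have f: "is_fun (lam A F) A B" using assms by (intro lam_is_fun) auto
  then show ?thesis
    unfolding equipollent_def is_bij_def is_inj_def
    using assms by (intro exI[of _ "lam A F"]) (fastforce simp: is_fun_related[OF f] app_lam)
qed

lemma bij_app:
  assumes "is_bij f A B"
  shows "\<And>x. x \<epsilon> A \<Longrightarrow> app f x \<epsilon> B" "\<And>x y. x \<epsilon> A \<Longrightarrow> y \<epsilon> A \<Longrightarrow> app f x = app f y \<Longrightarrow> x = y"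
    "\<And>y. y \<epsilon> B \<Longrightarrow> \<exists>x. x \<epsilon> A \<and> app f x = y"
proof -
  have f: "is_fun f A B" "is_inj f A B" using assms unfolding is_bij_def is_inj_def by auto
  from is_inj_injf[OF f(2)] show "\<And>x. x \<epsilon> A \<Longrightarrow> app f x \<epsilon> B"
    "\<And>x y. x \<epsilon> A \<Longrightarrow> y \<epsilon> A \<Longrightarrow> app f x = app f y \<Longrightarrow> x = y" unfolding injf_def by auto
  show "\<And>y. y \<epsilon> B \<Longrightarrow> \<exists>x. x \<epsilon> A \<and> app f x = y"
    using assms is_fun_related[OF f(1)] unfolding is_bij_def by fastforce
qed

lemma equipollent_sym: "equipollent A B \<Longrightarrow> equipollent B A"
proof -
  assume "equipollent A B"
  then obtain f where "is_bij f A B" unfolding equipollent_def by blast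
  note f = bij_app[OF this]
  have *: "the1 (\<lambda>x. x \<epsilon> A \<and> app f x = app f z) = z" if "z \<epsilon> A" for z
    by (rule the1_equality) (use that f(2) in auto)
  show ?thesis
  proof (rule equipollentI[of "\<lambda>y. the1 (\<lambda>x. x \<epsilon> A \<and> app f x = y)"])
    show "dft (\<lambda>s. the1 (\<lambda>x. x \<epsilon> A \<and> app f x = s 0))" by (intro dfns)
    show "the1 (\<lambda>x. x \<epsilon> A \<and> app f x = y) \<epsilon> A" if "y \<epsilon> B" for y
      using f(3)[OF that] * by auto
    show "x = y" if "x \<epsilon> B" "y \<epsilon> B"
      "the1 (\<lambda>z. z \<epsilon> A \<and> app f z = x) = the1 (\<lambda>z. z \<epsilon> A \<and> app f z = y)" for x y
      using f(3)[OF that(1)] f(3)[OF that(2)] that(3) * by auto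
    show "\<exists>x. x \<epsilon> B \<and> the1 (\<lambda>z. z \<epsilon> A \<and> app f z = x) = y" if "y \<epsilon> A" for y
      using that f(1) * by blast
  qed
qed

lemma equipollent_trans: "equipollent A B \<Longrightarrow> equipollent B C \<Longrightarrow> equipollent A C"
proof -
  assume "equipollent A B" "equipollent B C"
  then obtain f g where "is_bij f A B" "is_bij g B C" unfolding equipollent_def by blast
  note f = bij_app[OF this(1)] and g = bij_app[OF this(2)]
  show ?thesis
  proof (rule equipollentI[of "\<lambda>x. app g (app f x)"])
    show "dft (\<lambda>s. app g (app f (s 0)))" by (intro dfns)
    show "app g (app f x) \<epsilon> C" if "x \<epsilon> A" for x using f(1) g(1) that by blast
    show "x = y" if "x \<epsilon> A" "y \<epsilon> A" "app g (app f x) = app g (app f y)" for x y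
      using f(1,2) g(2) that by blast
    show "\<exists>x. x \<epsilon> A \<and> app g (app f x) = y" if "y \<epsilon> C" for y
      using f(3) g(3)[OF that] by blast
  qed
qed

lemma equipollent_refl: "equipollent A A"
  by (rule equipollentI[of "\<lambda>x. x"]) (intro dfns, auto)

lemma lep_equipollent_image:
  assumes "injf f A B" shows "equipollent A (Rep A (app f))" "subset_of (Rep A (app f)) B"
proof -
  have *: "y \<epsilon> Rep A (app f) \<longleftrightarrow> (\<exists>x. x \<epsilon> A \<and> y = app f x)" for y
    by (rule Rep_iff) (intro dfns)
  show "equipollent A (Rep A (app f))"
    by (rule equipollentI[of "app f"]) (intro dfns, use assms in \<open>auto simp: * injf_def\<close>)
  show "subset_of (Rep A (app f)) B"
    using assms by (auto simp: subset_of_def * injf_def)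
qed

end

section \<open>Ordinals\<close>

context membership
begin

lemma dfn_is_empty [dfns]: "dft t \<Longrightarrow> dfn (\<lambda>s. is_empty (t s))"
  by (rule subst1[where P = is_empty], unfold is_empty_def, intro dfns)

lemma dfn_transitive_set [dfns]: "dft t \<Longrightarrow> dfn (\<lambda>s. transitive_set (t s))"
  by (rule subst1[where P = transitive_set], unfold transitive_set_def, intro dfns)

lemma dfn_ordinal [dfns]: "dft t \<Longrightarrow> dfn (\<lambda>s. ordinal (t s))"
  by (rule subst1[where P = ordinal], unfold ordinal_def well_orders_def, intro dfns)

text \<open>This acts as a definable choice function on nonempty classes of ordinals.\<close>

definition leastO :: "('a \<Rightarrow> bool) \<Rightarrow> 'a" where
  "leastO P = the1 (\<lambda>x. ordinal x \<and> P x \<and> (\<forall>y. y \<epsilon> x \<longrightarrow> \<not> P y))"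

lemma dft_leastO [dfns]:
  assumes "dfn (\<lambda>s. P (\<lambda>n. s (Suc n)) (s 0))" shows "dft (\<lambda>s. leastO (P s))"
  unfolding leastO_def
  by (intro dfns dfn_body[of P "\<lambda>n. Suc (Suc n)" 0] assms) (simp_all add: inj_def)

definition om :: 'a where "om = coll (\<lambda>x. \<forall>u. is_inductive u \<longrightarrow> x \<epsilon> u)"

end

context ZF_DC
begin

lemma found_min:
  assumes "dfn (\<lambda>s. P (s 0))" "x \<epsilon> a" "P x"
  obtains m where "m \<epsilon> a" "P m" "\<And>z. z \<epsilon> m \<Longrightarrow> z \<epsilon> a \<Longrightarrow> \<not> P z"
proof -
  note * = Sep_iff[OF assms(1)]
  have "\<not> is_empty (Sep a P)" unfolding is_empty_def using assms(2,3) * by blast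
  from foundation[OF this] obtain m where "m \<epsilon> Sep a P" "\<forall>z. z \<epsilon> Sep a P \<longrightarrow> \<not> z \<epsilon> m" by blast
  then show ?thesis using * by (intro that[of m]) auto
qed

lemma mem_irrefl: "\<not> x \<epsilon> x"
proof -
  have "dfn (\<lambda>s. True)" by (intro dfns)
  from found_min[where P = "\<lambda>_. True", OF this, of x "upr x x"] show ?thesis by auto
qed

lemma mem_asym: "x \<epsilon> y \<Longrightarrow> \<not> y \<epsilon> x"
proof -
  have "dfn (\<lambda>s. True)" by (intro dfns)
  from found_min[where P = "\<lambda>_. True", OF this, of x "upr x y"] show "x \<epsilon> y \<Longrightarrow> \<not> y \<epsilon> x" by auto
qed

lemma transD: "transitive_set t \<Longrightarrow> x \<epsilon> y \<Longrightarrow> y \<epsilon> t \<Longrightarrow> x \<epsilon> t"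
  unfolding transitive_set_def subset_of_def by blast

lemma ord_transitive: "ordinal a \<Longrightarrow> transitive_set a"
  by (simp add: ordinal_def)

lemma ord_trans: "ordinal a \<Longrightarrow> x \<epsilon> y \<Longrightarrow> y \<epsilon> a \<Longrightarrow> x \<epsilon> a"
  using transD ord_transitive by blast

lemma ord_linear_inside: "ordinal a \<Longrightarrow> x \<epsilon> a \<Longrightarrow> y \<epsilon> a \<Longrightarrow> x \<epsilon> y \<or> x = y \<or> y \<epsilon> x"
  unfolding ordinal_def well_orders_def by blast

lemma well_orders_subset: "well_orders R A \<Longrightarrow> subset_of B A \<Longrightarrow> well_orders R B"
  unfolding well_orders_def subset_of_def by (elim conjE, intro conjI; meson)

lemma ord_elem: assumes a: "ordinal a" and x: "x \<epsilon> a" shows "ordinal x"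
proof -
  have sub: "subset_of x a" using a x unfolding ordinal_def transitive_set_def by blast
  have w: "well_orders (\<epsilon>) a" using a by (simp add: ordinal_def)
  have "transitive_set x"
    unfolding transitive_set_def subset_of_def
  proof (intro allI impI)
    fix y z assume "y \<epsilon> x" "z \<epsilon> y"
    then show "z \<epsilon> x" using w sub x ord_trans[OF a, of z y] unfolding well_orders_def subset_of_def by blast
  qed
  moreover have "well_orders (\<epsilon>) x"
    using w sub by (rule well_orders_subset)
  ultimately show ?thesis by (simp add: ordinal_def)
qed

lemma ord_psubset:
  assumes a: "ordinal a" and b: "ordinal b" and ab: "subset_of a b" "a \<noteq> b" shows "a \<epsilon> b"
proof -
  have "\<exists>x. x \<epsilon> b \<and> \<not> x \<epsilon> a" using ab subset_antisym unfolding subset_of_def by blast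
  moreover have "dfn (\<lambda>s. \<not> s 0 \<epsilon> a)" by (intro dfns)
  ultimately obtain m where m: "m \<epsilon> b" "\<not> m \<epsilon> a" "\<And>z. z \<epsilon> m \<Longrightarrow> z \<epsilon> b \<Longrightarrow> z \<epsilon> a"
    using found_min[where P = "\<lambda>x. \<not> x \<epsilon> a"] by metis
  have "m = a"
  proof (rule ext)
    fix z show "z \<epsilon> m \<longleftrightarrow> z \<epsilon> a"
      using m(2,3) ord_trans[OF b _ m(1), of z] ord_linear_inside[OF b _ m(1), of z]
        subset_ofD[OF ab(1), of z] ord_trans[OF a, of m z] by blast
  qed
  then show ?thesis using m(1) by simp
qed

lemma ord_cases:
  assumes a: "ordinal a" and b: "ordinal b"
  obtains "a \<epsilon> b" | "a = b" | "b \<epsilon> a"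
proof -
  define c where "c = Sep a (\<lambda>x. x \<epsilon> b)"
  have c: "x \<epsilon> c \<longleftrightarrow> x \<epsilon> a \<and> x \<epsilon> b" for x
    unfolding c_def by (rule Sep_iff) (intro dfns)
  have "transitive_set c"
    unfolding transitive_set_def subset_of_def c using ord_trans[OF a] ord_trans[OF b] by blast
  moreover have "well_orders (\<epsilon>) c"
  proof -
    have "well_orders (\<epsilon>) a" "subset_of c a" using a by (simp_all add: ordinal_def subset_of_def c)
    then show ?thesis by (rule well_orders_subset)
  qed
  ultimately have o: "ordinal c" by (simp add: ordinal_def)
  have s: "subset_of c a" "subset_of c b" by (auto simp: subset_of_def c)
  show ?thesis
    using ord_psubset[OF o a s(1)] ord_psubset[OF o b s(2)] c[of c] mem_irrefl[of c] that by metis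
qed

lemma ord_subset_iff: "ordinal a \<Longrightarrow> ordinal b \<Longrightarrow> subset_of a b \<longleftrightarrow> a \<epsilon> b \<or> a = b"
  using ord_psubset ord_trans unfolding subset_of_def by blast

lemma ord_mem_subset: "ordinal b \<Longrightarrow> a \<epsilon> b \<Longrightarrow> subset_of a b"
  using ord_subset_iff ord_elem by blast

lemma ord_not_mem: "ordinal a \<Longrightarrow> ordinal b \<Longrightarrow> \<not> a \<epsilon> b \<longleftrightarrow> subset_of b a"
  by (metis mem_irrefl ord_cases ord_subset_iff subset_ofD)

lemma ord_total: "ordinal a \<Longrightarrow> ordinal b \<Longrightarrow> subset_of a b \<or> b \<epsilon> a"
  using ord_not_mem by blast

lemma ord_sub_mem: "ordinal c \<Longrightarrow> ordinal a \<Longrightarrow> subset_of a b \<Longrightarrow> b \<epsilon> c \<Longrightarrow> a \<epsilon> c"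
  by (metis ord_elem ord_subset_iff ord_trans)

text \<open>The class \<open>P\<close> need not be a set; Foundation is applied to its part inside
  \<open>suc x\<close>.\<close>

lemma ord_min:
  assumes "dfn (\<lambda>s. P (s 0))" "ordinal x" "P x"
  obtains m where "ordinal m" "P m" "\<And>z. z \<epsilon> m \<Longrightarrow> \<not> P z" "subset_of m x"
proof -
  obtain m where m: "m \<epsilon> suc x" "P m" "\<And>z. z \<epsilon> m \<Longrightarrow> z \<epsilon> suc x \<Longrightarrow> \<not> P z"
    by (rule found_min[where P = P and x = x and a = "suc x"]) (use assms in auto)
  have "ordinal m" using m(1) assms(2) ord_elem by auto
  moreover have "subset_of m x" using m(1) assms(2) ord_mem_subset by auto
  ultimately show ?thesis using that m by (auto dest: subset_ofD)
qed

lemma ordI: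
  assumes "transitive_set a" "\<And>x. x \<epsilon> a \<Longrightarrow> ordinal x" shows "ordinal a"
proof -
  have "\<exists>m. m \<epsilon> b \<and> (\<forall>y. y \<epsilon> b \<longrightarrow> m = y \<or> m \<epsilon> y)" if b: "subset_of b a" "\<not> is_empty b" for b
  proof -
    obtain m where m: "m \<epsilon> b" "\<forall>z. z \<epsilon> b \<longrightarrow> \<not> z \<epsilon> m" using foundation[OF b(2)] by blast
    have "m = y \<or> m \<epsilon> y" if "y \<epsilon> b" for y
      using m that assms(2) b(1) unfolding subset_of_def by (metis ord_cases)
    then show ?thesis using m(1) by blast
  qed
  moreover have "x \<epsilon> y \<or> x = y \<or> y \<epsilon> x" if "x \<epsilon> a" "y \<epsilon> a" for x y
    using that assms(2) by (metis ord_cases)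
  moreover have "x \<epsilon> z" if "x \<epsilon> y" "y \<epsilon> z" "z \<epsilon> a" for x y z
    using that assms(2) ord_trans by blast
  ultimately have "well_orders (\<epsilon>) a"
    unfolding well_orders_def using mem_irrefl by (intro conjI) blast+
  with assms(1) show ?thesis by (simp add: ordinal_def)
qed

lemma ord_suc [simp]:
  assumes "ordinal a" shows "ordinal (suc a)"
proof (rule ordI)
  show "transitive_set (suc a)"
    using ord_trans[OF assms] unfolding transitive_set_def subset_of_def suc_iff by blast
qed (use assms ord_elem in \<open>auto simp: suc_iff\<close>)

lemma suc_subset: "ordinal a \<Longrightarrow> ordinal b \<Longrightarrow> subset_of (suc a) b \<longleftrightarrow> a \<epsilon> b"
  using ord_trans[of b _ a] unfolding subset_of_def suc_iff by blast

lemma ord_Uni: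
  assumes "\<And>x. x \<epsilon> a \<Longrightarrow> ordinal x" shows "ordinal (Uni a)"
proof (rule ordI)
  show "transitive_set (Uni a)"
    using ord_trans[OF assms] unfolding transitive_set_def subset_of_def Uni_iff by blast
qed (use assms ord_elem in auto)

lemma ord_emp [simp]: "ordinal emp"
  by (rule ordI) (auto simp: transitive_set_def)

lemma ord_emp_mem: "ordinal a \<Longrightarrow> a \<noteq> emp \<Longrightarrow> emp \<epsilon> a"
  by (metis emp_iff ord_cases ord_emp)

lemma ord_induct [consumes 1, case_names dfn step]:
  assumes "ordinal a" "dfn (\<lambda>s. P (s 0))" "\<And>x. ordinal x \<Longrightarrow> (\<And>y. y \<epsilon> x \<Longrightarrow> P y) \<Longrightarrow> P x"
  shows "P a"
proof (rule ccontr)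
  assume "\<not> P a"
  moreover have "dfn (\<lambda>s. \<not> P (s 0))" by (intro dfns assms)
  ultimately show False using ord_min[where P = "\<lambda>x. \<not> P x", of a] assms(1,3) by metis
qed

lemma leastO:
  assumes "dfn (\<lambda>s. P (s 0))" "ordinal x" "P x"
  shows "ordinal (leastO P)" "P (leastO P)" "\<And>z. z \<epsilon> leastO P \<Longrightarrow> \<not> P z" "subset_of (leastO P) x"
proof -
  obtain m where m: "ordinal m" "P m" "\<And>z. z \<epsilon> m \<Longrightarrow> \<not> P z" "subset_of m x"
    using ord_min[where P = P] assms by metis
  have "leastO P = m" unfolding leastO_def
    by (rule the1_equality) (use m in \<open>auto elim: ord_cases\<close>)
  with m show "ordinal (leastO P)" "P (leastO P)" "\<And>z. z \<epsilon> leastO P \<Longrightarrow> \<not> P z" "subset_of (leastO P) x"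
    by auto
qed

lemma dfn_is_inductive [dfns]: "dft t \<Longrightarrow> dfn (\<lambda>s. is_inductive (t s))"
  by (rule subst1[where P = is_inductive], unfold is_inductive_def is_empty_iff is_succ_iff, intro dfns)

lemma om_iff: "x \<epsilon> om \<longleftrightarrow> (\<forall>u. is_inductive u \<longrightarrow> x \<epsilon> u)"
proof -
  obtain w where w: "is_inductive w" using infinity by blast
  have "x \<epsilon> Sep w (\<lambda>x. \<forall>u. is_inductive u \<longrightarrow> x \<epsilon> u) \<longleftrightarrow> x \<epsilon> w \<and> (\<forall>u. is_inductive u \<longrightarrow> x \<epsilon> u)" for x
    by (rule Sep_iff) (intro dfns)
  then show ?thesis unfolding om_def using w by (intro coll_iff) blast
qed

lemma om_emp [simp]: "emp \<epsilon> om" and om_suc [simp]: "n \<epsilon> om \<Longrightarrow> suc n \<epsilon> om"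
  unfolding om_iff is_inductive_def is_empty_iff is_succ_iff by auto

lemma is_omega_iff: "is_omega w \<longleftrightarrow> w = om"
proof -
  have "is_inductive om"
    unfolding is_inductive_def is_empty_iff is_succ_iff by auto
  then have o: "is_omega om" unfolding is_omega_def subset_of_def om_iff by auto
  then show ?thesis unfolding is_omega_def using subset_antisym by blast
qed

lemma om_induct [consumes 1, case_names dfn emp suc]:
  assumes "n \<epsilon> om" "dfn (\<lambda>s. P (s 0))" "P emp" "\<And>n. n \<epsilon> om \<Longrightarrow> P n \<Longrightarrow> P (suc n)"
  shows "P n"
proof -
  have *: "x \<epsilon> Sep om P \<longleftrightarrow> x \<epsilon> om \<and> P x" for x by (rule Sep_iff[OF assms(2)])
  have "is_inductive (Sep om P)"
    unfolding is_inductive_def is_empty_iff is_succ_iff * using assms(3,4) by auto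
  then show ?thesis using assms(1) * om_iff by blast
qed

lemma om_ord: "n \<epsilon> om \<Longrightarrow> ordinal n"
proof (induction n rule: om_induct)
  case dfn
  show ?case by (intro dfns)
qed auto

lemma ord_om [simp]: "ordinal om"
proof (rule ordI)
  have "subset_of n om" if "n \<epsilon> om" for n
    using that
  proof (induction n rule: om_induct)
    case dfn
    show ?case by (intro dfns)
  qed (auto simp: subset_of_def)
  then show "transitive_set om" by (simp add: transitive_set_def)
qed (rule om_ord)

end

section \<open>Collapse of well-founded relations, cardinals\<close>

context membership
begin

definition pre :: "'a \<Rightarrow> 'a \<Rightarrow> 'a \<Rightarrow> 'a" where
  "pre X R x = Sep X (\<lambda>y. pr y x \<epsilon> R)"

text \<open>This says that \<open>g\<close> is an attempt at the recursion up to \<open>x\<close>.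
  Since \<open>R\<close> will be transitive, the immediate predecessors of \<open>x\<close> already
  contain all predecessors that the recursion visits.\<close>

definition iscol :: "'a \<Rightarrow> 'a \<Rightarrow> 'a \<Rightarrow> 'a \<Rightarrow> bool" where
  "iscol g X R x \<longleftrightarrow> (\<forall>y. y \<epsilon> X \<and> (y = x \<or> pr y x \<epsilon> R) \<longrightarrow> app g y = Rep (pre X R y) (app g))"

text \<open>This is the Mostowski collapse. For transitive well-founded \<open>R\<close> its values
  are ordinals and it is the rank function; if \<open>R\<close> is moreover linear it is injective.
  It thus yields order types as well as the ranks of functions modulo an ideal.\<close>

definition col :: "'a \<Rightarrow> 'a \<Rightarrow> 'a \<Rightarrow> 'a" where
  "col X R x = the1 (\<lambda>v. \<exists>g. iscol g X R x \<and> v = app g x)"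

definition wfr :: "'a \<Rightarrow> 'a \<Rightarrow> bool" where
  "wfr X R \<longleftrightarrow> (\<forall>b. subset_of b X \<and> (\<exists>x. x \<epsilon> b) \<longrightarrow>
     (\<exists>m. m \<epsilon> b \<and> (\<forall>y. y \<epsilon> b \<longrightarrow> \<not> pr y m \<epsilon> R)))"

definition trr :: "'a \<Rightarrow> 'a \<Rightarrow> bool" where
  "trr X R \<longleftrightarrow> (\<forall>x y z. x \<epsilon> X \<and> y \<epsilon> X \<and> z \<epsilon> X \<and> pr x y \<epsilon> R \<and> pr y z \<epsilon> R \<longrightarrow> pr x z \<epsilon> R)"

definition linr :: "'a \<Rightarrow> 'a \<Rightarrow> bool" where
  "linr X R \<longleftrightarrow> (\<forall>x y. x \<epsilon> X \<and> y \<epsilon> X \<longrightarrow> pr x y \<epsilon> R \<or> x = y \<or> pr y x \<epsilon> R)"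

definition memr :: "'a \<Rightarrow> 'a" where
  "memr B = Sep (prod B B) (\<lambda>p. fs p \<epsilon> sn p)"

definition otp :: "'a \<Rightarrow> 'a" where
  "otp B = Rep B (col B (memr B))"

lemma dft_pre [dfns]: "dft t \<Longrightarrow> dft u \<Longrightarrow> dft v \<Longrightarrow> dft (\<lambda>s. pre (t s) (u s) (v s))"
  by (rule tsubst3[where F = pre], unfold pre_def, intro dfns)

lemma dfn_iscol [dfns]:
  "dft t \<Longrightarrow> dft u \<Longrightarrow> dft v \<Longrightarrow> dft w \<Longrightarrow> dfn (\<lambda>s. iscol (t s) (u s) (v s) (w s))"
  by (rule subst4[where P = iscol], unfold iscol_def, intro dfns)

lemma dft_col [dfns]: "dft t \<Longrightarrow> dft u \<Longrightarrow> dft v \<Longrightarrow> dft (\<lambda>s. col (t s) (u s) (v s))"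
  by (rule tsubst3[where F = col], unfold col_def, intro dfns)

lemma dft_memr [dfns]: "dft t \<Longrightarrow> dft (\<lambda>s. memr (t s))"
  by (rule tsubst1[where F = memr], unfold memr_def, intro dfns)

lemma dft_otp [dfns]: "dft t \<Longrightarrow> dft (\<lambda>s. otp (t s))"
  by (rule tsubst1[where F = otp], unfold otp_def, intro dfns)

lemma Rep_cong: "(\<And>x. x \<epsilon> a \<Longrightarrow> F x = G x) \<Longrightarrow> Rep a F = Rep a G"
  unfolding Rep_def by (rule arg_cong[where f = coll]) (auto simp: fun_eq_iff)

end

context ZF_DC
begin

lemma pre_iff: "y \<epsilon> pre X R x \<longleftrightarrow> y \<epsilon> X \<and> pr y x \<epsilon> R"
  unfolding pre_def by (rule Sep_iff) (intro dfns)

lemma wfr_induct: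
  assumes "wfr X R" "dfn (\<lambda>s. P (s 0))" "x \<epsilon> X"
    "\<And>x. x \<epsilon> X \<Longrightarrow> (\<And>y. y \<epsilon> X \<Longrightarrow> pr y x \<epsilon> R \<Longrightarrow> P y) \<Longrightarrow> P x"
  shows "P x"
proof (rule ccontr)
  assume "\<not> P x"
  define b where "b = Sep X (\<lambda>x. \<not> P x)"
  have b: "y \<epsilon> b \<longleftrightarrow> y \<epsilon> X \<and> \<not> P y" for y unfolding b_def by (rule Sep_iff) (intro dfns assms)
  obtain m where "m \<epsilon> b" "\<And>y. y \<epsilon> b \<Longrightarrow> \<not> pr y m \<epsilon> R"
    using assms(1,3) \<open>\<not> P x\<close> b unfolding wfr_def subset_of_def by metis
  then show False using assms(4)[of m] b by blast
qed

context
  fixes X R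
  assumes wf: "wfr X R" and tr: "trr X R"
begin

lemma iscol_unique:
  assumes "iscol g X R x" "iscol h X R x'" "x \<epsilon> X" "x' \<epsilon> X" "y \<epsilon> X" "y = x \<or> pr y x \<epsilon> R" "y = x' \<or> pr y x' \<epsilon> R"
  shows "app g y = app h y"
proof -
  define Q where "Q y \<longleftrightarrow> ((y = x \<or> pr y x \<epsilon> R) \<and> (y = x' \<or> pr y x' \<epsilon> R) \<longrightarrow> app g y = app h y)" for y
  have "Q y"
    using wf _ \<open>y \<epsilon> X\<close>
  proof (rule wfr_induct[where P = Q])
    show "dfn (\<lambda>s. Q (s 0))" unfolding Q_def by (intro dfns)
    fix y assume y: "y \<epsilon> X" and IH: "\<And>z. z \<epsilon> X \<Longrightarrow> pr z y \<epsilon> R \<Longrightarrow> Q z"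
    show "Q y" unfolding Q_def
    proof
      assume a: "(y = x \<or> pr y x \<epsilon> R) \<and> (y = x' \<or> pr y x' \<epsilon> R)"
      have "app g z = app h z" if z: "z \<epsilon> pre X R y" for z
      proof -
        have "pr z x \<epsilon> R" "pr z x' \<epsilon> R"
          using a z tr y assms(3,4) unfolding pre_iff trr_def by blast+
        then show ?thesis using IH[of z] z unfolding Q_def pre_iff by blast
      qed
      then have "Rep (pre X R y) (app g) = Rep (pre X R y) (app h)" by (rule Rep_cong)
      then show "app g y = app h y" using assms(1,2) a y unfolding iscol_def by metis
    qed
  qed
  then show ?thesis using assms unfolding Q_def by blast
qed

lemma iscol_down: "iscol g X R x \<Longrightarrow> y \<epsilon> X \<Longrightarrow> pr y x \<epsilon> R \<Longrightarrow> x \<epsilon> X \<Longrightarrow> iscol g X R y"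
  using tr unfolding iscol_def trr_def by metis

lemma col_iscol: "iscol g X R x \<Longrightarrow> x \<epsilon> X \<Longrightarrow> col X R x = app g x"
  unfolding col_def by (rule the1_equality) (auto dest: iscol_unique)

text \<open>Attempts agree where they overlap, so \<open>col\<close> is correct at all predecessors
  of \<open>x\<close>, and one attempt at \<open>x\<close> is assembled by Replacement from
  \<open>col\<close> itself. No attempts for the predecessors have to be chosen.\<close>

lemma iscol_ex: "x \<epsilon> X \<Longrightarrow> \<exists>g. iscol g X R x"
proof -
  assume x: "x \<epsilon> X"
  show ?thesis
    using wf _ x
  proof (rule wfr_induct[where P = "\<lambda>x. \<exists>g. iscol g X R x"])
    show "dfn (\<lambda>s. \<exists>g. iscol g X R (s 0))" by (intro dfns)
    fix x assume x: "x \<epsilon> X" and IH: "\<And>y. y \<epsilon> X \<Longrightarrow> pr y x \<epsilon> R \<Longrightarrow> \<exists>g. iscol g X R y"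
    have c: "col X R y = Rep (pre X R y) (col X R)" if y: "y \<epsilon> X" "pr y x \<epsilon> R" for y
    proof -
      obtain g where g: "iscol g X R y" using IH y by blast
      have "Rep (pre X R y) (app g) = Rep (pre X R y) (col X R)"
        by (rule Rep_cong) (use iscol_down[OF g] col_iscol y pre_iff in metis)
      then show ?thesis using g col_iscol[OF g] y unfolding iscol_def by metis
    qed
    define G where "G = lam X (\<lambda>y. Rep (pre X R y) (col X R))"
    have G: "app G y = Rep (pre X R y) (col X R)" if "y \<epsilon> X" for y
      unfolding G_def by (rule app_lam) (intro dfns, rule that)
    have "iscol G X R x"
      unfolding iscol_def
    proof (intro allI impI)
      fix y assume y: "y \<epsilon> X \<and> (y = x \<or> pr y x \<epsilon> R)"
      have "Rep (pre X R y) (col X R) = Rep (pre X R y) (app G)"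
      proof (rule Rep_cong)
        fix z assume z: "z \<epsilon> pre X R y"
        then have "pr z x \<epsilon> R" using y x tr unfolding pre_iff trr_def by blast
        with z c[of z] G[of z] show "col X R z = app G z" unfolding pre_iff by simp
      qed
      then show "app G y = Rep (pre X R y) (app G)" using G y by simp
    qed
    then show "\<exists>g. iscol g X R x" by blast
  qed
qed

lemma col_mem: "x \<epsilon> X \<Longrightarrow> z \<epsilon> col X R x \<longleftrightarrow> (\<exists>y. y \<epsilon> X \<and> pr y x \<epsilon> R \<and> z = col X R y)"
proof -
  assume x: "x \<epsilon> X"
  obtain g where g: "iscol g X R x" using iscol_ex x by blast
  have "col X R x = Rep (pre X R x) (app g)" using col_iscol[OF g x] g x unfolding iscol_def by metis
  also have "\<dots> = Rep (pre X R x) (col X R)"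
    by (rule Rep_cong) (use iscol_down[OF g] col_iscol x pre_iff in metis)
  finally have "z \<epsilon> col X R x \<longleftrightarrow> z \<epsilon> Rep (pre X R x) (col X R)" by simp
  also have "\<dots> \<longleftrightarrow> (\<exists>y. y \<epsilon> pre X R x \<and> z = col X R y)" by (rule Rep_iff) (intro dfns)
  finally show ?thesis unfolding pre_iff by blast
qed

lemma col_ord: "x \<epsilon> X \<Longrightarrow> ordinal (col X R x)"
proof -
  assume x: "x \<epsilon> X"
  show ?thesis
    using wf _ x
  proof (rule wfr_induct[where P = "\<lambda>x. ordinal (col X R x)"])
    show "dfn (\<lambda>s. ordinal (col X R (s 0)))" by (intro dfns)
    fix x assume x: "x \<epsilon> X" and IH: "\<And>y. y \<epsilon> X \<Longrightarrow> pr y x \<epsilon> R \<Longrightarrow> ordinal (col X R y)"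
    show "ordinal (col X R x)"
    proof (rule ordI)
      show "transitive_set (col X R x)"
        unfolding transitive_set_def subset_of_def
      proof (intro allI impI)
        fix v w assume "v \<epsilon> col X R x" "w \<epsilon> v"
        then obtain y where y: "y \<epsilon> X" "pr y x \<epsilon> R" "w \<epsilon> col X R y" by (auto simp: col_mem[OF x])
        then obtain z where z: "z \<epsilon> X" "pr z y \<epsilon> R" "w = col X R z" by (auto simp: col_mem)
        then have "pr z x \<epsilon> R" using y x tr unfolding trr_def by blast
        with z show "w \<epsilon> col X R x" using col_mem[OF x] by blast
      qed
    qed (use IH col_mem[OF x] in auto)
  qed
qed

lemma col_less: "x \<epsilon> X \<Longrightarrow> y \<epsilon> X \<Longrightarrow> pr x y \<epsilon> R \<Longrightarrow> col X R x \<epsilon> col X R y"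
  using col_mem by blast

lemma col_inj:
  assumes "linr X R" "x \<epsilon> X" "y \<epsilon> X" shows "col X R x = col X R y \<longleftrightarrow> x = y"
  using assms col_less mem_irrefl unfolding linr_def by metis

lemma col_less_iff:
  assumes "linr X R" "x \<epsilon> X" "y \<epsilon> X" shows "col X R x \<epsilon> col X R y \<longleftrightarrow> pr x y \<epsilon> R"
  using assms col_less mem_irrefl mem_asym unfolding linr_def by metis

lemma col_range: "z \<epsilon> Rep X (col X R) \<longleftrightarrow> (\<exists>x. x \<epsilon> X \<and> z = col X R x)"
  by (rule Rep_iff) (intro dfns)

lemma col_range_ord: "ordinal (Rep X (col X R))"
proof (rule ordI)
  show "transitive_set (Rep X (col X R))"
    unfolding transitive_set_def subset_of_def
  proof (intro allI impI)
    fix y z assume "y \<epsilon> Rep X (col X R)" "z \<epsilon> y"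
    then obtain x where "x \<epsilon> X" "z \<epsilon> col X R x" by (auto simp: col_range)
    then show "z \<epsilon> Rep X (col X R)" unfolding col_range using col_mem[of x] by blast
  qed
qed (auto simp: col_range col_ord)

end

lemma memr_iff: "pr x y \<epsilon> memr B \<longleftrightarrow> x \<epsilon> B \<and> y \<epsilon> B \<and> x \<epsilon> y"
proof -
  have "pr x y \<epsilon> memr B \<longleftrightarrow> pr x y \<epsilon> prod B B \<and> fs (pr x y) \<epsilon> sn (pr x y)"
    unfolding memr_def by (rule Sep_iff) (intro dfns)
  then show ?thesis by simp
qed

lemma memr_wf: "wfr B (memr B)"
  unfolding wfr_def memr_iff
proof (intro allI impI)
  fix b assume b: "subset_of b B \<and> (\<exists>x. x \<epsilon> b)"
  then have "\<not> is_empty b" by (auto simp: is_empty_def)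
  from foundation[OF this] show "\<exists>m. m \<epsilon> b \<and> (\<forall>y. y \<epsilon> b \<longrightarrow> \<not> (y \<epsilon> B \<and> m \<epsilon> B \<and> y \<epsilon> m))" by blast
qed

lemma memr_tr: assumes "\<And>x. x \<epsilon> B \<Longrightarrow> ordinal x" shows "trr B (memr B)"
  unfolding trr_def memr_iff using assms ord_trans by blast

lemma memr_lin: assumes "\<And>x. x \<epsilon> B \<Longrightarrow> ordinal x" shows "linr B (memr B)"
  unfolding linr_def memr_iff using assms ord_cases by metis

context
  fixes B
  assumes B: "\<And>x. x \<epsilon> B \<Longrightarrow> ordinal x"
begin

lemma memr_tr_lin: "trr B (memr B)" "linr B (memr B)"
  using B by (auto intro: memr_tr memr_lin)

lemmas otp_col = col_ord[OF memr_wf memr_tr_lin(1)] col_mem[OF memr_wf memr_tr_lin(1)]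
  col_inj[OF memr_wf memr_tr_lin] col_less_iff[OF memr_wf memr_tr_lin]

lemma otp_iff: "z \<epsilon> otp B \<longleftrightarrow> (\<exists>x. x \<epsilon> B \<and> z = col B (memr B) x)"
  unfolding otp_def by (rule Rep_iff) (intro dfns)

lemma otp_ord: "ordinal (otp B)"
  unfolding otp_def by (rule col_range_ord[OF memr_wf memr_tr_lin(1)])

lemma otp_equipollent: "equipollent B (otp B)"
  by (rule equipollentI[of "col B (memr B)"]) (intro dfns, auto simp: otp_iff otp_col)

lemma otp_col_le: "x \<epsilon> B \<Longrightarrow> subset_of (col B (memr B) x) x"
proof -
  assume x: "x \<epsilon> B"
  show ?thesis
    using memr_wf _ x
  proof (rule wfr_induct[where P = "\<lambda>x. subset_of (col B (memr B) x) x"])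
    show "dfn (\<lambda>s. subset_of (col B (memr B) (s 0)) (s 0))" by (intro dfns)
    fix x assume x: "x \<epsilon> B"
      and IH: "\<And>y. y \<epsilon> B \<Longrightarrow> pr y x \<epsilon> memr B \<Longrightarrow> subset_of (col B (memr B) y) y"
    show "subset_of (col B (memr B) x) x"
      unfolding subset_of_def
    proof (intro allI impI)
      fix z assume "z \<epsilon> col B (memr B) x"
      then obtain y where y: "y \<epsilon> B" "y \<epsilon> x" "z = col B (memr B) y"
        using otp_col(2)[OF x] by (auto simp: memr_iff)
      then have "subset_of z y" using IH x memr_iff by blast
      then show "z \<epsilon> x" using ord_sub_mem[OF B[OF x]] y otp_col(1)[OF y(1)] by metis
    qed
  qed
qed

lemma otp_subset:
  assumes "ordinal a" "subset_of B a" shows "subset_of (otp B) a"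
  unfolding subset_of_def otp_iff
  using otp_col_le otp_col(1) assms ord_sub_mem B by (metis subset_ofD)

lemma otp_order_type: "has_order_type B (otp B)"
proof -
  define F where "F z = the1 (\<lambda>x. x \<epsilon> B \<and> z = col B (memr B) x)" for z
  have dF: "dft (\<lambda>s. F (s 0))" unfolding F_def by (intro dfns)
  have F: "F (col B (memr B) x) = x" if "x \<epsilon> B" for x
    unfolding F_def by (rule the1_equality) (use that otp_col(3) in auto)
  have f: "is_fun (lam (otp B) F) (otp B) B"
    by (rule lam_is_fun[OF dF]) (auto simp: otp_iff F)
  have app: "app (lam (otp B) F) z = F z" if "z \<epsilon> otp B" for z
    by (rule app_lam[OF dF that])
  have "is_bij (lam (otp B) F) (otp B) B"
    unfolding is_bij_def is_inj_def is_fun_related[OF f]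
    using f app otp_iff F by (auto; metis)
  moreover have "x \<epsilon> x' \<longleftrightarrow> y \<epsilon> y'"
    if "related (lam (otp B) F) x y" "related (lam (otp B) F) x' y'" for x x' y y'
    using that unfolding is_fun_related[OF f]
    by (auto simp: app otp_iff F otp_col(4) memr_iff)
  ultimately show ?thesis unfolding has_order_type_def using otp_ord by blast
qed

end

section \<open>Cardinalities of well-orderable sets\<close>

lemma lep_ordinal_equipollent:
  assumes "A \<lesssim> a" "ordinal a"
  obtains t where "ordinal t" "subset_of t a" "equipollent A t"
proof -
  obtain f where "injf f A a" using assms(1) unfolding lep_def by blast
  note B = lep_equipollent_image[OF this]
  have o: "ordinal x" if "x \<epsilon> Rep A (app f)" for x using that B(2) assms(2) ord_elem subset_ofD by blast
  show ?thesis
    by (rule that[of "otp (Rep A (app f))"])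
      (use o B otp_ord otp_subset assms(2) otp_equipollent equipollent_trans in blast)+
qed

lemma dfn_equipollent [dfns]: "dft t \<Longrightarrow> dft u \<Longrightarrow> dfn (\<lambda>s. equipollent (t s) (u s))"
  by (rule subst2[where P = equipollent],
      unfold equipollent_def is_bij_def is_inj_def related_iff, intro dfns)

lemma has_card_ex:
  assumes "A \<lesssim> a" "ordinal a"
  obtains k where "has_card A k" "subset_of k a"
proof -
  obtain t where t: "ordinal t" "subset_of t a" "equipollent A t" using lep_ordinal_equipollent assms by blast
  have "dfn (\<lambda>s. equipollent A (s 0))" by (intro dfns)
  from ord_min[where P = "equipollent A", OF this t(1,3)] obtain m where
    "ordinal m" "equipollent A m" "\<And>z. z \<epsilon> m \<Longrightarrow> \<not> equipollent A z" "subset_of m t" by metis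
  then show ?thesis using that[of m] t(2) subset_of_trans unfolding has_card_def by blast
qed

text \<open>Collapsing the image of an injection into \<open>b\<close> gives a bijection with an
  ordinal not above \<open>b\<close>. Hence cardinals can be handled by injections alone, without a
  Cantor-Bernstein argument. Finite ordinals are alephs in this sense.\<close>

lemma aleph_iff: "aleph k \<longleftrightarrow> ordinal k \<and> (\<forall>b. b \<epsilon> k \<longrightarrow> \<not> k \<lesssim> b)"
proof
  assume "aleph k"
  then obtain A where A: "has_card A k" unfolding aleph_def by blast
  have k: "ordinal k" using A by (simp add: has_card_def)
  have False if b: "b \<epsilon> k" "k \<lesssim> b" for b
  proof -
    have ob: "ordinal b" using k b(1) ord_elem by blast
    obtain t where t: "ordinal t" "subset_of t b" "equipollent k t"
      using lep_ordinal_equipollent[OF b(2) ob] by blast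
    have "t \<epsilon> k" using ord_sub_mem[OF k t(1,2) b(1)] .
    moreover have "equipollent A t" using A t(3) equipollent_trans unfolding has_card_def by blast
    ultimately show False using A unfolding has_card_def by blast
  qed
  then show "ordinal k \<and> (\<forall>b. b \<epsilon> k \<longrightarrow> \<not> k \<lesssim> b)" using k by blast
next
  assume a: "ordinal k \<and> (\<forall>b. b \<epsilon> k \<longrightarrow> \<not> k \<lesssim> b)"
  then have "has_card k k" unfolding has_card_def using equipollent_refl equipollent_lep by blast
  moreover have "well_orders (\<epsilon>) k" using a by (simp add: ordinal_def)
  then have "well_orders (related (memr k)) k"
    unfolding well_orders_def related_iff memr_iff subset_of_def
    by (elim conjE, intro conjI; meson)
  then have "well_orderable k" unfolding well_orderable_def by blast
  ultimately show "aleph k" unfolding aleph_def by blast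
qed

lemma card_less_iff:
  assumes "ordinal a" shows "card_less A a \<longleftrightarrow> (\<exists>b. b \<epsilon> a \<and> A \<lesssim> b)"
proof
  assume "card_less A a"
  then show "\<exists>b. b \<epsilon> a \<and> A \<lesssim> b" unfolding card_less_def has_card_def using equipollent_lep by blast
next
  assume "\<exists>b. b \<epsilon> a \<and> A \<lesssim> b"
  then obtain b where b: "b \<epsilon> a" "A \<lesssim> b" by blast
  have "ordinal b" using assms b(1) ord_elem by blast
  from has_card_ex[OF b(2) this] obtain k where k: "has_card A k" "subset_of k b" by blast
  then have "k \<epsilon> a" using ord_sub_mem[OF assms _ k(2) b(1)] by (simp add: has_card_def)
  then show "card_less A a" using k unfolding card_less_def by blast
qed

end

section \<open>Cardinal products\<close>

context ZF_DC
begin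

lemma injf_mem: "injf f A B \<Longrightarrow> x \<epsilon> A \<Longrightarrow> app f x \<epsilon> B"
  and injf_eq: "injf f A B \<Longrightarrow> x \<epsilon> A \<Longrightarrow> y \<epsilon> A \<Longrightarrow> app f x = app f y \<longleftrightarrow> x = y"
  unfolding injf_def by blast+

lemma suc_inj: "suc x = suc y \<Longrightarrow> x = y"
  by (metis mem_asym suc_iff)

lemma suc_not_emp [simp]: "suc x \<noteq> emp" "emp \<noteq> suc x"
  by (metis emp_iff suc_iff)+

lemma lep_prod: "A \<lesssim> A' \<Longrightarrow> B \<lesssim> B' \<Longrightarrow> prod A B \<lesssim> prod A' B'"
proof -
  assume "A \<lesssim> A'" "B \<lesssim> B'"
  then obtain f g where f: "injf f A A'" and g: "injf g B B'" unfolding lep_def by blast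
  show ?thesis
    by (rule lepI[of "\<lambda>p. pr (app f (fs p)) (app g (sn p))"])
      (intro dfns, auto simp: prod_iff injf_mem[OF f] injf_mem[OF g] injf_eq[OF f] injf_eq[OF g])
qed

lemma om_not_lep: "n \<epsilon> om \<Longrightarrow> \<not> om \<lesssim> n"
proof (induction n rule: om_induct)
  case dfn
  show ?case by (intro dfns)
next
  case emp
  then show ?case unfolding lep_def injf_def using om_emp emp_iff by blast
next
  case (suc n)
  have "om \<lesssim> n" if h: "om \<lesssim> suc n"
  proof -
    obtain f where f: "injf f om (suc n)" using h unfolding lep_def by blast
    \<comment> \<open>The argument is shifted by one, which frees the value of \<open>f\<close> at
      0; that value replaces \<open>n\<close> wherever \<open>n\<close> would be taken.\<close>
    define g where "g k = (if app f (suc k) = n then app f emp else app f (suc k))" for k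
    have i: "app f x = app f y \<longleftrightarrow> x = y" if "x \<epsilon> om" "y \<epsilon> om" for x y
      using f that unfolding injf_def by blast
    have r: "app f x \<epsilon> n" if "x \<epsilon> om" "app f x \<noteq> n" for x
      using f that unfolding injf_def by auto
    have *: "app f emp \<noteq> app f (suc k)" if "k \<epsilon> om" for k
      using i[of emp "suc k"] that suc_not_emp[of k] by auto
    show ?thesis
    proof (rule lepI[of g])
      show "dft (\<lambda>s. g (s 0))" unfolding g_def by (intro dfns)
      show "g x \<epsilon> n" if "x \<epsilon> om" for x
        unfolding g_def using r *[OF that] that by auto
      show "x = y" if "x \<epsilon> om" "y \<epsilon> om" "g x = g y" for x y
      proof -
        have "app f (suc x) = app f (suc y)"
          using that(3) *[OF that(1)] *[OF that(2)] unfolding g_def by (auto split: if_splits)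
        then show ?thesis using i[of "suc x" "suc y"] that suc_inj by auto
      qed
    qed
  qed
  with suc show ?case by blast
qed

definition fin :: "'a \<Rightarrow> bool" where "fin A \<longleftrightarrow> (\<exists>k. k \<epsilon> om \<and> A \<lesssim> k)"

lemma dfn_fin [dfns]: "dft t \<Longrightarrow> dfn (\<lambda>s. fin (t s))"
  by (rule subst1[where P = fin], unfold fin_def, intro dfns)

lemma fin_insert: "fin A \<Longrightarrow> fin (un A (upr x x))"
proof -
  assume "fin A"
  then obtain k f where k: "k \<epsilon> om" and f: "injf f A k" unfolding fin_def lep_def by blast
  have *: "app f y \<noteq> k" if "y \<epsilon> A" for y using f that mem_irrefl unfolding injf_def by metis
  have "un A (upr x x) \<lesssim> suc k"
    by (rule lepI[of "\<lambda>y. if y \<epsilon> A then app f y else k"])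
      (intro dfns, auto simp: injf_mem[OF f] injf_eq[OF f] * split: if_splits dest: *[symmetric])
  then show ?thesis unfolding fin_def using om_suc k by blast
qed

lemma fin_row: "m \<epsilon> om \<Longrightarrow> fin A \<Longrightarrow> fin (un A (prod m (upr n n)))"
proof (induction m rule: om_induct)
  case dfn
  show ?case by (intro dfns)
next
  case emp
  moreover have "un A (prod emp (upr n n)) = A"
    by (rule ext) (auto simp: prod_iff)
  ultimately show ?case by simp
next
  case (suc m)
  have "un A (prod (suc m) (upr n n)) = un (un A (prod m (upr n n))) (upr (pr m n) (pr m n))"
    by (rule ext) (auto simp: prod_iff)
  then show ?case using fin_insert suc by metis
qed

lemma fin_prod: "n \<epsilon> om \<Longrightarrow> m \<epsilon> om \<Longrightarrow> fin (prod m n)"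
proof (induction n rule: om_induct)
  case dfn
  show ?case by (intro dfns)
next
  case emp
  have "prod m emp \<lesssim> emp"
    by (rule subset_lep) (auto simp: prod_iff subset_of_def)
  then show ?case unfolding fin_def using om_emp by blast
next
  case (suc n)
  have "prod m (suc n) = un (prod m n) (prod m (upr n n))"
    by (rule ext) (auto simp: prod_iff)
  then show ?case using fin_row suc by metis
qed

text \<open>Hilbert's hotel: the new element \<open>b\<close> goes to 0, the natural numbers move up
  by one and the rest stays.\<close>

lemma suc_lep: assumes "subset_of om b" "ordinal b" shows "suc b \<lesssim> b"
proof -
  define F where "F x = (if x = b then emp else if x \<epsilon> om then suc x else x)" for x
  have b: "\<not> b \<epsilon> om" using assms mem_irrefl subset_ofD by blast
  show ?thesis
  proof (rule lepI[of F])
    show "dft (\<lambda>s. F (s 0))" unfolding F_def by (intro dfns)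
    show "F x \<epsilon> b" if "x \<epsilon> suc b" for x
      unfolding F_def using that subset_ofD[OF assms(1)] by auto
    show "x = y" if "x \<epsilon> suc b" "y \<epsilon> suc b" "F x = F y" for x y
      using that(3) om_emp om_suc suc_inj[of x y] suc_not_emp unfolding F_def
      by (auto split: if_splits)
  qed
qed

lemma aleph_suc:
  assumes "aleph m" "om \<epsilon> m" "x \<epsilon> m" shows "suc x \<epsilon> m"
proof -
  have m: "ordinal m" "\<not> m \<lesssim> x" using assms(1,3) aleph_iff by auto
  have x: "ordinal x" using assms(3) m(1) ord_elem by blast
  have s: "subset_of (suc x) m" using suc_subset[OF x m(1)] assms(3) by blast
  have "suc x \<noteq> m"
  proof
    assume e: "suc x = m"
    show False
    proof (cases "x \<epsilon> om")
      case True
      then show False using e om_suc assms(2) mem_asym by blast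
    next
      case False
      then show False using suc_lep[OF _ x] ord_not_mem[OF x ord_om] e m(2) by simp
    qed
  qed
  then show ?thesis using s ord_psubset x m(1) by simp
qed

text \<open>For ordinals \<open>un\<close> is the maximum, so this is Goedel's canonical ordering of
  pairs: by maximum, then by first and second coordinate.\<close>

definition godel_less :: "'a \<Rightarrow> 'a \<Rightarrow> bool" where
  "godel_less p q \<longleftrightarrow> un (fs p) (sn p) \<epsilon> un (fs q) (sn q) \<or>
     un (fs p) (sn p) = un (fs q) (sn q) \<and> (fs p \<epsilon> fs q \<or> fs p = fs q \<and> sn p \<epsilon> sn q)"

definition godel :: "'a \<Rightarrow> 'a" where
  "godel a = Sep (prod (prod a a) (prod a a)) (\<lambda>z. godel_less (fs z) (sn z))"

lemma dfn_godel_less [dfns]: "dft t \<Longrightarrow> dft u \<Longrightarrow> dfn (\<lambda>s. godel_less (t s) (u s))"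
  by (rule subst2[where P = godel_less], unfold godel_less_def, intro dfns)

lemma godel_iff: "pr p q \<epsilon> godel a \<longleftrightarrow> p \<epsilon> prod a a \<and> q \<epsilon> prod a a \<and> godel_less p q"
proof -
  have "pr p q \<epsilon> godel a \<longleftrightarrow> pr p q \<epsilon> prod (prod a a) (prod a a) \<and> godel_less (fs (pr p q)) (sn (pr p q))"
    unfolding godel_def by (rule Sep_iff) (intro dfns)
  then show ?thesis by simp
qed

lemma ord_un: assumes "ordinal a" "ordinal b" shows "un a b = a \<or> un a b = b"
proof -
  have "subset_of a b \<or> subset_of b a" using ord_total[OF assms] ord_mem_subset[OF assms(1)] by blast
  then show ?thesis
  proof
    assume "subset_of a b"
    then have "un a b = b" by (intro ext) (auto dest: subset_ofD)
    then show ?thesis ..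
  next
    assume "subset_of b a"
    then have "un a b = a" by (intro ext) (auto dest: subset_ofD)
    then show ?thesis ..
  qed
qed

context
  fixes a assumes a: "ordinal a"
begin

lemma godel_parts:
  assumes "p \<epsilon> prod a a"
  shows "fs p \<epsilon> a" "sn p \<epsilon> a" "un (fs p) (sn p) \<epsilon> a" "p = pr (fs p) (sn p)"
    "ordinal (fs p)" "ordinal (sn p)" "ordinal (un (fs p) (sn p))"
proof -
  show *: "fs p \<epsilon> a" "sn p \<epsilon> a" "p = pr (fs p) (sn p)" using assms by (auto simp: prod_iff)
  then show o: "ordinal (fs p)" "ordinal (sn p)" using a ord_elem by auto
  from ord_un[OF this] * show "un (fs p) (sn p) \<epsilon> a" by auto
  then show "ordinal (un (fs p) (sn p))" using a ord_elem by auto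
qed

lemma godel_tr: "trr (prod a a) (godel a)"
  unfolding trr_def godel_iff
proof (intro allI impI, elim conjE, intro conjI)
  fix p q r assume "p \<epsilon> prod a a" "q \<epsilon> prod a a" "r \<epsilon> prod a a" and *: "godel_less p q" "godel_less q r"
  note r = godel_parts[OF this(3)]
  have t: "x \<epsilon> un (fs r) (sn r)" if "x \<epsilon> y" "y \<epsilon> un (fs r) (sn r)" for x y using ord_trans[OF r(7)] that .
  have t2: "x \<epsilon> fs r" if "x \<epsilon> y" "y \<epsilon> fs r" for x y using ord_trans[OF r(5)] that .
  have t3: "x \<epsilon> sn r" if "x \<epsilon> y" "y \<epsilon> sn r" for x y using ord_trans[OF r(6)] that .
  obtain mp mq mr where m: "un (fs p) (sn p) = mp" "un (fs q) (sn q) = mq" "un (fs r) (sn r) = mr" by blast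
  show "godel_less p r"
    using * t[unfolded m] t2 t3 unfolding godel_less_def m by metis
qed

lemma godel_lin: "linr (prod a a) (godel a)"
  unfolding linr_def godel_iff
proof (intro allI impI, elim conjE)
  fix p q assume pq: "p \<epsilon> prod a a" "q \<epsilon> prod a a"
  note p = godel_parts[OF pq(1)] and q = godel_parts[OF pq(2)]
  have "godel_less p q \<or> (fs p = fs q \<and> sn p = sn q) \<or> godel_less q p"
    using ord_cases[OF p(5) q(5)] ord_cases[OF p(6) q(6)] ord_cases[OF p(7) q(7)]
    unfolding godel_less_def by metis
  then show "p \<epsilon> prod a a \<and> q \<epsilon> prod a a \<and> godel_less p q \<or> p = q \<or>
      q \<epsilon> prod a a \<and> p \<epsilon> prod a a \<and> godel_less q p"
    using pq p(4) q(4) by metis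
qed

text \<open>Three successive minimisations: of the maximum, then of the first and then of the second
  coordinate.\<close>

lemma godel_wf: "wfr (prod a a) (godel a)"
  unfolding wfr_def
proof (intro allI impI, elim conjE exE)
  fix b p0 assume b: "subset_of b (prod a a)" and p0: "p0 \<epsilon> b"
  note P = godel_parts[OF subset_ofD[OF b]]
  have d1: "dfn (\<lambda>s. \<exists>p. p \<epsilon> b \<and> un (fs p) (sn p) = s 0)" by (intro dfns)
  from ord_min[where P = "\<lambda>x. \<exists>p. p \<epsilon> b \<and> un (fs p) (sn p) = x", OF d1 P(7)[OF p0]] p0
  obtain m p1 where m: "p1 \<epsilon> b" "un (fs p1) (sn p1) = m"
    "\<And>z p. z \<epsilon> m \<Longrightarrow> p \<epsilon> b \<Longrightarrow> un (fs p) (sn p) \<noteq> z" by metis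
  have d2: "dfn (\<lambda>s. \<exists>p. p \<epsilon> b \<and> un (fs p) (sn p) = m \<and> fs p = s 0)" by (intro dfns)
  from ord_min[where P = "\<lambda>x. \<exists>p. p \<epsilon> b \<and> un (fs p) (sn p) = m \<and> fs p = x", OF d2 P(5)[OF m(1)]] m(1,2)
  obtain k p2 where k: "p2 \<epsilon> b" "un (fs p2) (sn p2) = m" "fs p2 = k"
    "\<And>z p. z \<epsilon> k \<Longrightarrow> p \<epsilon> b \<Longrightarrow> un (fs p) (sn p) = m \<Longrightarrow> fs p \<noteq> z" by metis
  have d3: "dfn (\<lambda>s. \<exists>p. p \<epsilon> b \<and> un (fs p) (sn p) = m \<and> fs p = k \<and> sn p = s 0)" by (intro dfns)
  from ord_min[where P = "\<lambda>x. \<exists>p. p \<epsilon> b \<and> un (fs p) (sn p) = m \<and> fs p = k \<and> sn p = x", OF d3 P(6)[OF k(1)]] k(1-3)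
  obtain l p3 where l: "p3 \<epsilon> b" "un (fs p3) (sn p3) = m" "fs p3 = k" "sn p3 = l"
    "\<And>z p. z \<epsilon> l \<Longrightarrow> p \<epsilon> b \<Longrightarrow> un (fs p) (sn p) = m \<Longrightarrow> fs p = k \<Longrightarrow> sn p \<noteq> z" by metis
  have "\<not> pr y p3 \<epsilon> godel a" if "y \<epsilon> b" for y
    unfolding godel_iff godel_less_def l(2) unfolding l(3,4) using m(3) k(4) l(5) that by blast
  then show "\<exists>m. m \<epsilon> b \<and> (\<forall>y. y \<epsilon> b \<longrightarrow> \<not> pr y m \<epsilon> godel a)" using l(1) by blast
qed

end

text \<open>The Goedel ordering of \<open>a \<times> a\<close> has type \<open>a\<close> when \<open>a\<close> is an infinite initial ordinal, because
  its proper initial segments are covered by squares of smaller ordinals.\<close>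

theorem prod_lep: "ordinal a \<Longrightarrow> subset_of om a \<Longrightarrow> prod a a \<lesssim> a"
proof (induction a rule: ord_induct)
  case dfn
  show ?case by (intro dfns)
next
  case (step a)
  show ?case
  proof (cases "\<exists>b. b \<epsilon> a \<and> subset_of om b \<and> a \<lesssim> b")
    \<comment> \<open>When \<open>a\<close> is not an initial ordinal, the result is inherited from
      a smaller infinite \<open>b\<close> of the same size.\<close>
    case True
    then obtain b where b: "b \<epsilon> a" "subset_of om b" "a \<lesssim> b" by blast
    have "prod a a \<lesssim> prod b b" using b lep_prod by blast
    also have "\<dots> \<lesssim> b" using step.IH b by blast
    also have "\<dots> \<lesssim> a" using subset_lep ord_mem_subset step.hyps b(1) by blast
    finally show ?thesis .
  next
    case False
    let ?X = "prod a a" let ?R = "godel a"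
    note a = \<open>ordinal a\<close>
    note G = godel_wf[OF a] godel_tr[OF a]
    have "col ?X ?R p \<epsilon> a" if p: "p \<epsilon> ?X" for p
    proof (rule ccontr)
      assume "\<not> col ?X ?R p \<epsilon> a"
      then have 1: "subset_of a (col ?X ?R p)" using ord_not_mem a col_ord[OF G p] by blast
      define s where "s = un (fs p) (sn p)"
      note P = godel_parts[OF a p, folded s_def]
      define F where "F z = the1 (\<lambda>q. q \<epsilon> ?X \<and> z = col ?X ?R q)" for z
      have F: "F (col ?X ?R q) = q" if "q \<epsilon> ?X" for q
        unfolding F_def by (rule the1_equality) (use that col_inj[OF G godel_lin[OF a]] in auto)
      have "a \<lesssim> col ?X ?R p" using 1 by (rule subset_lep)
      also have "col ?X ?R p \<lesssim> prod (suc s) (suc s)"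
      proof (rule lepI[of F])
        show "dft (\<lambda>s. F (s 0))" unfolding F_def by (intro dfns)
        show "F z \<epsilon> prod (suc s) (suc s)" if z: "z \<epsilon> col ?X ?R p" for z
        proof -
          obtain q where q: "q \<epsilon> ?X" "pr q p \<epsilon> ?R" "z = col ?X ?R q" using z by (auto simp: col_mem[OF G p])
          note Q = godel_parts[OF a q(1)]
          have "un (fs q) (sn q) \<epsilon> s \<or> un (fs q) (sn q) = s"
            using q(2) unfolding godel_iff godel_less_def s_def by blast
          then have "subset_of (un (fs q) (sn q)) s" using ord_subset_iff P(7) Q(7) by blast
          then have "subset_of (fs q) s" "subset_of (sn q) s" by (auto simp: subset_of_def)
          then have "fs q \<epsilon> suc s" "sn q \<epsilon> suc s" using ord_subset_iff P(7) Q(5,6) by auto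
          then show ?thesis using F[OF q(1)] q(3) Q(4) pr_prod by metis
        qed
        show "x = y" if "x \<epsilon> col ?X ?R p" "y \<epsilon> col ?X ?R p" "F x = F y" for x y
          using that F unfolding col_mem[OF G p] by metis
      qed
      finally have 2: "a \<lesssim> prod (suc s) (suc s)" .
      have os: "ordinal s" "s \<epsilon> a" using P by auto
      show False
      proof (cases "s \<epsilon> om")
        \<comment> \<open>For finite \<open>s\<close> the square is finite and cannot contain a copy
          of \<open>om\<close>.\<close>
        case True
        then obtain k where k: "k \<epsilon> om" "prod (suc s) (suc s) \<lesssim> k" using fin_prod om_suc unfolding fin_def by blast
        have "om \<lesssim> k" using subset_lep[OF step.prems] 2 k(2) lep_trans by blast
        with k om_not_lep show False by blast
      next
        case n: False
        then have s: "subset_of om s" using ord_not_mem os by auto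
        then have s': "subset_of om (suc s)" using subset_of_def by auto
        have "subset_of (suc s) a" using suc_subset os a by blast
        then consider "suc s \<epsilon> a" | "suc s = a" using ord_subset_iff a os ord_suc by blast
        then show False
        proof cases
          case 1
          then have "prod (suc s) (suc s) \<lesssim> suc s" using step.IH s' by blast
          with 2 False 1 s' lep_trans show False by blast
        next
          case 2
          then have "a \<lesssim> s" using suc_lep[OF s os(1)] by simp
          then show False using False os s by blast
        qed
      qed
    qed
    then show ?thesis
      by (intro lepI[of "col ?X ?R" ?X a]) (intro dfns, use col_inj[OF G godel_lin[OF a]] in auto)
  qed
qed

lemma un_lep:
  assumes "ordinal a" "subset_of om a" "A \<lesssim> a" "B \<lesssim> a" shows "un A B \<lesssim> a"
proof -
  obtain f g where f: "injf f A a" and g: "injf g B a" using assms(3,4) unfolding lep_def by blast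
  have e: "emp \<epsilon> a" "suc emp \<epsilon> a" using assms(2) om_emp om_suc subset_ofD by blast+
  have "un A B \<lesssim> prod a a"
    by (rule lepI[of "\<lambda>x. if x \<epsilon> A then pr emp (app f x) else pr (suc emp) (app g x)"])
      (intro dfns, auto simp: injf_mem[OF f] injf_mem[OF g] injf_eq[OF f] injf_eq[OF g] e split: if_splits)
  then show ?thesis using prod_lep assms(1,2) lep_trans by blast
qed

end

context membership
begin

lemma dfn_app_pred:
  assumes "dfn (\<lambda>s. P (s 0))" "dft t" shows "dfn (\<lambda>s. P (t s))"
  by (rule subst_last[where P = "\<lambda>s. P"]) (rule assms)+

lemma dft_app_fun:
  assumes "dft (\<lambda>s. F (s 0))" "dft t" shows "dft (\<lambda>s. F (t s))"
proof -
  have 1: "dfn (\<lambda>s. s 0 = F (s 1))" using assms(1) by (simp add: dft_def)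
  have "inj (case_nat 1 (case_nat 0 (\<lambda>n. Suc (Suc n))))" by (auto simp: inj_def split: nat.splits)
  from dfn_ren[OF this 1] have "dfn (\<lambda>s. s (Suc 0) = F (s 0))" by simp
  then have "dfn (\<lambda>s. s 0 = F (t (\<lambda>n. s (Suc n))))"
    by (rule subst_last[where P = "\<lambda>s x. s 0 = F x", OF _ dft_shift[OF assms(2)]])
  then show ?thesis by (simp add: dft_def)
qed

end

context ZF_DC
begin

text \<open>Each value is sent to the least index of one of its preimages, which avoids choosing
  preimages.\<close>

lemma Rep_lep:
  assumes "dft (\<lambda>s. F (s 0))" "A \<lesssim> b" "ordinal b" shows "Rep A F \<lesssim> b"
proof -
  obtain f where f: "injf f A b" using assms(2) unfolding lep_def by blast
  note R = Rep_iff[where F = F, OF assms(1)]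
  define G where "G z = leastO (\<lambda>v. \<exists>x. x \<epsilon> A \<and> F x = z \<and> app f x = v)" for z
  have G: "\<exists>x. x \<epsilon> A \<and> F x = z \<and> app f x = G z" if z: "z \<epsilon> Rep A F" for z
  proof -
    obtain x where x: "x \<epsilon> A" "z = F x" using z unfolding R by blast
    have d: "dfn (\<lambda>s. \<exists>x. x \<epsilon> A \<and> F x = z \<and> app f x = s 0)"
      by (intro dfns dft_app_fun[OF assms(1)])
    have o: "ordinal (app f x)" using injf_mem[OF f x(1)] ord_elem assms(3) by blast
    show ?thesis unfolding G_def
      by (rule leastO(2)[where P = "\<lambda>v. \<exists>x. x \<epsilon> A \<and> F x = z \<and> app f x = v", OF d o])
        (use x in auto)
  qed
  show ?thesis
  proof (rule lepI[of G])
    show "dft (\<lambda>s. G (s 0))" unfolding G_def by (intro dfns dft_app_fun[OF assms(1)])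
    show "G z \<epsilon> b" if "z \<epsilon> Rep A F" for z using G[OF that] injf_mem[OF f] by metis
    show "x = y" if "x \<epsilon> Rep A F" "y \<epsilon> Rep A F" "G x = G y" for x y
      using G[OF that(1)] G[OF that(2)] that(3) injf_eq[OF f] by metis
  qed
qed

end

text \<open>\<open>kap\<close> is the cofinality of \<open>mu\<close>, \<open>c\<close> an increasing cofinal map, \<open>H\<close> is the set
  \<open>H(mu)\<close> and \<open>b\<close> injects it into \<open>mu\<close>.\<close>

locale singular_aleph = ZF_DC mem for mem :: "'a \<Rightarrow> 'a \<Rightarrow> bool"  (infix "\<epsilon>" 50) +
  fixes mu kap H b c :: 'a
  assumes aleph_mu: "aleph mu"
    and om_kap: "om \<epsilon> kap" and kap_mu: "kap \<epsilon> mu"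
    and c_mu: "i \<epsilon> kap \<Longrightarrow> app c i \<epsilon> mu"
    and c_less: "i \<epsilon> j \<Longrightarrow> j \<epsilon> kap \<Longrightarrow> app c i \<epsilon> app c j"
    and c_cofinal: "x \<epsilon> mu \<Longrightarrow> \<exists>i. i \<epsilon> kap \<and> x \<epsilon> app c i"
    and kap_bounded: "t \<epsilon> kap \<Longrightarrow> (\<And>x. x \<epsilon> t \<Longrightarrow> app g x \<epsilon> kap) \<Longrightarrow>
      \<exists>d. d \<epsilon> kap \<and> (\<forall>x. x \<epsilon> t \<longrightarrow> app g x \<epsilon> d)"
    and H: "is_H mu H" and b: "injf b H mu"
begin

lemma ord_mu: "ordinal mu" and mu_not_lep: "x \<epsilon> mu \<Longrightarrow> \<not> mu \<lesssim> x"
  using aleph_mu aleph_iff by auto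

lemma ord_kap: "ordinal kap" using kap_mu ord_mu ord_elem by blast

lemma om_mu: "om \<epsilon> mu" using om_kap kap_mu ord_mu ord_trans by blast

lemma om_sub_mu: "subset_of om mu" and om_sub_kap: "subset_of om kap"
  using om_mu om_kap ord_mem_subset ord_mu ord_kap by auto

lemmas suc_mu = aleph_suc[OF aleph_mu om_mu]

lemma un_mu: "x \<epsilon> mu \<Longrightarrow> y \<epsilon> mu \<Longrightarrow> un x y \<epsilon> mu"
  using ord_un ord_mu ord_elem by metis

text \<open>The layers are \<open>r\<close>, the unordered pairs and the Kuratowski pairs over
  \<open>r\<close>. For an ordinal \<open>r\<close> this set is transitive, and for infinite
  \<open>r\<close> no larger than \<open>r\<close>; hence it witnesses that binary relations on a
  small ordinal belong to \<open>H\<close>.\<close>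

definition sqt :: "'a \<Rightarrow> 'a" where
  "sqt r = un r (un (Rep (prod r r) (\<lambda>p. upr (fs p) (sn p))) (prod r r))"

lemma sqt_iff: "z \<epsilon> sqt r \<longleftrightarrow> z \<epsilon> r \<or> (\<exists>x y. x \<epsilon> r \<and> y \<epsilon> r \<and> (z = upr x y \<or> z = pr x y))"
proof -
  have "z \<epsilon> Rep (prod r r) (\<lambda>p. upr (fs p) (sn p)) \<longleftrightarrow> (\<exists>p. p \<epsilon> prod r r \<and> z = upr (fs p) (sn p))" for z
    by (rule Rep_iff) (intro dfns)
  then show ?thesis unfolding sqt_def un_iff prod_iff by fastforce
qed

text \<open>The transitive closure is carved out of any small transitive superset by Separation, and
  so inherits its size bound.\<close>

lemma H_I:
  assumes "subset_of x t" "transitive_set t" "t \<lesssim> r" "r \<epsilon> mu" shows "x \<epsilon> H"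
proof -
  define T where "T = Sep t (\<lambda>z. \<forall>u. transitive_set u \<and> subset_of x u \<longrightarrow> z \<epsilon> u)"
  have T: "z \<epsilon> T \<longleftrightarrow> z \<epsilon> t \<and> (\<forall>u. transitive_set u \<and> subset_of x u \<longrightarrow> z \<epsilon> u)" for z
    unfolding T_def by (rule Sep_iff) (intro dfns)
  have "transitive_set T"
    unfolding transitive_set_def[of T] subset_of_def[of _ T] T using assms(2) transD by blast
  moreover have "subset_of x T" using assms(1) unfolding subset_of_def T by blast
  moreover have "subset_of T u" if "transitive_set u" "subset_of x u" for u
    using that unfolding subset_of_def[of T] T by blast
  ultimately have "is_trans_closure x T" unfolding is_trans_closure_def by blast
  moreover have "subset_of T t" unfolding subset_of_def T by blast
  then have "T \<lesssim> r" using subset_lep lep_trans assms(3) by blast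
  then have "card_less T mu" using card_less_iff[OF ord_mu] assms(4) by blast
  ultimately show ?thesis using H unfolding is_H_def by blast
qed

lemma H_sqt:
  assumes "subset_of x (sqt r)" "r \<epsilon> mu" shows "x \<epsilon> H"
proof -
  \<comment> \<open>Adding \<open>om\<close> makes the ordinal infinite, as the bounds on products
    and unions require.\<close>
  define r' where "r' = un r om"
  have r': "r' \<epsilon> mu" "subset_of om r'" "subset_of r r'"
    using un_mu[OF assms(2) om_mu] by (auto simp: r'_def subset_of_def)
  have o: "ordinal r'" using r'(1) ord_mu ord_elem by blast
  have "subset_of (sqt r) (sqt r')"
    using r'(3) unfolding subset_of_def sqt_iff by blast
  then have 1: "subset_of x (sqt r')" using assms(1) subset_of_trans by blast
  have 2: "transitive_set (sqt r')"
    unfolding transitive_set_def subset_of_def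
  proof (intro allI impI)
    fix y z assume "y \<epsilon> sqt r'" "z \<epsilon> y"
    then show "z \<epsilon> sqt r'" using ord_trans[OF o] unfolding sqt_iff[of y]
      by (auto simp: sqt_iff pr_def)
  qed
  have "prod r' r' \<lesssim> r'" using prod_lep o r'(2) by blast
  moreover have "Rep (prod r' r') (\<lambda>p. upr (fs p) (sn p)) \<lesssim> r'"
    by (rule Rep_lep) (intro dfns, (rule calculation o)+)
  ultimately have "sqt r' \<lesssim> r'"
    unfolding sqt_def by (auto intro!: un_lep o r'(2) simp: subset_lep)
  then show ?thesis using H_I 1 2 r'(1) by blast
qed

lemma H_prod:
  assumes "subset_of x (prod r r')" "r \<epsilon> mu" "r' \<epsilon> mu" shows "x \<epsilon> H"
proof (rule H_sqt)
  show "un r r' \<epsilon> mu" using assms un_mu by blast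
  show "subset_of x (sqt (un r r'))"
    using assms(1) unfolding subset_of_def sqt_iff prod_iff un_iff by blast
qed

lemma H_subset:
  assumes "subset_of x r" "r \<epsilon> mu" shows "x \<epsilon> H"
  by (rule H_sqt[of x r]) (use assms in \<open>auto simp: subset_of_def sqt_iff\<close>)

lemma H_pair:
  assumes "x \<epsilon> mu" "y \<epsilon> mu" shows "pr x y \<epsilon> H"
proof (rule H_sqt)
  show "un (suc x) (suc y) \<epsilon> mu" using assms un_mu suc_mu by blast
  show "subset_of (pr x y) (sqt (un (suc x) (suc y)))"
    unfolding subset_of_def sqt_iff by (auto simp: pr_def)
qed

text \<open>Pairs of elements of \<open>mu\<close> lie in \<open>H\<close>, so \<open>b\<close>
  doubles as a fixed pairing function on \<open>mu\<close>.\<close>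

definition pp :: "'a \<Rightarrow> 'a \<Rightarrow> 'a" where "pp x y = app b (pr x y)"

lemma dft_pp [dfns]: "dft t \<Longrightarrow> dft u \<Longrightarrow> dft (\<lambda>s. pp (t s) (u s))"
  by (rule tsubst2[where F = pp], unfold pp_def, intro dfns)

lemma pp_mu: "x \<epsilon> mu \<Longrightarrow> y \<epsilon> mu \<Longrightarrow> pp x y \<epsilon> mu"
  unfolding pp_def using H_pair injf_mem[OF b] by blast

lemma pp_eq: "x \<epsilon> mu \<Longrightarrow> y \<epsilon> mu \<Longrightarrow> x' \<epsilon> mu \<Longrightarrow> y' \<epsilon> mu \<Longrightarrow> pp x y = pp x' y' \<longleftrightarrow> x = x' \<and> y = y'"
  unfolding pp_def using injf_eq[OF b] H_pair by simp

text \<open>This is the choice function for definable nonempty parts of \<open>H\<close>. The ideals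
  on \<open>kap\<close> get a parallel one, \<open>leastN\<close>; the lemma
  \<open>least_via_injf\<close> serves both.\<close>

definition leastH :: "('a \<Rightarrow> bool) \<Rightarrow> 'a" where
  "leastH P = the1 (\<lambda>x. x \<epsilon> H \<and> P x \<and> (\<forall>y. y \<epsilon> H \<and> P y \<longrightarrow> app b x = app b y \<or> app b x \<epsilon> app b y))"

lemma dft_leastH [dfns]:
  assumes "dfn (\<lambda>s. P (\<lambda>n. s (Suc n)) (s 0))" shows "dft (\<lambda>s. leastH (P s))"
  unfolding leastH_def
  by (intro dfns dfn_body[of P "\<lambda>n. Suc (Suc n)" 0] assms) (simp_all add: inj_def)

lemma least_via_injf:
  assumes "dfn (\<lambda>s. P (s 0))" "x \<epsilon> A" "P x" "injf f A d" "ordinal d"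
  obtains m where "m \<epsilon> A" "P m"
    "the1 (\<lambda>x. x \<epsilon> A \<and> P x \<and> (\<forall>y. y \<epsilon> A \<and> P y \<longrightarrow> app f x = app f y \<or> app f x \<epsilon> app f y)) = m"
proof -
  note O = ord_elem[OF assms(5) injf_mem[OF assms(4)]]
  have d: "dfn (\<lambda>s. \<exists>x. x \<epsilon> A \<and> P x \<and> app f x = s 0)" by (intro dfns dfn_app_pred[OF assms(1)])
  from ord_min[where P = "\<lambda>v. \<exists>x. x \<epsilon> A \<and> P x \<and> app f x = v", OF d O[OF assms(2)]] assms(2,3)
  obtain m where m: "m \<epsilon> A" "P m" "\<And>z y. z \<epsilon> app f m \<Longrightarrow> y \<epsilon> A \<Longrightarrow> P y \<Longrightarrow> app f y \<noteq> z" by metis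
  have "app f m = app f y \<or> app f m \<epsilon> app f y" if "y \<epsilon> A" "P y" for y
    using ord_cases[OF O[OF m(1)] O[OF that(1)]] m(3) that by metis
  note le = this
  have un: "x = m" if "x \<epsilon> A" "P x" "\<forall>y. y \<epsilon> A \<and> P y \<longrightarrow> app f x = app f y \<or> app f x \<epsilon> app f y" for x
    using that m injf_eq[OF assms(4)] by metis
  have "the1 (\<lambda>x. x \<epsilon> A \<and> P x \<and> (\<forall>y. y \<epsilon> A \<and> P y \<longrightarrow> app f x = app f y \<or> app f x \<epsilon> app f y)) = m"
  proof (rule the1_equality)
    show "m \<epsilon> A \<and> P m \<and> (\<forall>y. y \<epsilon> A \<and> P y \<longrightarrow> app f m = app f y \<or> app f m \<epsilon> app f y)"
      using m(1,2) le by simp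
  qed (use un in simp)
  then show ?thesis by (rule that[OF m(1,2)])
qed

lemma leastH:
  assumes "dfn (\<lambda>s. P (s 0))" "x \<epsilon> H" "P x" shows "leastH P \<epsilon> H" "P (leastH P)"
proof -
  obtain m where m: "m \<epsilon> H" "P m" "leastH P = m"
    using least_via_injf[where P = P, OF assms b ord_mu] unfolding leastH_def by blast
  then show "leastH P \<epsilon> H" "P (leastH P)" by auto
qed

text \<open>Koenig's argument: an injection of \<open>mu\<close> into the power set of \<open>kap\<close> would make \<open>mu\<close> to the
  power \<open>kap\<close> no larger than the set of subsets of \<open>kap \<times> kap\<close>, hence than \<open>mu\<close>.\<close>

lemma not_mu_lep_pow: "\<not> mu \<lesssim> pow kap"
proof
  assume "mu \<lesssim> pow kap"
  then obtain w where w: "injf w mu (pow kap)" unfolding lep_def by blast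
  \<comment> \<open>A function \<open>f\<close> from \<open>kap\<close> to \<open>mu\<close> is
    encoded by the relation whose section at \<open>i\<close> is the subset of \<open>kap\<close>
    that \<open>w\<close> assigns to \<open>f i\<close>. The relation lies in \<open>H\<close>, so
    \<open>f\<close> receives an ordinal code below \<open>mu\<close>.\<close>
  define S where "S f = Sep (prod kap kap) (\<lambda>p. sn p \<epsilon> app w (app f (fs p)))" for f
  define \<Psi> where "\<Psi> f = app b (S f)" for f
  have [dfns]: "dft (\<lambda>s. \<Psi> (t s))" if "dft t" for t
    using _ that by (rule tsubst1[where F = \<Psi>]) (unfold \<Psi>_def S_def, intro dfns)
  have S: "pr i x \<epsilon> S f \<longleftrightarrow> i \<epsilon> kap \<and> x \<epsilon> kap \<and> x \<epsilon> app w (app f i)" for f i x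
  proof -
    have "pr i x \<epsilon> S f \<longleftrightarrow> pr i x \<epsilon> prod kap kap \<and> sn (pr i x) \<epsilon> app w (app f (fs (pr i x)))"
      unfolding S_def by (rule Sep_iff) (intro dfns)
    then show ?thesis by simp
  qed
  have SH: "S f \<epsilon> H" for f
  proof (rule H_prod)
    have "p \<epsilon> S f \<longleftrightarrow> p \<epsilon> prod kap kap \<and> sn p \<epsilon> app w (app f (fs p))" for p
      unfolding S_def by (rule Sep_iff) (intro dfns)
    then show "subset_of (S f) (prod kap kap)" by (simp add: subset_of_def)
  qed (rule kap_mu)+
  have \<Psi>: "app f i = app g i" if fg: "is_fun f kap mu" "is_fun g kap mu" "\<Psi> f = \<Psi> g" and i: "i \<epsilon> kap" for f g i
  proof -
    have "S f = S g" using injf_eq[OF b SH SH] fg(3) unfolding \<Psi>_def by simp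
    then have "x \<epsilon> app w (app f i) \<longleftrightarrow> x \<epsilon> app w (app g i)" if "x \<epsilon> kap" for x
      using S[of i x f] S[of i x g] i that by simp
    moreover have "app f i \<epsilon> mu" "app g i \<epsilon> mu" using fg i is_fun_app by auto
    moreover from this have "subset_of (app w (app f i)) kap" "subset_of (app w (app g i)) kap"
      using injf_mem[OF w] by auto
    ultimately have "app w (app f i) = app w (app g i)" unfolding subset_of_def by (intro ext) blast
    then show ?thesis using injf_eq[OF w] \<open>app f i \<epsilon> mu\<close> \<open>app g i \<epsilon> mu\<close> by blast
  qed
  \<comment> \<open>The value \<open>y\<close> escapes, at \<open>i\<close>, all functions with code
    below \<open>c i\<close>. Such a value exists because otherwise \<open>mu\<close> would inject
    into \<open>c i\<close>.\<close>
  define Q where "Q i y \<longleftrightarrow> y \<epsilon> mu \<and> (\<forall>f. is_fun f kap mu \<and> \<Psi> f \<epsilon> app c i \<longrightarrow> app f i \<noteq> y)" for i y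
  have [dfns]: "dfn (\<lambda>s. Q (t s) (u s))" if "dft t" "dft u" for t u
    using _ that by (rule subst2[where P = Q]) (unfold Q_def, intro dfns)
  have ex: "\<exists>y. Q i y" if i: "i \<epsilon> kap" for i
  proof (rule ccontr)
    assume n: "\<nexists>y. Q i y"
    \<comment> \<open>Each \<open>y\<close> is sent to the least code below \<open>c i\<close> of a
      function with value \<open>y\<close> at \<open>i\<close>; the code determines the function and
      hence \<open>y\<close>.\<close>
    define G where "G y = leastO (\<lambda>z. \<exists>f. is_fun f kap mu \<and> \<Psi> f = z \<and> z \<epsilon> app c i \<and> app f i = y)" for y
    have G: "\<exists>f. is_fun f kap mu \<and> \<Psi> f = G y \<and> G y \<epsilon> app c i \<and> app f i = y" if y: "y \<epsilon> mu" for y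
    proof -
      obtain f where f: "is_fun f kap mu" "\<Psi> f \<epsilon> app c i" "app f i = y" using n y unfolding Q_def by blast
      have d: "dfn (\<lambda>s. \<exists>f. is_fun f kap mu \<and> \<Psi> f = s 0 \<and> s 0 \<epsilon> app c i \<and> app f i = y)" by (intro dfns)
      have o: "ordinal (\<Psi> f)" using f(2) c_mu[OF i] ord_mu ord_elem by blast
      show ?thesis unfolding G_def
        by (rule leastO(2)[where P = "\<lambda>z. \<exists>f. is_fun f kap mu \<and> \<Psi> f = z \<and> z \<epsilon> app c i \<and> app f i = y", OF d o])
          (use f in blast)
    qed
    have "mu \<lesssim> app c i"
    proof (rule lepI[of G])
      show "dft (\<lambda>s. G (s 0))" unfolding G_def by (intro dfns)
      show "G x \<epsilon> app c i" if "x \<epsilon> mu" for x using G[OF that] by blast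
      show "x = y" if "x \<epsilon> mu" "y \<epsilon> mu" "G x = G y" for x y
        using G[OF that(1)] G[OF that(2)] that(3) \<Psi> i by metis
    qed
    then show False using mu_not_lep c_mu i by blast
  qed
  define d where "d i = leastO (Q i)" for i
  have d: "Q i (d i)" if i: "i \<epsilon> kap" for i
  proof -
    obtain y where y: "Q i y" using ex i by blast
    have "dfn (\<lambda>s. Q i (s 0))" by (intro dfns)
    then show ?thesis unfolding d_def using y ord_elem ord_mu leastO(2)[where P = "Q i"] unfolding Q_def by blast
  qed
  have dd: "dft (\<lambda>s. d (s 0))" unfolding d_def by (intro dfns)
  \<comment> \<open>The diagonal function: its own code lies below some \<open>c i\<close>, and
    there it would have to differ from itself.\<close>
  define D where "D = lam kap d"
  have D: "is_fun D kap mu" unfolding D_def by (rule lam_is_fun[OF dd]) (use d Q_def in blast)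
  have "\<Psi> D \<epsilon> mu" unfolding \<Psi>_def using injf_mem[OF b SH] .
  then obtain i where i: "i \<epsilon> kap" "\<Psi> D \<epsilon> app c i" using c_cofinal by blast
  have "app D i = d i" unfolding D_def using app_lam[OF dd i(1)] .
  then show False using d[OF i(1)] i D unfolding Q_def by blast
qed

text \<open>The power set of \<open>kap\<close> is contained in \<open>H\<close>, hence equipollent
  to some ordinal \<open>t\<close> not above \<open>mu\<close>, and Koenig's argument excludes
  \<open>t = mu\<close>. Sets of subsets of \<open>kap\<close> then become subsets of
  \<open>t < mu\<close>, which lie in \<open>H\<close>. The ideals on \<open>kap\<close> are among
  them.\<close>

lemma pow_pow_lep: "pow (pow kap) \<lesssim> mu"
proof -
  have "pow kap \<lesssim> mu"
  proof -
    have "pow kap \<lesssim> H" by (rule subset_lep) (use H_subset kap_mu in \<open>auto simp: subset_of_def\<close>)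
    also have "H \<lesssim> mu" using b unfolding lep_def by blast
    finally show ?thesis .
  qed
  then obtain t where t: "ordinal t" "subset_of t mu" "equipollent (pow kap) t"
    using lep_ordinal_equipollent ord_mu by blast
  have "t \<noteq> mu" using t(3) not_mu_lep_pow equipollent_sym equipollent_lep by blast
  then have "t \<epsilon> mu" using t ord_psubset ord_mu by blast
  obtain h where h: "injf h (pow kap) t" using equipollent_lep[OF t(3)] unfolding lep_def by blast
  have R: "y \<epsilon> Rep X (app h) \<longleftrightarrow> (\<exists>x. x \<epsilon> X \<and> y = app h x)" for X y
    by (rule Rep_iff) (intro dfns)
  have RH: "Rep X (app h) \<epsilon> H" if "X \<epsilon> pow (pow kap)" for X
    by (rule H_subset[of _ t]) (use that injf_mem[OF h] \<open>t \<epsilon> mu\<close> in \<open>auto simp: subset_of_def R\<close>)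
  show ?thesis
  proof (rule lepI[of "\<lambda>X. app b (Rep X (app h))"])
    show "dft (\<lambda>s. app b (Rep (s 0) (app h)))" by (intro dfns)
    show "app b (Rep X (app h)) \<epsilon> mu" if "X \<epsilon> pow (pow kap)" for X
      using RH[OF that] injf_mem[OF b] by blast
    show "X = Y" if XY: "X \<epsilon> pow (pow kap)" "Y \<epsilon> pow (pow kap)" "app b (Rep X (app h)) = app b (Rep Y (app h))" for X Y
    proof (rule ext)
      fix x
      have "Rep X (app h) = Rep Y (app h)" using XY RH injf_eq[OF b] by blast
      then have "(\<exists>z. z \<epsilon> X \<and> app h x = app h z) \<longleftrightarrow> (\<exists>z. z \<epsilon> Y \<and> app h x = app h z)"
        using R by metis
      then show "x \<epsilon> X \<longleftrightarrow> x \<epsilon> Y"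
        using XY(1,2) injf_eq[OF h] unfolding pow_iff[of _ "pow kap"] subset_of_def[of _ "pow kap"] by metis
    qed
  qed
qed

end

section \<open>Normal ideals\<close>

context ZF_DC
begin

lemma DC:
  assumes "x \<epsilon> A" "\<And>x. x \<epsilon> A \<Longrightarrow> \<exists>y. y \<epsilon> A \<and> pr x y \<epsilon> r"
  obtains f where "\<And>n. n \<epsilon> om \<Longrightarrow> app f n \<epsilon> A" "\<And>n. n \<epsilon> om \<Longrightarrow> pr (app f n) (app f (suc n)) \<epsilon> r"
proof -
  have "\<not> is_empty A" using assms(1) by (auto simp: is_empty_def)
  from dependent_choice[OF this, of r] assms(2) obtain f where f: "is_fun f om A"
    "\<And>n x y. n \<epsilon> om \<Longrightarrow> related f n x \<Longrightarrow> related f (suc n) y \<Longrightarrow> related r x y"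
    unfolding is_omega_iff is_succ_iff related_iff by metis
  show ?thesis
  proof (rule that[of f])
    show "app f n \<epsilon> A" if "n \<epsilon> om" for n using is_fun_app f(1) that by blast
    show "pr (app f n) (app f (suc n)) \<epsilon> r" if "n \<epsilon> om" for n
      using f(2)[of n "app f n" "app f (suc n)"] that om_suc
      unfolding is_fun_related[OF f(1)] unfolding related_iff by blast
  qed
qed

lemma wfr_DC:
  assumes "\<And>f. (\<And>n. n \<epsilon> om \<Longrightarrow> app f n \<epsilon> X) \<Longrightarrow> (\<And>n. n \<epsilon> om \<Longrightarrow> pr (app f (suc n)) (app f n) \<epsilon> R) \<Longrightarrow> False"
  shows "wfr X R"
  unfolding wfr_def
proof (intro allI impI, rule ccontr)
  fix B assume B: "subset_of B X \<and> (\<exists>x. x \<epsilon> B)" and n: "\<not> (\<exists>m. m \<epsilon> B \<and> (\<forall>y. y \<epsilon> B \<longrightarrow> \<not> pr y m \<epsilon> R))"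
  define r where "r = Sep (prod B B) (\<lambda>p. pr (sn p) (fs p) \<epsilon> R)"
  have r: "pr x y \<epsilon> r \<longleftrightarrow> x \<epsilon> B \<and> y \<epsilon> B \<and> pr y x \<epsilon> R" for x y
  proof -
    have "pr x y \<epsilon> r \<longleftrightarrow> pr x y \<epsilon> prod B B \<and> pr (sn (pr x y)) (fs (pr x y)) \<epsilon> R"
      unfolding r_def by (rule Sep_iff) (intro dfns)
    then show ?thesis by simp
  qed
  obtain x where x: "x \<epsilon> B" using B by blast
  have "\<exists>y. y \<epsilon> B \<and> pr x y \<epsilon> r" if "x \<epsilon> B" for x using n that r by blast
  from DC[OF x this] obtain f where f: "\<And>n. n \<epsilon> om \<Longrightarrow> app f n \<epsilon> B" "\<And>n. n \<epsilon> om \<Longrightarrow> pr (app f n) (app f (suc n)) \<epsilon> r" by blast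
  show False by (rule assms[of f]) (use f r B subset_ofD in blast)+
qed

end

context singular_aleph
begin

lemma kap_bdd:
  assumes "dft (\<lambda>s. F (s 0))" "t \<epsilon> kap" "\<And>x. x \<epsilon> t \<Longrightarrow> F x \<epsilon> kap"
  shows "\<exists>d. d \<epsilon> kap \<and> (\<forall>x. x \<epsilon> t \<longrightarrow> F x \<epsilon> d)"
  using kap_bounded[of t "lam t F"] app_lam[OF assms(1), of _ t] assms(2,3) by auto

lemma kap_ord: "x \<epsilon> kap \<Longrightarrow> ordinal x"
  using ord_kap ord_elem by blast

lemma kap_trans: "x \<epsilon> y \<Longrightarrow> y \<epsilon> kap \<Longrightarrow> x \<epsilon> kap"
  using ord_kap ord_trans by blast

lemma emp_kap: "emp \<epsilon> kap" using om_emp om_kap kap_trans by blast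

lemma kap_sub: "ordinal x \<Longrightarrow> subset_of x y \<Longrightarrow> y \<epsilon> kap \<Longrightarrow> x \<epsilon> kap"
  using ord_sub_mem ord_kap by blast

lemma suc_kap: assumes "x \<epsilon> kap" shows "suc x \<epsilon> kap"
proof -
  have 1: "suc emp \<epsilon> kap" using om_emp om_suc om_kap kap_trans by blast
  have "dft (\<lambda>s. x)" by (intro dfns)
  from kap_bdd[where F = "\<lambda>_. x", OF this 1] assms obtain d where d: "d \<epsilon> kap" "x \<epsilon> d"
    by (metis suc_iff)
  then have "subset_of (suc x) d" using suc_subset kap_ord assms by blast
  then show ?thesis using kap_sub d(1) assms kap_ord by simp
qed

lemma un_kap: "x \<epsilon> kap \<Longrightarrow> y \<epsilon> kap \<Longrightarrow> un x y \<epsilon> kap"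
  using ord_un kap_ord by metis

definition fib :: "'a \<Rightarrow> 'a \<Rightarrow> 'a \<Rightarrow> 'a" where "fib A p j = Sep A (\<lambda>i. app p i = j)"

lemma dft_fib [dfns]: "dft t \<Longrightarrow> dft u \<Longrightarrow> dft v \<Longrightarrow> dft (\<lambda>s. fib (t s) (u s) (v s))"
  by (rule tsubst3[where F = fib], unfold fib_def, intro dfns)

lemma fib_iff [simp]: "i \<epsilon> fib A p j \<longleftrightarrow> i \<epsilon> A \<and> app p i = j"
  unfolding fib_def by (rule Sep_iff) (intro dfns)

text \<open>The exceptional segment \<open>d\<close> absorbs the points that are too small for the
  intended values; it is harmless because every normal ideal contains the bounded sets.\<close>

definition regressive :: "'a \<Rightarrow> 'a \<Rightarrow> bool" where
  "regressive p A \<longleftrightarrow> (\<exists>d. d \<epsilon> kap \<and> (\<forall>i. i \<epsilon> A \<longrightarrow> i \<epsilon> d \<or> app p i \<epsilon> i))"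

text \<open>Normality is stated in the form of Fodor's lemma. This speaks of one function
  \<open>p\<close> instead of a sequence of null sets, and finite and countable unions come out as
  special cases. The clause \<open>subset_of kap I\<close> puts the initial segments of
  \<open>kap\<close> into \<open>I\<close>. Properness is kept apart, in \<open>ip\<close>.\<close>

definition normal :: "'a \<Rightarrow> bool" where
  "normal I \<longleftrightarrow> subset_of I (pow kap) \<and> subset_of kap I \<and> (\<forall>A B. A \<epsilon> I \<and> subset_of B A \<longrightarrow> B \<epsilon> I) \<and>
     (\<forall>A p. subset_of A kap \<and> regressive p A \<and> (\<forall>j. j \<epsilon> kap \<longrightarrow> fib A p j \<epsilon> I) \<longrightarrow> A \<epsilon> I)"

lemma dfn_regressive [dfns]: "dft t \<Longrightarrow> dft u \<Longrightarrow> dfn (\<lambda>s. regressive (t s) (u s))"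
  by (rule subst2[where P = regressive], unfold regressive_def, intro dfns)

lemma dfn_normal [dfns]: "dft t \<Longrightarrow> dfn (\<lambda>s. normal (t s))"
  by (rule subst1[where P = normal], unfold normal_def, intro dfns)

lemma normalD:
  assumes "normal I"
  shows "A \<epsilon> I \<Longrightarrow> subset_of A kap" "d \<epsilon> kap \<Longrightarrow> d \<epsilon> I" "A \<epsilon> I \<Longrightarrow> subset_of B A \<Longrightarrow> B \<epsilon> I"
    "subset_of A kap \<Longrightarrow> regressive p A \<Longrightarrow> (\<And>j. j \<epsilon> kap \<Longrightarrow> fib A p j \<epsilon> I) \<Longrightarrow> A \<epsilon> I"
proof -
  note * = assms[unfolded normal_def]
  show "A \<epsilon> I \<Longrightarrow> subset_of A kap" "d \<epsilon> kap \<Longrightarrow> d \<epsilon> I" using * subset_ofD pow_iff by metis+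
  show "A \<epsilon> I \<Longrightarrow> subset_of B A \<Longrightarrow> B \<epsilon> I" using * by blast
  show "subset_of A kap \<Longrightarrow> regressive p A \<Longrightarrow> (\<And>j. j \<epsilon> kap \<Longrightarrow> fib A p j \<epsilon> I) \<Longrightarrow> A \<epsilon> I" using * by blast
qed

lemma regressiveI: "d \<epsilon> kap \<Longrightarrow> (\<And>i. i \<epsilon> A \<Longrightarrow> \<not> i \<epsilon> d \<Longrightarrow> app p i \<epsilon> i) \<Longrightarrow> regressive p A"
  unfolding regressive_def by blast

text \<open>The union is split by a function with values 0 and 1, which is regressive from 2
  on.\<close>

lemma normal_un:
  assumes I: "normal I" and A: "A \<epsilon> I" and B: "B \<epsilon> I" shows "un A B \<epsilon> I"
proof -
  define p where "p = lam kap (\<lambda>i. if i \<epsilon> A then emp else suc emp)"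
  have p: "app p i = (if i \<epsilon> A then emp else suc emp)" if "i \<epsilon> kap" for i
    unfolding p_def by (rule app_lam) (intro dfns, rule that)
  have s: "subset_of (un A B) kap" using normalD(1)[OF I] A B by (auto simp: subset_of_def)
  show ?thesis
  proof (rule normalD(4)[OF I s])
    have "suc (suc emp) \<epsilon> kap" using suc_kap emp_kap by blast
    show "regressive p (un A B)"
    proof (rule regressiveI[OF \<open>suc (suc emp) \<epsilon> kap\<close>])
      fix i assume "i \<epsilon> un A B" and n: "\<not> i \<epsilon> suc (suc emp)"
      then have i: "i \<epsilon> kap" using s subset_ofD by blast
      then have "subset_of (suc (suc emp)) i" using ord_not_mem[OF kap_ord[OF i] kap_ord[OF \<open>suc (suc emp) \<epsilon> kap\<close>]] n by blast
      then have "emp \<epsilon> i" "suc emp \<epsilon> i" by (auto simp: subset_of_def)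
      then show "app p i \<epsilon> i" using p[OF i] by simp
    qed
    fix j
    have "subset_of (fib (un A B) p j) A \<or> subset_of (fib (un A B) p j) B"
    proof (cases "j = emp")
      case True
      then have "subset_of (fib (un A B) p j) A"
        unfolding subset_of_def fib_iff using p s[unfolded subset_of_def] suc_not_emp by metis
      then show ?thesis ..
    next
      case False
      then have "subset_of (fib (un A B) p j) B"
        unfolding subset_of_def fib_iff using p s[unfolded subset_of_def] un_iff by metis
      then show ?thesis ..
    qed
    then show "fib (un A B) p j \<epsilon> I" using normalD(3)[OF I] A B by blast
  qed
qed

text \<open>Sending \<open>i\<close> to the least \<open>n\<close> with \<open>i\<close> in
  \<open>F n\<close> is regressive from \<open>om\<close> on. This is where uncountability of
  \<open>kap\<close> is needed.\<close>

lemma normal_countable: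
  assumes I: "normal I" and F: "dft (\<lambda>s. F (s 0))" and B: "\<And>n. n \<epsilon> om \<Longrightarrow> F n \<epsilon> I"
    and A: "subset_of A kap" "\<And>i. i \<epsilon> A \<Longrightarrow> \<exists>n. n \<epsilon> om \<and> i \<epsilon> F n"
  shows "A \<epsilon> I"
proof -
  have dF: "dfn (\<lambda>s. s 0 \<epsilon> om \<and> i \<epsilon> F (s 0))" for i by (intro dfns F)
  define p where "p = lam A (\<lambda>i. leastO (\<lambda>n. n \<epsilon> om \<and> i \<epsilon> F n))"
  have p: "app p i \<epsilon> om" "i \<epsilon> F (app p i)" if i: "i \<epsilon> A" for i
  proof -
    obtain n where n: "n \<epsilon> om" "i \<epsilon> F n" using A i by blast
    have "app p i = leastO (\<lambda>n. n \<epsilon> om \<and> i \<epsilon> F n)"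
      unfolding p_def by (rule app_lam) (intro dfns dft_app_fun[OF F], rule i)
    then show "app p i \<epsilon> om" "i \<epsilon> F (app p i)"
      using leastO(2)[where P = "\<lambda>n. n \<epsilon> om \<and> i \<epsilon> F n", OF dF om_ord[OF n(1)]] n by auto
  qed
  show ?thesis
  proof (rule normalD(4)[OF I A(1), of p])
    show "regressive p A"
    proof (rule regressiveI[OF om_kap])
      fix i assume i: "i \<epsilon> A" "\<not> i \<epsilon> om"
      then have "subset_of om i" using ord_not_mem kap_ord A(1) subset_ofD ord_om by metis
      then show "app p i \<epsilon> i" using p(1)[OF i(1)] subset_ofD by blast
    qed
    fix j
    show "fib A p j \<epsilon> I"
    proof (cases "j \<epsilon> om")
      case True
      have "subset_of (fib A p j) (F j)" unfolding subset_of_def fib_iff using p(2) by blast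
      then show ?thesis using normalD(3)[OF I] B True by blast
    next
      case False
      then have "fib A p j = emp" using p(1) by (intro ext) auto
      then show ?thesis using normalD(2)[OF I] emp_kap by simp
    qed
  qed
qed

text \<open>The nonstationary ideal: its members avoid the closure points of some \<open>F\<close>.\<close>

definition avoids :: "'a \<Rightarrow> 'a \<Rightarrow> 'a \<Rightarrow> bool" where
  "avoids A F d \<longleftrightarrow> d \<epsilon> kap \<and> (\<forall>j. j \<epsilon> kap \<longrightarrow> app F j \<epsilon> kap) \<and>
     (\<forall>i. i \<epsilon> A \<longrightarrow> i \<epsilon> d \<or> (\<exists>j. j \<epsilon> i \<and> i \<epsilon> app F j))"

definition NS :: 'a where "NS = Sep (pow kap) (\<lambda>A. \<exists>F d. avoids A F d)"

lemma dfn_avoids [dfns]: "dft t \<Longrightarrow> dft u \<Longrightarrow> dft v \<Longrightarrow> dfn (\<lambda>s. avoids (t s) (u s) (v s))"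
  by (rule subst3[where P = avoids], unfold avoids_def, intro dfns)

lemma NS_iff: "A \<epsilon> NS \<longleftrightarrow> subset_of A kap \<and> (\<exists>F d. avoids A F d)"
proof -
  have "A \<epsilon> NS \<longleftrightarrow> A \<epsilon> pow kap \<and> (\<exists>F d. avoids A F d)"
    unfolding NS_def by (rule Sep_iff) (intro dfns)
  then show ?thesis by simp
qed

lemma NS_normal: "normal NS"
  unfolding normal_def
proof (intro conjI allI impI)
  show "subset_of NS (pow kap)" by (simp add: subset_of_def[of NS] NS_iff)
  show "subset_of kap NS"
    unfolding subset_of_def[of _ NS] NS_iff
  proof (intro allI impI conjI)
    fix d assume d: "d \<epsilon> kap"
    show "subset_of d kap" using d ord_mem_subset ord_kap by blast
    have "app (lam kap (\<lambda>x. x)) j = j" if "j \<epsilon> kap" for j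
      by (rule app_lam) (intro dfns, rule that)
    then have "avoids d (lam kap (\<lambda>x. x)) d" unfolding avoids_def using d by simp
    then show "\<exists>F e. avoids d F e" by blast
  qed
  fix A B assume "A \<epsilon> NS \<and> subset_of B A"
  then show "B \<epsilon> NS" unfolding NS_iff avoids_def
    using subset_of_trans subset_ofD by meson
next
  fix A p assume *: "subset_of A kap \<and> regressive p A \<and> (\<forall>j. j \<epsilon> kap \<longrightarrow> fib A p j \<epsilon> NS)"
  then obtain d where d: "d \<epsilon> kap" "\<And>i. i \<epsilon> A \<Longrightarrow> i \<epsilon> d \<or> app p i \<epsilon> i" unfolding regressive_def by blast
  \<comment> \<open>Witnesses for all fibres at once: functions from \<open>kap\<close> to
    \<open>kap\<close> lie in \<open>H\<close> because \<open>kap < mu\<close>, so they can be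
    chosen by \<open>leastH\<close>.\<close>
  define Fc where "Fc j = leastH (\<lambda>F. \<exists>e. avoids (fib A p j) F e)" for j
  define dc where "dc j = leastO (\<lambda>e. avoids (fib A p j) (Fc j) e)" for j
  have [dfns]: "dft (\<lambda>s. Fc (t s))" if "dft t" for t
    using _ that by (rule tsubst1[where F = Fc]) (unfold Fc_def, intro dfns)
  have [dfns]: "dft (\<lambda>s. dc (t s))" if "dft t" for t
    using _ that by (rule tsubst1[where F = dc]) (unfold dc_def, intro dfns)
  have av: "avoids (fib A p j) (Fc j) (dc j)" if j: "j \<epsilon> kap" for j
  proof -
    obtain F e where F: "avoids (fib A p j) F e" using * j NS_iff by blast
    \<comment> \<open>The set \<open>F\<close> is arbitrary outside \<open>kap\<close>; its
      restriction lies in \<open>H\<close>.\<close>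
    define F' where "F' = lam kap (app F)"
    have F': "app F' k = app F k" if "k \<epsilon> kap" for k
      unfolding F'_def by (rule app_lam) (intro dfns, rule that)
    have l: "q \<epsilon> F' \<longleftrightarrow> (\<exists>x. x \<epsilon> kap \<and> q = pr x (app F x))" for q
      unfolding F'_def by (rule lam_iff) (intro dfns)
    have "F' \<epsilon> H"
      by (rule H_prod[OF _ kap_mu kap_mu]) (use F in \<open>auto simp: avoids_def subset_of_def l\<close>)
    moreover have "k \<epsilon> kap" if "i \<epsilon> fib A p j" "k \<epsilon> i" for i k
      using that * kap_trans subset_ofD by fastforce
    then have "avoids (fib A p j) F' e" using F F' unfolding avoids_def by metis
    moreover have d1: "dfn (\<lambda>s. \<exists>e. avoids (fib A p j) (s 0) e)" by (intro dfns)
    ultimately have "\<exists>e. avoids (fib A p j) (Fc j) e"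
      unfolding Fc_def using leastH(2)[where P = "\<lambda>F. \<exists>e. avoids (fib A p j) F e"] by blast
    then obtain e where e: "avoids (fib A p j) (Fc j) e" by blast
    then have "ordinal e" unfolding avoids_def using kap_ord by blast
    moreover have "dfn (\<lambda>s. avoids (fib A p j) (Fc j) (s 0))" by (intro dfns)
    ultimately show ?thesis unfolding dc_def using e leastO(2)[where P = "\<lambda>e. avoids (fib A p j) (Fc j) e"] by blast
  qed
  \<comment> \<open>A bound for all witnessing functions with index and argument up to
    \<open>m\<close>. A point closed under such bounds is closed under each function whose index is
    below it, which is the diagonal intersection.\<close>
  define good where "good m e \<longleftrightarrow> e \<epsilon> kap \<and> (\<forall>j k. j \<epsilon> suc m \<and> k \<epsilon> suc m \<longrightarrow> app (Fc j) k \<epsilon> e) \<and>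
    (\<forall>j. j \<epsilon> suc m \<longrightarrow> dc j \<epsilon> e)" for m e
  have [dfns]: "dfn (\<lambda>s. good (t s) (u s))" if "dft t" "dft u" for t u
    using _ that by (rule subst2[where P = good]) (unfold good_def, intro dfns)
  have ex: "\<exists>e. good m e" if m: "m \<epsilon> kap" for m
  proof -
    have sm: "suc m \<epsilon> kap" using suc_kap m by blast
    have k: "x \<epsilon> kap" if "x \<epsilon> suc m" for x using that sm kap_trans by blast
    define B where "B j = leastO (\<lambda>e. e \<epsilon> kap \<and> (\<forall>k. k \<epsilon> suc m \<longrightarrow> app (Fc j) k \<epsilon> e))" for j
    have B: "B j \<epsilon> kap \<and> (\<forall>k. k \<epsilon> suc m \<longrightarrow> app (Fc j) k \<epsilon> B j)" if j: "j \<epsilon> suc m" for j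
    proof -
      have "app (Fc j) x \<epsilon> kap" if "x \<epsilon> suc m" for x using av[OF k[OF j]] k[OF that] unfolding avoids_def by blast
      from kap_bounded[OF sm this] obtain e where e: "e \<epsilon> kap" "\<forall>k. k \<epsilon> suc m \<longrightarrow> app (Fc j) k \<epsilon> e" by blast
      have "dfn (\<lambda>s. s 0 \<epsilon> kap \<and> (\<forall>k. k \<epsilon> suc m \<longrightarrow> app (Fc j) k \<epsilon> s 0))" by (intro dfns)
      from leastO(2)[where P = "\<lambda>e. e \<epsilon> kap \<and> (\<forall>k. k \<epsilon> suc m \<longrightarrow> app (Fc j) k \<epsilon> e)", OF this kap_ord[OF e(1)]] e
      show ?thesis unfolding B_def by blast
    qed
    have "\<exists>e. e \<epsilon> kap \<and> (\<forall>j. j \<epsilon> suc m \<longrightarrow> B j \<epsilon> e)"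
      by (rule kap_bdd[OF _ sm]) (unfold B_def[abs_def], intro dfns, use B B_def in auto)
    then obtain e1 where e1: "e1 \<epsilon> kap" "\<And>j. j \<epsilon> suc m \<Longrightarrow> B j \<epsilon> e1" by blast
    have "\<exists>e. e \<epsilon> kap \<and> (\<forall>j. j \<epsilon> suc m \<longrightarrow> dc j \<epsilon> e)"
      by (rule kap_bdd[OF _ sm]) (intro dfns, use av k avoids_def in blast)
    then obtain e2 where e2: "e2 \<epsilon> kap" "\<And>j. j \<epsilon> suc m \<Longrightarrow> dc j \<epsilon> e2" by blast
    have "good m (un e1 e2)"
      unfolding good_def
    proof (intro conjI allI impI)
      show "un e1 e2 \<epsilon> kap" using e1 e2 un_kap by blast
      show "dc j \<epsilon> un e1 e2" if "j \<epsilon> suc m" for j using e2(2)[OF that] by simp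
      fix j k' assume "j \<epsilon> suc m \<and> k' \<epsilon> suc m"
      then have "app (Fc j) k' \<epsilon> B j" "B j \<epsilon> e1" using B e1 by auto
      then have "app (Fc j) k' \<epsilon> e1" using ord_trans kap_ord[OF e1(1)] by blast
      then show "app (Fc j) k' \<epsilon> un e1 e2" by simp
    qed
    then show ?thesis by blast
  qed
  define G where "G = lam kap (\<lambda>m. leastO (good m))"
  have G: "good m (app G m)" if m: "m \<epsilon> kap" for m
  proof -
    obtain e where e: "good m e" using ex m by blast
    then have o: "ordinal e" unfolding good_def using kap_ord by blast
    have "dfn (\<lambda>s. good m (s 0))" by (intro dfns)
    from leastO(2)[where P = "good m", OF this o e] have "good m (leastO (good m))" .
    moreover have "app G m = leastO (good m)" unfolding G_def by (rule app_lam) (intro dfns, rule m)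
    ultimately show ?thesis by simp
  qed
  have "avoids A G d"
    unfolding avoids_def
  proof (intro conjI allI impI)
    show "d \<epsilon> kap" by (rule d)
    show "app G j \<epsilon> kap" if "j \<epsilon> kap" for j using G[OF that] unfolding good_def by blast
    fix i assume i: "i \<epsilon> A"
    then have ik: "i \<epsilon> kap" using * subset_ofD by blast
    show "i \<epsilon> d \<or> (\<exists>j. j \<epsilon> i \<and> i \<epsilon> app G j)"
    proof (cases "i \<epsilon> d")
      case False
      define j where "j = app p i"
      have j: "j \<epsilon> i" "i \<epsilon> fib A p j" using d(2)[OF i] False i by (auto simp: j_def)
      have jk: "j \<epsilon> kap" using j ik kap_trans by blast
      from av[OF jk] j(2) consider "i \<epsilon> dc j" | k where "k \<epsilon> i" "i \<epsilon> app (Fc j) k"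
        unfolding avoids_def by blast
      then show ?thesis
      proof cases
        case 1
        have g: "dc j \<epsilon> app G j" "app G j \<epsilon> kap" using G[OF jk] unfolding good_def by auto
        then have "i \<epsilon> app G j" using 1 ord_trans kap_ord by blast
        with j(1) show ?thesis by blast
      next
        case (2 k)
        have kk: "k \<epsilon> kap" using 2 ik kap_trans by blast
        \<comment> \<open>One stage has to cover both the index \<open>j\<close> and the argument
          \<open>k\<close>, hence their maximum, still below \<open>i\<close>.\<close>
        define m where "m = un j k"
        have m: "m \<epsilon> kap" "m \<epsilon> i" unfolding m_def
          using ord_un[OF kap_ord[OF jk] kap_ord[OF kk]] jk kk j(1) 2(1) by auto
        have "subset_of j m" "subset_of k m" by (auto simp: m_def subset_of_def)
        then have "j \<epsilon> suc m" "k \<epsilon> suc m"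
          using ord_subset_iff[OF kap_ord[OF jk] kap_ord[OF m(1)]] ord_subset_iff[OF kap_ord[OF kk] kap_ord[OF m(1)]] by auto
        then have g: "app (Fc j) k \<epsilon> app G m" "app G m \<epsilon> kap" using G[OF m(1)] unfolding good_def by auto
        then have "i \<epsilon> app G m" using 2 ord_trans kap_ord by blast
        with m(2) show ?thesis by blast
      qed
    qed simp
  qed
  then show "A \<epsilon> NS" unfolding NS_iff using * by blast
qed

text \<open>Dependent choice gives an increasing sequence above \<open>d\<close> in which each
  member exceeds the \<open>F\<close>-values at all points below its predecessor. Its supremum is a
  closure point of \<open>F\<close>, and it lies below \<open>kap\<close> because countable subsets
  of \<open>kap\<close> are bounded.\<close>

lemma NS_proper: "\<not> kap \<epsilon> NS"
proof
  assume "kap \<epsilon> NS"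
  then obtain F d where F: "avoids kap F d" unfolding NS_iff by blast
  have d: "d \<epsilon> kap" and Fk: "\<And>j. j \<epsilon> kap \<Longrightarrow> app F j \<epsilon> kap" using F unfolding avoids_def by auto
  define r where "r = Sep (prod kap kap) (\<lambda>q. d \<epsilon> sn q \<and> fs q \<epsilon> sn q \<and> (\<forall>j. j \<epsilon> fs q \<longrightarrow> app F j \<epsilon> sn q))"
  have r: "pr x y \<epsilon> r \<longleftrightarrow> x \<epsilon> kap \<and> y \<epsilon> kap \<and> d \<epsilon> y \<and> x \<epsilon> y \<and> (\<forall>j. j \<epsilon> x \<longrightarrow> app F j \<epsilon> y)" for x y
  proof -
    have "pr x y \<epsilon> r \<longleftrightarrow> pr x y \<epsilon> prod kap kap \<and> (d \<epsilon> sn (pr x y) \<and> fs (pr x y) \<epsilon> sn (pr x y) \<and>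
        (\<forall>j. j \<epsilon> fs (pr x y) \<longrightarrow> app F j \<epsilon> sn (pr x y)))"
      unfolding r_def by (rule Sep_iff) (intro dfns)
    then show ?thesis by simp
  qed
  have "\<exists>y. y \<epsilon> kap \<and> pr x y \<epsilon> r" if x: "x \<epsilon> kap" for x
  proof -
    obtain e where e: "e \<epsilon> kap" "\<And>j. j \<epsilon> x \<Longrightarrow> app F j \<epsilon> e"
      using kap_bounded[OF x, of F] Fk kap_trans x by metis
    define y where "y = suc (un (un d x) e)"
    have y: "y \<epsilon> kap" unfolding y_def by (intro suc_kap un_kap d x e(1))
    have "z \<epsilon> y" if z: "z \<epsilon> kap" "subset_of z (un (un d x) e)" for z
      using z ord_subset_iff[OF kap_ord[OF z(1)] kap_ord[OF un_kap[OF un_kap[OF d x] e(1)]]]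
      by (simp add: y_def)
    then have "d \<epsilon> y" "x \<epsilon> y" using d x by (auto simp: subset_of_def)
    moreover have "app F j \<epsilon> y" if "j \<epsilon> x" for j using e(2)[OF that] by (simp add: y_def)
    ultimately show ?thesis using r x y by blast
  qed
  from DC[OF emp_kap this] obtain f where f: "\<And>n. n \<epsilon> om \<Longrightarrow> app f n \<epsilon> kap"
    "\<And>n. n \<epsilon> om \<Longrightarrow> pr (app f n) (app f (suc n)) \<epsilon> r" by blast
  define i where "i = Uni (Rep om (app f))"
  have i: "z \<epsilon> i \<longleftrightarrow> (\<exists>n. n \<epsilon> om \<and> z \<epsilon> app f n)" for z
  proof -
    have "y \<epsilon> Rep om (app f) \<longleftrightarrow> (\<exists>n. n \<epsilon> om \<and> y = app f n)" for y
      by (rule Rep_iff) (intro dfns)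
    then show ?thesis unfolding i_def by auto
  qed
  have "ordinal i" unfolding i_def
  proof (rule ord_Uni)
    fix x assume "x \<epsilon> Rep om (app f)"
    moreover have "x \<epsilon> Rep om (app f) \<longleftrightarrow> (\<exists>n. n \<epsilon> om \<and> x = app f n)"
      by (rule Rep_iff) (intro dfns)
    ultimately show "ordinal x" using f kap_ord by auto
  qed
  obtain e where e: "e \<epsilon> kap" "\<And>n. n \<epsilon> om \<Longrightarrow> app f n \<epsilon> e" using kap_bounded[OF om_kap, of f] f(1) by blast
  have "subset_of i e" unfolding subset_of_def i using e ord_trans kap_ord by blast
  then have ik: "i \<epsilon> kap" using kap_sub \<open>ordinal i\<close> e(1) by blast
  have "d \<epsilon> i" unfolding i using f(2)[OF om_emp] r om_suc om_emp by blast
  then have "\<not> i \<epsilon> d" using mem_asym by blast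
  moreover have "\<not> i \<epsilon> app F j" if j: "j \<epsilon> i" for j
  proof -
    obtain n where n: "n \<epsilon> om" "j \<epsilon> app f n" using j i by blast
    then have "app F j \<epsilon> app f (suc n)" using f(2) r by blast
    then have "app F j \<epsilon> i" unfolding i using n om_suc by blast
    then show ?thesis using mem_asym by blast
  qed
  ultimately show False using F ik unfolding avoids_def by blast
qed

end

section \<open>Ranks of functions modulo a normal ideal\<close>

context singular_aleph
begin

text \<open>Taking the supremum over \<open>j < i\<close> makes the map continuous: every element of
  \<open>mm i\<close> lies below \<open>c j\<close> for some \<open>j < i\<close>. This is the
  source of all regressive functions used on codes.\<close>

definition mm :: "'a \<Rightarrow> 'a" where "mm i = Uni (Rep i (app c))"

text \<open>The bound is on the size of \<open>f i\<close>, not on \<open>f i\<close> itself. It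
  provides an injection of \<open>f i\<close> into \<open>mm i\<close>, hence codes below
  \<open>mm i\<close> for the values of any smaller function.\<close>

definition F0 :: 'a where
  "F0 = Sep (pow (prod kap mu)) (\<lambda>f. is_fun f kap mu \<and> (\<forall>i. i \<epsilon> kap \<longrightarrow> app f i \<lesssim> mm i))"

text \<open>Such injections are members of \<open>H\<close>, so they can be chosen uniformly in
  \<open>i\<close> and \<open>v\<close>.\<close>

definition ei :: "'a \<Rightarrow> 'a \<Rightarrow> 'a" where "ei i v = leastH (\<lambda>e. injf e v (mm i))"

definition nl :: "'a \<Rightarrow> 'a \<Rightarrow> 'a" where "nl f g = Sep kap (\<lambda>i. \<not> app f i \<epsilon> app g i)"

definition rel :: "'a \<Rightarrow> 'a" where "rel I = Sep (prod F0 F0) (\<lambda>p. nl (fs p) (sn p) \<epsilon> I)"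

text \<open>The Galvin-Hajnal norm. Being a collapse, it takes all ordinals below each of its
  values.\<close>

definition rk :: "'a \<Rightarrow> 'a \<Rightarrow> 'a" where "rk I f = col F0 (rel I) f"

text \<open>The ideal whose dual filter is generated by \<open>A\<close> and the dual filter of
  \<open>I\<close>.\<close>

definition restr :: "'a \<Rightarrow> 'a \<Rightarrow> 'a" where
  "restr I A = Sep (pow kap) (\<lambda>B. Sep B (\<lambda>i. i \<epsilon> A) \<epsilon> I)"

text \<open>\<open>big I A f v\<close>: modulo \<open>I\<close> restricted to \<open>A\<close>, the function \<open>f\<close> has rank at least \<open>v\<close>; the rank
  modulo the improper ideal counts as infinite.\<close>

definition big :: "'a \<Rightarrow> 'a \<Rightarrow> 'a \<Rightarrow> 'a \<Rightarrow> bool" where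
  "big I A f v \<longleftrightarrow> A \<epsilon> I \<or> subset_of v (rk (restr I A) f)"

definition JJ :: "'a \<Rightarrow> 'a \<Rightarrow> 'a" where
  "JJ I f = Sep (pow kap) (\<lambda>A. big I A f (suc (rk I f)))"

text \<open>A function \<open>g\<close> below \<open>f\<close> is coded by \<open>h i = ei i (f i) (g i)\<close>, a value below \<open>mm i\<close>;
  \<open>Dec f h\<close> decodes \<open>h\<close>, with value \<open>0\<close> where \<open>h i\<close> is not a code.\<close>

definition Dec :: "'a \<Rightarrow> 'a \<Rightarrow> 'a" where
  "Dec f h = lam kap (\<lambda>i. if \<exists>x. x \<epsilon> app f i \<and> app (ei i (app f i)) x = app h i
     then the1 (\<lambda>x. x \<epsilon> app f i \<and> app (ei i (app f i)) x = app h i) else emp)"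

definition ip :: "'a \<Rightarrow> bool" where "ip I \<longleftrightarrow> normal I \<and> \<not> kap \<epsilon> I"

lemma dft_mm [dfns]: "dft t \<Longrightarrow> dft (\<lambda>s. mm (t s))"
  by (rule tsubst1[where F = mm], unfold mm_def, intro dfns)

lemma dft_ei [dfns]: "dft t \<Longrightarrow> dft u \<Longrightarrow> dft (\<lambda>s. ei (t s) (u s))"
  by (rule tsubst2[where F = ei], unfold ei_def, intro dfns)

lemma dft_nl [dfns]: "dft t \<Longrightarrow> dft u \<Longrightarrow> dft (\<lambda>s. nl (t s) (u s))"
  by (rule tsubst2[where F = nl], unfold nl_def, intro dfns)

lemma dft_rel [dfns]: "dft t \<Longrightarrow> dft (\<lambda>s. rel (t s))"
  by (rule tsubst1[where F = rel], unfold rel_def, intro dfns)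

lemma dft_rk [dfns]: "dft t \<Longrightarrow> dft u \<Longrightarrow> dft (\<lambda>s. rk (t s) (u s))"
  by (rule tsubst2[where F = rk], unfold rk_def, intro dfns)

lemma dft_restr [dfns]: "dft t \<Longrightarrow> dft u \<Longrightarrow> dft (\<lambda>s. restr (t s) (u s))"
  by (rule tsubst2[where F = restr], unfold restr_def, intro dfns)

lemma dfn_big [dfns]: "dft t \<Longrightarrow> dft u \<Longrightarrow> dft v \<Longrightarrow> dft w \<Longrightarrow> dfn (\<lambda>s. big (t s) (u s) (v s) (w s))"
  by (rule subst4[where P = big], unfold big_def, intro dfns)

lemma dft_JJ [dfns]: "dft t \<Longrightarrow> dft u \<Longrightarrow> dft (\<lambda>s. JJ (t s) (u s))"
  by (rule tsubst2[where F = JJ], unfold JJ_def, intro dfns)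

lemma dft_Dec [dfns]: "dft t \<Longrightarrow> dft u \<Longrightarrow> dft (\<lambda>s. Dec (t s) (u s))"
  by (rule tsubst2[where F = Dec], unfold Dec_def, intro dfns)

lemma dfn_ip [dfns]: "dft t \<Longrightarrow> dfn (\<lambda>s. ip (t s))"
  by (rule subst1[where P = ip], unfold ip_def, intro dfns)

lemma mm_iff: "x \<epsilon> mm i \<longleftrightarrow> (\<exists>j. j \<epsilon> i \<and> x \<epsilon> app c j)"
proof -
  have "y \<epsilon> Rep i (app c) \<longleftrightarrow> (\<exists>j. j \<epsilon> i \<and> y = app c j)" for y
    by (rule Rep_iff) (intro dfns)
  then show ?thesis unfolding mm_def by auto
qed

lemma mm_mu: assumes i: "i \<epsilon> kap" shows "mm i \<epsilon> mu"
proof -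
  have o: "ordinal (app c j)" if "j \<epsilon> kap" for j using c_mu that ord_mu ord_elem by blast
  have "y \<epsilon> Rep i (app c) \<longleftrightarrow> (\<exists>j. j \<epsilon> i \<and> y = app c j)" for y
    by (rule Rep_iff) (intro dfns)
  then have "ordinal (mm i)" unfolding mm_def using o kap_trans i by (intro ord_Uni) auto
  moreover have "subset_of (mm i) (app c i)"
    unfolding subset_of_def mm_iff using c_less[OF _ i] ord_trans[OF o[OF i]] by blast
  ultimately show ?thesis using ord_sub_mem ord_mu c_mu i by blast
qed

lemma F0_iff: "f \<epsilon> F0 \<longleftrightarrow> is_fun f kap mu \<and> (\<forall>i. i \<epsilon> kap \<longrightarrow> app f i \<lesssim> mm i)"
proof -
  have "f \<epsilon> F0 \<longleftrightarrow> f \<epsilon> pow (prod kap mu) \<and> is_fun f kap mu \<and> (\<forall>i. i \<epsilon> kap \<longrightarrow> app f i \<lesssim> mm i)"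
    unfolding F0_def by (rule Sep_iff) (intro dfns)
  moreover have "f \<epsilon> pow (prod kap mu)" if "is_fun f kap mu"
    using that unfolding is_fun_def is_pair_iff pow_iff subset_of_def prod_iff by blast
  ultimately show ?thesis by blast
qed

lemma F0_app: "f \<epsilon> F0 \<Longrightarrow> i \<epsilon> kap \<Longrightarrow> app f i \<epsilon> mu" "f \<epsilon> F0 \<Longrightarrow> i \<epsilon> kap \<Longrightarrow> app f i \<lesssim> mm i"
  using F0_iff is_fun_app by auto

lemma F0_ord: "f \<epsilon> F0 \<Longrightarrow> i \<epsilon> kap \<Longrightarrow> ordinal (app f i)"
  using F0_app ord_mu ord_elem by blast

lemma F0_lam:
  assumes "dft (\<lambda>s. F (s 0))" "\<And>i. i \<epsilon> kap \<Longrightarrow> F i \<epsilon> mu" "\<And>i. i \<epsilon> kap \<Longrightarrow> F i \<lesssim> mm i"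
  shows "lam kap F \<epsilon> F0" "\<And>i. i \<epsilon> kap \<Longrightarrow> app (lam kap F) i = F i"
proof -
  show *: "\<And>i. i \<epsilon> kap \<Longrightarrow> app (lam kap F) i = F i" by (rule app_lam[OF assms(1)])
  show "lam kap F \<epsilon> F0" unfolding F0_iff
    using lam_is_fun[OF assms(1,2)] assms(3) * by simp
qed

lemma ei: assumes "i \<epsilon> kap" "v \<epsilon> mu" "v \<lesssim> mm i" shows "injf (ei i v) v (mm i)"
proof -
  obtain e where e: "injf e v (mm i)" using assms(3) unfolding lep_def by blast
  have d: "dft (\<lambda>s. app e (s 0))" by (intro dfns)
  have "lam v (app e) \<epsilon> H"
    by (rule H_prod[OF _ assms(2) mm_mu[OF assms(1)]])
      (auto simp: subset_of_def lam_iff[OF d] injf_mem[OF e])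
  moreover have "injf (lam v (app e)) v (mm i)"
    unfolding injf_def by (auto simp: app_lam[OF d] injf_mem[OF e] injf_eq[OF e])
  moreover have "dfn (\<lambda>s. injf (s 0) v (mm i))" by (intro dfns)
  ultimately show ?thesis unfolding ei_def using leastH(2)[where P = "\<lambda>e. injf e v (mm i)"] by blast
qed

lemma ei_F0:
  assumes "f \<epsilon> F0" "i \<epsilon> kap"
  shows "x \<epsilon> app f i \<Longrightarrow> app (ei i (app f i)) x \<epsilon> mm i"
    "x \<epsilon> app f i \<Longrightarrow> y \<epsilon> app f i \<Longrightarrow> app (ei i (app f i)) x = app (ei i (app f i)) y \<longleftrightarrow> x = y"
  using injf_mem[OF ei] injf_eq[OF ei] F0_app[OF assms] assms(2) by blast+

lemma nl_iff: "i \<epsilon> nl f g \<longleftrightarrow> i \<epsilon> kap \<and> \<not> app f i \<epsilon> app g i"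
  unfolding nl_def by (rule Sep_iff) (intro dfns)

lemma rel_iff: "pr f g \<epsilon> rel I \<longleftrightarrow> f \<epsilon> F0 \<and> g \<epsilon> F0 \<and> nl f g \<epsilon> I"
proof -
  have "pr f g \<epsilon> rel I \<longleftrightarrow> pr f g \<epsilon> prod F0 F0 \<and> nl (fs (pr f g)) (sn (pr f g)) \<epsilon> I"
    unfolding rel_def by (rule Sep_iff) (intro dfns)
  then show ?thesis by simp
qed

lemma rel_tr: assumes "normal I" shows "trr F0 (rel I)"
  unfolding trr_def rel_iff
proof (intro allI impI, elim conjE, intro conjI)
  fix f g h assume *: "f \<epsilon> F0" "g \<epsilon> F0" "h \<epsilon> F0" "nl f g \<epsilon> I" "nl g h \<epsilon> I"
  have "subset_of (nl f h) (un (nl f g) (nl g h))"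
    unfolding subset_of_def un_iff nl_iff using ord_trans F0_ord[OF *(3)] by blast
  then show "nl f h \<epsilon> I" using normalD(3)[OF assms] normal_un[OF assms *(4,5)] by blast
qed

text \<open>Along a descending sequence the exceptional sets are countably many, so their union is
  in \<open>I\<close> and misses some \<open>i\<close> in \<open>kap\<close>; there the values form
  a descending sequence of ordinals.\<close>

lemma rel_wf: assumes "ip I" shows "wfr F0 (rel I)"
proof (rule wfr_DC)
  fix f assume f: "\<And>n. n \<epsilon> om \<Longrightarrow> app f n \<epsilon> F0" "\<And>n. n \<epsilon> om \<Longrightarrow> pr (app f (suc n)) (app f n) \<epsilon> rel I"
  have I: "normal I" "\<not> kap \<epsilon> I" using assms by (auto simp: ip_def)
  have "kap \<epsilon> I" if *: "\<And>i. i \<epsilon> kap \<Longrightarrow> \<exists>n. n \<epsilon> om \<and> i \<epsilon> nl (app f (suc n)) (app f n)"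
    by (rule normal_countable[of I "\<lambda>n. nl (app f (suc n)) (app f n)"])
      (rule I, intro dfns, use f rel_iff * in auto)
  then obtain i where i: "i \<epsilon> kap" "\<And>n. n \<epsilon> om \<Longrightarrow> app (app f (suc n)) i \<epsilon> app (app f n) i"
    using I nl_iff by blast
  have R: "y \<epsilon> Rep om (\<lambda>n. app (app f n) i) \<longleftrightarrow> (\<exists>n. n \<epsilon> om \<and> y = app (app f n) i)" for y
    by (rule Rep_iff) (intro dfns)
  have "\<not> is_empty (Rep om (\<lambda>n. app (app f n) i))" unfolding is_empty_def R using om_emp by blast
  from foundation[OF this] obtain n where "n \<epsilon> om" "\<And>z. z \<epsilon> Rep om (\<lambda>n. app (app f n) i) \<Longrightarrow> \<not> z \<epsilon> app (app f n) i"
    unfolding R by blast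
  then show False using i(2) R om_suc by blast
qed

lemma rk_iff: "ip I \<Longrightarrow> f \<epsilon> F0 \<Longrightarrow> z \<epsilon> rk I f \<longleftrightarrow> (\<exists>g. g \<epsilon> F0 \<and> nl g f \<epsilon> I \<and> z = rk I g)"
  unfolding rk_def using col_mem[OF rel_wf rel_tr] rel_iff ip_def by simp

lemma rk_ord: "ip I \<Longrightarrow> f \<epsilon> F0 \<Longrightarrow> ordinal (rk I f)"
  unfolding rk_def using col_ord[OF rel_wf rel_tr] ip_def by simp

lemma rk_less: "ip I \<Longrightarrow> f \<epsilon> F0 \<Longrightarrow> g \<epsilon> F0 \<Longrightarrow> nl g f \<epsilon> I \<Longrightarrow> rk I g \<epsilon> rk I f"
  using rk_iff by blast

lemma rk_le:
  assumes I: "ip I" and f: "f \<epsilon> F0" and g: "g \<epsilon> F0"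
    and N: "N \<epsilon> I" "\<And>i. i \<epsilon> kap \<Longrightarrow> \<not> i \<epsilon> N \<Longrightarrow> subset_of (app f i) (app g i)"
  shows "subset_of (rk I f) (rk I g)"
  unfolding subset_of_def
proof (intro allI impI)
  fix z assume "z \<epsilon> rk I f"
  then obtain h where h: "h \<epsilon> F0" "nl h f \<epsilon> I" "z = rk I h" using rk_iff[OF I f] by auto
  have n: "normal I" using I by (simp add: ip_def)
  have "subset_of (nl h g) (un (nl h f) N)"
    unfolding subset_of_def[of _ "un (nl h f) N"] un_iff nl_iff using N(2) subset_ofD by blast
  then have "nl h g \<epsilon> I" using normalD(3)[OF n] normal_un[OF n h(2) N(1)] by blast
  then show "z \<epsilon> rk I g" using rk_less[OF I g h(1)] h(3) by simp
qed

text \<open>Passing to the larger ideal keeps every function that was below \<open>f\<close>, and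
  the induction runs along the relation of the smaller ideal.\<close>

lemma rk_mono:
  assumes I: "ip I" and I': "ip I'" and s: "subset_of I I'" and f: "f \<epsilon> F0"
  shows "subset_of (rk I f) (rk I' f)"
  using rel_wf[OF I] _ f
proof (rule wfr_induct[where P = "\<lambda>f. subset_of (rk I f) (rk I' f)"])
  show "dfn (\<lambda>s. subset_of (rk I (s 0)) (rk I' (s 0)))" by (intro dfns)
  fix f assume f: "f \<epsilon> F0" and IH: "\<And>g. g \<epsilon> F0 \<Longrightarrow> pr g f \<epsilon> rel I \<Longrightarrow> subset_of (rk I g) (rk I' g)"
  show "subset_of (rk I f) (rk I' f)"
    unfolding subset_of_def
  proof (intro allI impI)
    fix z assume "z \<epsilon> rk I f"
    then obtain g where g: "g \<epsilon> F0" "nl g f \<epsilon> I" "z = rk I g" using rk_iff[OF I f] by auto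
    then have "subset_of z (rk I' g)" using IH f rel_iff by blast
    moreover have "rk I' g \<epsilon> rk I' f" using rk_less[OF I' f g(1)] g(2) s subset_ofD by blast
    ultimately show "z \<epsilon> rk I' f" using ord_sub_mem rk_ord[OF I' f] rk_ord[OF I g(1)] g(3) by blast
  qed
qed

section \<open>Restricting an ideal to a positive set\<close>

definition int :: "'a \<Rightarrow> 'a \<Rightarrow> 'a" where "int B A = Sep B (\<lambda>i. i \<epsilon> A)"

lemma int_iff [simp]: "i \<epsilon> int B A \<longleftrightarrow> i \<epsilon> B \<and> i \<epsilon> A"
  unfolding int_def by (rule Sep_iff) (intro dfns)

lemma restr_iff: "B \<epsilon> restr I A \<longleftrightarrow> subset_of B kap \<and> int B A \<epsilon> I"
proof -
  have "B \<epsilon> restr I A \<longleftrightarrow> B \<epsilon> pow kap \<and> Sep B (\<lambda>i. i \<epsilon> A) \<epsilon> I"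
    unfolding restr_def by (rule Sep_iff) (intro dfns)
  then show ?thesis by (simp add: int_def)
qed

lemma restr_ip:
  assumes n: "normal I" and A: "subset_of A kap" "\<not> A \<epsilon> I" shows "ip (restr I A)"
  unfolding ip_def
proof
  have i: "subset_of (int B A) B" for B by (simp add: subset_of_def)
  have "int kap A = A" using A(1) by (intro ext) (auto simp: subset_of_def)
  then show "\<not> kap \<epsilon> restr I A" using A by (simp add: restr_iff)
  show "normal (restr I A)"
    unfolding normal_def
  proof (intro conjI allI impI)
    show "subset_of (restr I A) (pow kap)" by (simp add: subset_of_def[of "restr I A"] restr_iff)
    show "subset_of kap (restr I A)"
      unfolding subset_of_def[of _ "restr I A"] restr_iff
      using normalD(2,3)[OF n] i ord_mem_subset ord_kap by blast
    fix B C assume "B \<epsilon> restr I A \<and> subset_of C B"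
    moreover from this have "subset_of (int C A) (int B A)" by (simp add: subset_of_def)
    ultimately show "C \<epsilon> restr I A" unfolding restr_iff using normalD(3)[OF n] subset_of_trans by blast
  next
    fix B p assume B: "subset_of B kap \<and> regressive p B \<and> (\<forall>j. j \<epsilon> kap \<longrightarrow> fib B p j \<epsilon> restr I A)"
    have "int B A \<epsilon> I"
    proof (rule normalD(4)[OF n])
      show "subset_of (int B A) kap" using B i subset_of_trans by blast
      show "regressive p (int B A)" using B unfolding regressive_def by auto
      fix j assume "j \<epsilon> kap"
      moreover have "fib (int B A) p j = int (fib B p j) A" by (rule ext) auto
      ultimately show "fib (int B A) p j \<epsilon> I" using B by (auto simp: restr_iff)
    qed
    then show "B \<epsilon> restr I A" using B by (simp add: restr_iff)
  qed
qed

lemma restr_sub: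
  assumes n: "normal I" and "subset_of B A" shows "subset_of (restr I A) (restr I B)"
  unfolding subset_of_def
proof (intro allI impI)
  fix C assume "C \<epsilon> restr I A"
  moreover have "subset_of (int C B) (int C A)" using assms(2) by (simp add: subset_of_def)
  ultimately show "C \<epsilon> restr I B" unfolding restr_iff using normalD(3)[OF n] by blast
qed

lemma restr_super: assumes n: "normal I" shows "subset_of I (restr I A)"
  unfolding subset_of_def
proof (intro allI impI)
  fix C assume "C \<epsilon> I"
  moreover have "subset_of (int C A) C" by (simp add: subset_of_def)
  ultimately show "C \<epsilon> restr I A" unfolding restr_iff using normalD(1,3)[OF n] by blast
qed

lemma restr_kap: assumes n: "normal I" shows "restr I kap = I"
proof (rule ext)
  fix C
  have "int C kap = C" if "subset_of C kap" using that by (intro ext) (auto simp: subset_of_def)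
  then show "C \<epsilon> restr I kap \<longleftrightarrow> C \<epsilon> I" unfolding restr_iff using normalD(1)[OF n] by metis
qed

lemma restr_rk:
  assumes I: "ip I" and A: "subset_of A kap" "\<not> A \<epsilon> I" and f: "f \<epsilon> F0"
  shows "subset_of (rk I f) (rk (restr I A) f)"
  using rk_mono[OF I restr_ip restr_super] I A f ip_def by blast

lemma big_mono:
  assumes n: "normal I" and big: "big I A f v" and A: "subset_of A kap" "subset_of B A" and f: "f \<epsilon> F0"
  shows "big I B f v"
proof (cases "B \<epsilon> I")
  case B: False
  then have A': "\<not> A \<epsilon> I" using normalD(3)[OF n] A(2) by blast
  have "subset_of B kap" using A subset_of_trans by blast
  then have "subset_of (rk (restr I A) f) (rk (restr I B) f)"
    using rk_mono[OF restr_ip[OF n A(1) A'] restr_ip[OF n _ B] restr_sub[OF n A(2)] f] by blast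
  then show ?thesis using big A' subset_of_trans unfolding big_def by blast
qed (simp add: big_def)

lemma big_le:
  assumes n: "normal I" and big: "big I A f v" and A: "subset_of A kap" and fg: "f \<epsilon> F0" "g \<epsilon> F0"
    and N: "N \<epsilon> I" "\<And>i. i \<epsilon> A \<Longrightarrow> \<not> i \<epsilon> N \<Longrightarrow> subset_of (app f i) (app g i)"
  shows "big I A g v"
proof (cases "A \<epsilon> I")
  case A': False
  \<comment> \<open>The hypothesis compares \<open>f\<close> and \<open>g\<close> on
    \<open>A\<close> only; the complement of \<open>A\<close> is null for the restricted ideal and
    joins the exceptional set.\<close>
  define M where "M = Sep kap (\<lambda>i. i \<epsilon> N \<or> \<not> i \<epsilon> A)"
  have M: "i \<epsilon> M \<longleftrightarrow> i \<epsilon> kap \<and> (i \<epsilon> N \<or> \<not> i \<epsilon> A)" for i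
    unfolding M_def by (rule Sep_iff) (intro dfns)
  have "subset_of (int M A) N" unfolding subset_of_def int_iff M by blast
  then have "M \<epsilon> restr I A" unfolding restr_iff using normalD(3)[OF n] N(1) by (auto simp: subset_of_def M)
  moreover have "subset_of (app f i) (app g i)" if "i \<epsilon> kap" "\<not> i \<epsilon> M" for i
    using N(2) that M by blast
  ultimately have "subset_of (rk (restr I A) f) (rk (restr I A) g)"
    by (intro rk_le[OF restr_ip[OF n A A'] fg, of M])
  then show ?thesis using big A' subset_of_trans unfolding big_def by blast
qed (simp add: big_def)

lemma Dec_F0:
  assumes f: "f \<epsilon> F0"
  shows "Dec f h \<epsilon> F0" 
    and "\<And>i x. i \<epsilon> kap \<Longrightarrow> x \<epsilon> app f i \<Longrightarrow> app (ei i (app f i)) x = app h i \<Longrightarrow> app (Dec f h) i = x"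
proof -
  define D where "D i = (if \<exists>x. x \<epsilon> app f i \<and> app (ei i (app f i)) x = app h i
     then the1 (\<lambda>x. x \<epsilon> app f i \<and> app (ei i (app f i)) x = app h i) else emp)" for i
  have dD: "dft (\<lambda>s. D (s 0))" unfolding D_def by (intro dfns)
  have 1: "D i = x" if x: "i \<epsilon> kap" "x \<epsilon> app f i" "app (ei i (app f i)) x = app h i" for i x
  proof -
    have "the1 (\<lambda>x. x \<epsilon> app f i \<and> app (ei i (app f i)) x = app h i) = x"
      by (rule the1_equality) (use x ei_F0(2)[OF f x(1)] in \<open>simp, metis\<close>)
    then show ?thesis unfolding D_def using x by auto
  qed
  have 2: "D i = emp \<or> D i \<epsilon> app f i" if "i \<epsilon> kap" for i
  proof (cases "\<exists>x. x \<epsilon> app f i \<and> app (ei i (app f i)) x = app h i")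
    case True
    then show ?thesis using 1[OF that] by blast
  next
    case False
    show ?thesis unfolding D_def if_not_P[OF False] by simp
  qed
  have 3: "D i \<epsilon> mu" if i: "i \<epsilon> kap" for i
  proof -
    have "emp \<epsilon> mu" using ord_trans[OF ord_mu om_emp om_mu] .
    then show ?thesis using 2[OF i] ord_trans[OF ord_mu _ F0_app(1)[OF f i]] by metis
  qed
  have 4: "D i \<lesssim> mm i" if i: "i \<epsilon> kap" for i
  proof -
    have "subset_of emp (app f i)" by (simp add: subset_of_def)
    then have "subset_of (D i) (app f i)"
      using 2[OF i] ord_mem_subset[OF F0_ord[OF f i]] by metis
    then show ?thesis using subset_lep lep_trans F0_app(2)[OF f i] by blast
  qed
  have e: "Dec f h = lam kap D" unfolding Dec_def D_def ..
  note L = F0_lam[of D, OF dD 3 4]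
  show "Dec f h \<epsilon> F0" unfolding e using L(1) by blast
  show "\<And>i x. i \<epsilon> kap \<Longrightarrow> x \<epsilon> app f i \<Longrightarrow> app (ei i (app f i)) x = app h i \<Longrightarrow> app (Dec f h) i = x"
    unfolding e using L(2) 1 by simp
qed

text \<open>The key step. Given \<open>f\<close>, functions below \<open>f\<close> can be chosen for \<open>kap\<close> many pieces at once although
  there is no choice for subsets of \<open>F0\<close>: by normality each piece splits into \<open>kap\<close> many smaller ones
  on which the function, seen through the injections \<open>ei\<close>, is bounded below \<open>mu\<close>, hence is coded by
  an element of the well-ordered set \<open>H\<close>.\<close>

definition ok :: "'a \<Rightarrow> 'a \<Rightarrow> 'a \<Rightarrow> 'a \<Rightarrow> 'a \<Rightarrow> bool" where
  "ok I f v X h \<longleftrightarrow> int (nl (Dec f h) f) X \<epsilon> I \<and> big I X (Dec f h) v"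

definition split :: "'a \<Rightarrow> 'a \<Rightarrow> 'a \<Rightarrow> 'a \<Rightarrow> 'a \<Rightarrow> bool" where
  "split I f v A q \<longleftrightarrow> regressive q A \<and> (\<forall>k. k \<epsilon> kap \<longrightarrow> (\<exists>h. h \<epsilon> H \<and> ok I f v (fib A q k) h))"

lemma dft_int [dfns]: "dft t \<Longrightarrow> dft u \<Longrightarrow> dft (\<lambda>s. int (t s) (u s))"
  by (rule tsubst2[where F = int], unfold int_def, intro dfns)

lemma dfn_ok [dfns]: "dft t \<Longrightarrow> dft u \<Longrightarrow> dft v \<Longrightarrow> dft w \<Longrightarrow> dfn (\<lambda>s. ok I (t s) (u s) (v s) (w s))"
  by (rule subst4[where P = "ok I"], unfold ok_def, intro dfns)

lemma dfn_split [dfns]: "dft t \<Longrightarrow> dft u \<Longrightarrow> dft v \<Longrightarrow> dft w \<Longrightarrow> dfn (\<lambda>s. split I (t s) (u s) (v s) (w s))"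
  by (rule subst4[where P = "split I"], unfold split_def, intro dfns)

lemma regressive_pos:
  assumes "\<And>i. i \<epsilon> A \<Longrightarrow> i \<epsilon> kap \<and> (app q i = emp \<or> app q i \<epsilon> i)"
  shows "regressive q A"
proof (rule regressiveI)
  show "suc emp \<epsilon> kap" using emp_kap suc_kap by blast
  fix i assume i: "i \<epsilon> A" "\<not> i \<epsilon> suc emp"
  then have "emp \<epsilon> i" using ord_emp_mem[of i] kap_ord assms by auto
  then show "app q i \<epsilon> i" using assms[OF i(1)] by auto
qed

lemma emp_H: "emp \<epsilon> H"
  by (rule H_subset[OF _ om_mu]) (simp add: subset_of_def)

text \<open>Pressing down: the code of \<open>g i\<close> lies below \<open>mm i\<close>, hence
  below \<open>c k\<close> for some \<open>k < i\<close>, and the least such \<open>k\<close> is a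
  regressive function of \<open>i\<close>. On each of its fibres the codes form a map into the fixed
  ordinal \<open>c k < mu\<close>, which is a member of \<open>H\<close>.\<close>

lemma codes:
  assumes f: "f \<epsilon> F0" and g: "g \<epsilon> F0" and A: "subset_of A kap"
  obtains q where "q \<epsilon> H" "regressive q A"
    "\<And>k. k \<epsilon> kap \<Longrightarrow> \<exists>h. h \<epsilon> H \<and> (\<forall>i. i \<epsilon> fib A q k \<and> app g i \<epsilon> app f i \<longrightarrow>
        app h i = app (ei i (app f i)) (app g i) \<and> app (Dec f h) i = app g i)"
proof -
  define cd where "cd i = app (ei i (app f i)) (app g i)" for i
  have [dfns]: "dft (\<lambda>s. cd (t s))" if "dft t" for t
    using _ that by (rule tsubst1[where F = cd]) (unfold cd_def, intro dfns)
  \<comment> \<open>The value 0 serves where \<open>g i\<close> is not below \<open>f i\<close>,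
    since no code exists there; it is regressive except at 0.\<close>
  define p where "p i = (if app g i \<epsilon> app f i then leastO (\<lambda>k. k \<epsilon> i \<and> cd i \<epsilon> app c k) else emp)" for i
  have [dfns]: "dft (\<lambda>s. p (t s))" if "dft t" for t
    using _ that by (rule tsubst1[where F = p]) (unfold p_def, intro dfns)
  have p: "p i \<epsilon> i" "cd i \<epsilon> app c (p i)" if i: "i \<epsilon> kap" "app g i \<epsilon> app f i" for i
  proof -
    have "cd i \<epsilon> mm i" unfolding cd_def using ei_F0(1)[OF f i] .
    then obtain k where k: "k \<epsilon> i" "cd i \<epsilon> app c k" unfolding mm_iff by blast
    have "ordinal k" using k(1) i(1) kap_ord kap_trans by blast
    moreover have "dfn (\<lambda>s. s 0 \<epsilon> i \<and> cd i \<epsilon> app c (s 0))" by (intro dfns)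
    ultimately show "p i \<epsilon> i" "cd i \<epsilon> app c (p i)"
      using leastO(2)[where P = "\<lambda>k. k \<epsilon> i \<and> cd i \<epsilon> app c k", of k] k i(2) by (auto simp: p_def)
  qed
  have pk: "p i \<epsilon> kap" if "i \<epsilon> kap" for i
    using p[OF that] kap_trans that emp_kap by (cases "app g i \<epsilon> app f i") (auto simp: p_def)
  define q where "q = lam kap p"
  have dp: "dft (\<lambda>s. p (s 0))" by (intro dfns)
  have q: "app q i = p i" if "i \<epsilon> kap" for i unfolding q_def by (rule app_lam[OF dp that])
  show ?thesis
  proof (rule that[of q])
    show "q \<epsilon> H" by (rule H_prod[OF _ kap_mu kap_mu]) (auto simp: subset_of_def q_def lam_iff[OF dp] pk)
    show "regressive q A"
    proof (rule regressive_pos)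
      fix i assume "i \<epsilon> A"
      then have i: "i \<epsilon> kap" using A subset_ofD by blast
      show "i \<epsilon> kap \<and> (app q i = emp \<or> app q i \<epsilon> i)"
        using i p(1)[OF i] q[OF i] by (cases "app g i \<epsilon> app f i") (auto simp: p_def)
    qed
    fix k assume k: "k \<epsilon> kap"
    \<comment> \<open>The part of the fibre on which codes exist; outside it the decoded function
      may differ from \<open>g\<close>.\<close>
    define X where "X = Sep (fib A q k) (\<lambda>i. app g i \<epsilon> app f i)"
    have X: "i \<epsilon> X \<longleftrightarrow> i \<epsilon> fib A q k \<and> app g i \<epsilon> app f i" for i
      unfolding X_def by (rule Sep_iff) (intro dfns)
    have Xk: "i \<epsilon> kap" "cd i \<epsilon> app c k" if "i \<epsilon> X" for i
    proof -
      show i: "i \<epsilon> kap" using that A subset_ofD X by fastforce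
      show "cd i \<epsilon> app c k" using p(2)[OF i] q[OF i] that X by auto
    qed
    have dc: "dft (\<lambda>s. cd (s 0))" by (intro dfns)
    have h: "app (lam X cd) i = cd i" if "i \<epsilon> X" for i by (rule app_lam[OF dc that])
    have "lam X cd \<epsilon> H"
      by (rule H_prod[OF _ kap_mu c_mu[OF k]]) (auto simp: subset_of_def lam_iff[OF dc] Xk)
    moreover have "app (Dec f (lam X cd)) i = app g i" if "i \<epsilon> X" for i
      by (rule Dec_F0(2)[OF f Xk(1)[OF that]]) (use that X h cd_def in auto)
    ultimately show "\<exists>h. h \<epsilon> H \<and> (\<forall>i. i \<epsilon> fib A q k \<and> app g i \<epsilon> app f i \<longrightarrow>
        app h i = app (ei i (app f i)) (app g i) \<and> app (Dec f h) i = app g i)"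
      using h unfolding X cd_def by blast
  qed
qed

text \<open>If \<open>A\<close> is not null, some \<open>g\<close> below \<open>f\<close> modulo the
  restricted ideal has rank exactly \<open>v\<close>, and \<open>codes\<close> cuts it into pieces
  that are recovered from members of \<open>H\<close>. The function \<open>g\<close> itself is not
  selected; only the splitting and the codes are.\<close>

lemma split_ex:
  assumes I: "ip I" and f: "f \<epsilon> F0" and A: "subset_of A kap"
    and big: "A \<epsilon> I \<or> v \<epsilon> rk (restr I A) f"
  shows "\<exists>q. q \<epsilon> H \<and> split I f v A q"
proof (cases "A \<epsilon> I")
  case True
  have n: "normal I" using I by (simp add: ip_def)
  \<comment> \<open>On a null set every code is acceptable; the pair \<open>f\<close>,
    \<open>f\<close> serves only to obtain some regressive \<open>q\<close> in
    \<open>H\<close>.\<close>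
  obtain q where q: "q \<epsilon> H" "regressive q A" by (rule codes[OF f f A]) blast
  have "ok I f v (fib A q k) emp" for k
  proof -
    have "subset_of (fib A q k) A" "subset_of (int (nl (Dec f emp) f) (fib A q k)) A"
      by (auto simp: subset_of_def)
    then show ?thesis unfolding ok_def big_def using normalD(3)[OF n True] by blast
  qed
  then show ?thesis unfolding split_def using q emp_H by blast
next
  case False
  have n: "normal I" using I by (simp add: ip_def)
  note IA = restr_ip[OF n A False]
  obtain g where g: "g \<epsilon> F0" "nl g f \<epsilon> restr I A" "v = rk (restr I A) g"
    using big False rk_iff[OF IA f] by blast
  have Z: "int (nl g f) A \<epsilon> I" using g(2) by (simp add: restr_iff)
  have bg: "big I A g v" using g(3) by (simp add: big_def)
  obtain q where q: "q \<epsilon> H" "regressive q A"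
    "\<And>k. k \<epsilon> kap \<Longrightarrow> \<exists>h. h \<epsilon> H \<and> (\<forall>i. i \<epsilon> fib A q k \<and> app g i \<epsilon> app f i \<longrightarrow>
        app h i = app (ei i (app f i)) (app g i) \<and> app (Dec f h) i = app g i)"
    by (rule codes[OF f g(1) A]) blast
  have "\<exists>h. h \<epsilon> H \<and> ok I f v (fib A q k) h" if k: "k \<epsilon> kap" for k
  proof -
    obtain h where h: "h \<epsilon> H" "\<And>i. i \<epsilon> fib A q k \<Longrightarrow> app g i \<epsilon> app f i \<Longrightarrow> app (Dec f h) i = app g i"
      using q(3)[OF k] by blast
    have s: "subset_of (fib A q k) A" by (simp add: subset_of_def)
    have "subset_of (int (nl (Dec f h) f) (fib A q k)) (int (nl g f) A)"
      using h(2) by (auto simp: subset_of_def nl_iff)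
    then have 1: "int (nl (Dec f h) f) (fib A q k) \<epsilon> I" using normalD(3)[OF n Z] by blast
    have "big I (fib A q k) g v" using big_mono[OF n bg A s g(1)] .
    then have "big I (fib A q k) (Dec f h) v"
    proof (rule big_le[OF n _ _ g(1) Dec_F0(1)[OF f] Z])
      show "subset_of (fib A q k) kap" using s A subset_of_trans by blast
      fix i assume "i \<epsilon> fib A q k" "\<not> i \<epsilon> int (nl g f) A"
      then show "subset_of (app g i) (app (Dec f h) i)"
        using h(2)[of i] A subset_ofD by (fastforce simp: nl_iff)
    qed
    with 1 h(1) show ?thesis unfolding ok_def by blast
  qed
  then show ?thesis unfolding split_def using q(1,2) by blast
qed

text \<open>For \<open>w < v\<close> each piece carries functions of rank at least \<open>w\<close>
  below \<open>f\<close>. Codes for them are chosen in \<open>H\<close> and glued to one function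
  \<open>G\<close>. By normality, along \<open>p\<close> and along the finer splittings,
  \<open>G\<close> is below \<open>f\<close> modulo \<open>I\<close> restricted to \<open>A\<close>,
  and by induction \<open>G\<close> has rank at least \<open>w\<close> there. Hence the rank of
  \<open>f\<close> exceeds every such \<open>w\<close>.\<close>

theorem big_normal:
  assumes I: "ip I" and v: "ordinal v"
  shows "\<forall>A p f. subset_of A kap \<and> regressive p A \<and> f \<epsilon> F0 \<and>
    (\<forall>j. j \<epsilon> kap \<longrightarrow> big I (fib A p j) f v) \<longrightarrow> big I A f v"
  using v
proof (induction v rule: ord_induct)
  case dfn
  show ?case by (intro dfns)
next
  case (step v)
  have n: "normal I" using I by (simp add: ip_def)
  show ?case
  proof (intro allI impI, elim conjE)
    fix A p f assume A: "subset_of A kap" and p: "regressive p A" and f: "f \<epsilon> F0"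
      and B: "\<forall>j. j \<epsilon> kap \<longrightarrow> big I (fib A p j) f v"
    show "big I A f v"
    proof (cases "A \<epsilon> I")
      case AI: False
      note IA = restr_ip[OF n A AI]
      have "w \<epsilon> rk (restr I A) f" if w: "w \<epsilon> v" for w
      proof -
        have sA: "subset_of (fib A p j) kap" for j using A by (simp add: subset_of_def)
        define qc where "qc j = leastH (\<lambda>q. split I f w (fib A p j) q)" for j
        define hc where "hc j k = leastH (\<lambda>h. ok I f w (fib (fib A p j) (qc j) k) h)" for j k
        have [dfns]: "dft (\<lambda>s. qc (t s))" if "dft t" for t
          using _ that by (rule tsubst1[where F = qc]) (unfold qc_def, intro dfns)
        have [dfns]: "dft (\<lambda>s. hc (t s) (u s))" if "dft t" "dft u" for t u
          using _ that by (rule tsubst2[where F = hc]) (unfold hc_def, intro dfns)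
        have qc: "split I f w (fib A p j) (qc j)" if j: "j \<epsilon> kap" for j
        proof -
          have "fib A p j \<epsilon> I \<or> w \<epsilon> rk (restr I (fib A p j)) f"
            using B j w subset_ofD unfolding big_def by blast
          from split_ex[OF I f sA this] obtain q where q: "q \<epsilon> H" "split I f w (fib A p j) q" by blast
          have "dfn (\<lambda>s. split I f w (fib A p j) (s 0))" by (intro dfns)
          from leastH(2)[where P = "split I f w (fib A p j)", OF this q] show ?thesis unfolding qc_def .
        qed
        have hc: "ok I f w (fib (fib A p j) (qc j) k) (hc j k)" if j: "j \<epsilon> kap" "k \<epsilon> kap" for j k
        proof -
          obtain h where h: "h \<epsilon> H" "ok I f w (fib (fib A p j) (qc j) k) h"
            using qc[OF j(1)] j(2) unfolding split_def by blast
          have "dfn (\<lambda>s. ok I f w (fib (fib A p j) (qc j) k) (s 0))" by (intro dfns)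
          from leastH(2)[where P = "ok I f w (fib (fib A p j) (qc j) k)", OF this h] show ?thesis unfolding hc_def .
        qed
        \<comment> \<open>Each point determines its own piece, by its value under \<open>p\<close>
          and then under the splitting chosen for that value, so the gluing involves no
          overlaps.\<close>
        define Gf where "Gf i = app (Dec f (hc (app p i) (app (qc (app p i)) i))) i" for i
        have dG: "dft (\<lambda>s. Gf (s 0))" unfolding Gf_def by (intro dfns)
        define G where "G = lam kap Gf"
        have G: "G \<epsilon> F0" "\<And>i. i \<epsilon> kap \<Longrightarrow> app G i = Gf i"
          using F0_lam[of Gf, OF dG] F0_app[OF Dec_F0(1)[OF f]] unfolding G_def Gf_def by blast+
        have Gp: "app G i = app (Dec f (hc j k)) i" if "i \<epsilon> fib (fib A p j) (qc j) k" for i j k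
          using that G(2)[of i] A subset_ofD unfolding Gf_def by auto
        define Y where "Y = int (nl G f) A"
        have "Y \<epsilon> I"
        proof (rule normalD(4)[OF n])
          show "subset_of Y kap" using A by (auto simp: subset_of_def Y_def)
          show "regressive p Y" using p unfolding regressive_def Y_def by auto
          fix j assume j: "j \<epsilon> kap"
          show "fib Y p j \<epsilon> I"
          proof (rule normalD(4)[OF n])
            show "subset_of (fib Y p j) kap" using A by (auto simp: subset_of_def Y_def)
            have "regressive (qc j) (fib A p j)" using qc[OF j] unfolding split_def by blast
            then show "regressive (qc j) (fib Y p j)" unfolding regressive_def Y_def by auto
            fix k assume k: "k \<epsilon> kap"
            have "subset_of (fib (fib Y p j) (qc j) k) (int (nl (Dec f (hc j k)) f) (fib (fib A p j) (qc j) k))"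
              unfolding subset_of_def
            proof (intro allI impI)
              fix i assume "i \<epsilon> fib (fib Y p j) (qc j) k"
              then show "i \<epsilon> int (nl (Dec f (hc j k)) f) (fib (fib A p j) (qc j) k)"
                using Gp[of i j k] by (auto simp: Y_def nl_iff)
            qed
            then show "fib (fib Y p j) (qc j) k \<epsilon> I"
              using hc[OF j k] normalD(3)[OF n] unfolding ok_def by blast
          qed
        qed
        then have nG: "nl G f \<epsilon> restr I A" by (simp add: restr_iff Y_def subset_of_def nl_iff)
        have 1: "big I (fib (fib A p j) (qc j) k) G w" if "j \<epsilon> kap" "k \<epsilon> kap" for j k
        proof (rule big_le[OF n _ _ Dec_F0(1)[OF f] G(1) normalD(2)[OF n emp_kap]])
          show "big I (fib (fib A p j) (qc j) k) (Dec f (hc j k)) w" using hc[OF that] by (simp add: ok_def)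
          show "subset_of (fib (fib A p j) (qc j) k) kap" using A by (simp add: subset_of_def)
        qed (simp only: Gp subset_of_refl)
        \<comment> \<open>The induction hypothesis is used twice: here along the splitting
          \<open>qc j\<close> of one piece, next along \<open>p\<close> for all of
          \<open>A\<close>.\<close>
        have 2: "big I (fib A p j) G w" if "j \<epsilon> kap" for j
          using step.IH[OF w] sA qc[OF that] G(1) 1[OF that] unfolding split_def by blast
        have "big I A G w" using step.IH[OF w] A p G(1) 2 by blast
        then have "subset_of w (rk (restr I A) G)" using AI by (simp add: big_def)
        moreover have "rk (restr I A) G \<epsilon> rk (restr I A) f" using rk_less[OF IA f G(1) nG] .
        ultimately show ?thesis using ord_sub_mem rk_ord[OF IA f] ord_elem step.hyps w by blast
      qed
      then show ?thesis unfolding big_def subset_of_def by blast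
    qed (simp add: big_def)
  qed
qed

section \<open>The ideal attached to a function\<close>

lemma JJ_iff: "A \<epsilon> JJ I f \<longleftrightarrow> subset_of A kap \<and> big I A f (suc (rk I f))"
proof -
  have "A \<epsilon> JJ I f \<longleftrightarrow> A \<epsilon> pow kap \<and> big I A f (suc (rk I f))"
    unfolding JJ_def by (rule Sep_iff) (intro dfns)
  then show ?thesis by simp
qed

lemma JJ_super: "normal I \<Longrightarrow> subset_of I (JJ I f)"
  unfolding subset_of_def[of I] JJ_iff big_def using normalD(1) by blast

text \<open>Normality is \<open>big_normal\<close> at the ordinal one above the rank. Restricting to
  \<open>kap\<close> changes nothing and cannot raise the rank, so the ideal is proper.\<close>

lemma JJ_ip: assumes I: "ip I" and f: "f \<epsilon> F0" shows "ip (JJ I f)"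
  unfolding ip_def
proof
  have n: "normal I" using I by (simp add: ip_def)
  have o: "ordinal (suc (rk I f))" using rk_ord[OF I f] by simp
  show "\<not> kap \<epsilon> JJ I f"
    using I restr_kap[OF n] mem_irrefl[of "rk I f"] by (auto simp: ip_def JJ_iff big_def subset_of_def)
  show "normal (JJ I f)"
    unfolding normal_def
  proof (intro conjI allI impI)
    show "subset_of (JJ I f) (pow kap)" by (simp add: subset_of_def[of "JJ I f"] JJ_iff)
    show "subset_of kap (JJ I f)"
      using JJ_super[OF n, of f] normalD(2)[OF n] by (auto simp: subset_of_def)
    fix A B assume "A \<epsilon> JJ I f \<and> subset_of B A"
    then show "B \<epsilon> JJ I f" unfolding JJ_iff using big_mono[OF n] f subset_of_trans by blast
  next
    fix A p assume "subset_of A kap \<and> regressive p A \<and> (\<forall>j. j \<epsilon> kap \<longrightarrow> fib A p j \<epsilon> JJ I f)"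
    then show "A \<epsilon> JJ I f" unfolding JJ_iff using big_normal[OF I o] f by blast
  qed
qed

lemma JJ_not:
  assumes I: "ip I" and f: "f \<epsilon> F0" and A: "subset_of A kap" "\<not> A \<epsilon> JJ I f"
  shows "\<not> A \<epsilon> I" "rk (restr I A) f = rk I f"
proof -
  have n: "normal I" using I by (simp add: ip_def)
  show AI: "\<not> A \<epsilon> I" using A by (auto simp: JJ_iff big_def)
  have "\<not> rk I f \<epsilon> rk (restr I A) f"
    using A AI suc_subset[OF rk_ord[OF I f] rk_ord[OF restr_ip[OF n A(1) AI] f]] by (simp add: JJ_iff big_def)
  then have "subset_of (rk (restr I A) f) (rk I f)"
    using ord_not_mem rk_ord[OF I f] rk_ord[OF restr_ip[OF n A(1) AI] f] by blast
  then show "rk (restr I A) f = rk I f" using restr_rk[OF I A(1) AI f] subset_antisym by blast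
qed

text \<open>If the set \<open>A\<close> where \<open>f\<close> is below \<open>g\<close> were
  positive, then restricting to \<open>A\<close> would leave the rank of \<open>g\<close> unchanged
  and put the rank of \<open>f\<close> below it, although restricting never lowers the rank of
  \<open>f\<close>.\<close>

lemma rk_le_JJ:
  assumes I: "ip I" and f: "f \<epsilon> F0" and g: "g \<epsilon> F0" and le: "subset_of (rk I g) (rk I f)"
  shows "Sep kap (\<lambda>i. app f i \<epsilon> app g i) \<epsilon> JJ I g"
proof (rule ccontr)
  define A where "A = Sep kap (\<lambda>i. app f i \<epsilon> app g i)"
  have A: "i \<epsilon> A \<longleftrightarrow> i \<epsilon> kap \<and> app f i \<epsilon> app g i" for i
    unfolding A_def by (rule Sep_iff) (intro dfns)
  assume "\<not> Sep kap (\<lambda>i. app f i \<epsilon> app g i) \<epsilon> JJ I g"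
  then have J: "\<not> A \<epsilon> JJ I g" by (simp add: A_def)
  have n: "normal I" using I by (simp add: ip_def)
  have s: "subset_of A kap" by (simp add: subset_of_def A)
  note AI = JJ_not[OF I g s J] and IA = restr_ip[OF n s JJ_not(1)[OF I g s J]]
  have "int (nl f g) A = emp" by (rule ext) (auto simp: nl_iff A)
  then have "nl f g \<epsilon> restr I A"
    using normalD(2)[OF n emp_kap] by (simp add: restr_iff subset_of_def nl_iff)
  then have "rk (restr I A) f \<epsilon> rk I g" using rk_less[OF IA g f] AI by simp
  moreover have "subset_of (rk I g) (rk (restr I A) f)"
    using restr_rk[OF I s AI(1) f] le subset_of_trans by blast
  ultimately show False using subset_ofD mem_irrefl by blast
qed

text \<open>If the set \<open>A\<close> where \<open>f\<close> is at most \<open>g\<close> were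
  positive, then on \<open>A\<close> the rank of \<open>f\<close> would be at most that of
  \<open>g\<close>. The latter is unchanged by restricting, the former not lowered, against the
  hypothesis.\<close>

lemma rk_less_JJ:
  assumes I: "ip I" and f: "f \<epsilon> F0" and g: "g \<epsilon> F0" and less: "rk I g \<epsilon> rk I f"
  shows "nl g f \<epsilon> JJ I g"
proof (rule ccontr)
  define A where "A = nl g f"
  assume "\<not> nl g f \<epsilon> JJ I g"
  then have J: "\<not> A \<epsilon> JJ I g" by (simp add: A_def)
  have n: "normal I" using I by (simp add: ip_def)
  have s: "subset_of A kap" by (simp add: subset_of_def A_def nl_iff)
  note AI = JJ_not[OF I g s J] and IA = restr_ip[OF n s JJ_not(1)[OF I g s J]]
  have "big I A f (rk (restr I A) f)" by (simp add: big_def)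
  then have "big I A g (rk (restr I A) f)"
  proof (rule big_le[OF n _ s f g normalD(2)[OF n emp_kap]])
    fix i assume "i \<epsilon> A"
    then show "subset_of (app f i) (app g i)"
      using ord_not_mem F0_ord[OF f] F0_ord[OF g] by (auto simp: A_def nl_iff)
  qed
  then have "subset_of (rk (restr I A) f) (rk I g)" using AI by (simp add: big_def)
  moreover have "subset_of (rk I f) (rk (restr I A) f)" using restr_rk[OF I s AI(1) f] .
  ultimately show False using less subset_ofD mem_irrefl by blast
qed

text \<open>By equality of ranks both sets on which one function is strictly below the other are
  null.\<close>

lemma JJ_unique:
  assumes I: "ip I" and f: "f \<epsilon> F0" and g: "g \<epsilon> F0" and e: "rk I f = rk I g" "JJ I f = JJ I g"
  shows "Sep kap (\<lambda>i. app f i \<noteq> app g i) \<epsilon> JJ I f"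
proof -
  have 1: "Sep kap (\<lambda>i. app f i \<epsilon> app g i) \<epsilon> JJ I f" "Sep kap (\<lambda>i. app g i \<epsilon> app f i) \<epsilon> JJ I f"
    using rk_le_JJ[OF I f g] rk_le_JJ[OF I g f] e by simp_all
  have n: "normal (JJ I f)" using JJ_ip[OF I f] by (simp add: ip_def)
  have S: "i \<epsilon> Sep kap (\<lambda>i. app f i \<epsilon> app g i) \<longleftrightarrow> i \<epsilon> kap \<and> app f i \<epsilon> app g i"
    "i \<epsilon> Sep kap (\<lambda>i. app f i \<noteq> app g i) \<longleftrightarrow> i \<epsilon> kap \<and> app f i \<noteq> app g i" for f g i
    by (rule Sep_iff; intro dfns)+
  have "subset_of (Sep kap (\<lambda>i. app f i \<noteq> app g i))
      (un (Sep kap (\<lambda>i. app f i \<epsilon> app g i)) (Sep kap (\<lambda>i. app g i \<epsilon> app f i)))"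
    unfolding subset_of_def S un_iff using ord_cases F0_ord[OF f] F0_ord[OF g] by metis
  then show ?thesis using normalD(3)[OF n normal_un[OF n 1]] by blast
qed

end

section \<open>Uniform injections of the ordinals below the successor\<close>

context singular_aleph
begin

lemma NS_ip: "ip NS" unfolding ip_def using NS_normal NS_proper by blast

text \<open>Canonical functions: an enumeration of \<open>d\<close> exhausts it by small sets
  \<open>C i\<close>, and \<open>ff x\<close> takes at \<open>i\<close> the order type of
  \<open>C i\<close> below \<open>x\<close>. These functions increase strictly modulo bounded sets,
  so \<open>ff x\<close> has rank at least \<open>x\<close>.\<close>

lemma rk_onto:
  assumes d: "ordinal d" "d \<lesssim> mu" shows "\<exists>f. f \<epsilon> F0 \<and> rk NS f = d"
proof -
  obtain e where e: "injf e d mu" using d(2) unfolding lep_def by blast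
  define C where "C i = Sep d (\<lambda>x. app e x \<epsilon> mm i)" for i
  have C: "x \<epsilon> C i \<longleftrightarrow> x \<epsilon> d \<and> app e x \<epsilon> mm i" for x i
    unfolding C_def by (rule Sep_iff) (intro dfns)
  have CO: "ordinal x" if "x \<epsilon> C i" for x i using that C d(1) ord_elem by blast
  \<comment> \<open>The order type of the part of \<open>C i\<close> below \<open>x\<close>, taken
    as an image under the collapse of the whole \<open>C i\<close>, so that the types for different
    \<open>x\<close> are directly comparable.\<close>
  define v where "v x i = Rep (Sep (C i) (\<lambda>y. y \<epsilon> x)) (col (C i) (memr (C i)))" for x i
  have [dfns]: "dft (\<lambda>s. C (t s))" if "dft t" for t
    using _ that by (rule tsubst1[where F = C]) (unfold C_def, intro dfns)
  have [dfns]: "dft (\<lambda>s. v (t s) (u s))" if "dft t" "dft u" for t u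
    using _ that by (rule tsubst2[where F = v]) (unfold v_def, intro dfns)
  have v: "z \<epsilon> v x i \<longleftrightarrow> (\<exists>y. y \<epsilon> C i \<and> y \<epsilon> x \<and> z = col (C i) (memr (C i)) y)" for z x i
  proof -
    have "y \<epsilon> Sep (C i) (\<lambda>y. y \<epsilon> x) \<longleftrightarrow> y \<epsilon> C i \<and> y \<epsilon> x" for y by (rule Sep_iff) (intro dfns)
    moreover have "z \<epsilon> v x i \<longleftrightarrow> (\<exists>y. y \<epsilon> Sep (C i) (\<lambda>y. y \<epsilon> x) \<and> z = col (C i) (memr (C i)) y)"
      unfolding v_def by (rule Rep_iff) (intro dfns)
    ultimately show ?thesis by blast
  qed
  have oc1: "ordinal (col (C i) (memr (C i)) y)" if "y \<epsilon> C i" for y i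
    by (rule otp_col(1)[OF _ that]) (rule CO)
  have oc3: "col (C i) (memr (C i)) y = col (C i) (memr (C i)) y' \<longleftrightarrow> y = y'" if "y \<epsilon> C i" "y' \<epsilon> C i" for y y' i
    by (rule otp_col(3)[OF _ that]) (rule CO)
  have cm: "z \<epsilon> col (C i) (memr (C i)) y \<longleftrightarrow> (\<exists>y'. y' \<epsilon> C i \<and> y' \<epsilon> y \<and> z = col (C i) (memr (C i)) y')"
    if "y \<epsilon> C i" for z y i
    using that by (subst otp_col(2)) (auto simp: memr_iff intro: CO)
  have vo: "ordinal (v x i)" if x: "ordinal x" for x i
  proof (rule ordI)
    show "transitive_set (v x i)"
      unfolding transitive_set_def subset_of_def
    proof (intro allI impI)
      fix z w assume "z \<epsilon> v x i" "w \<epsilon> z"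
      then obtain y where y: "y \<epsilon> C i" "y \<epsilon> x" "w \<epsilon> col (C i) (memr (C i)) y" by (auto simp: v)
      then obtain y' where "y' \<epsilon> C i" "y' \<epsilon> y" "w = col (C i) (memr (C i)) y'" by (auto simp: cm)
      then show "w \<epsilon> v x i" unfolding v using ord_trans[OF x _ y(2)] by blast
    qed
    show "ordinal z" if "z \<epsilon> v x i" for z using that by (auto simp: v oc1)
  qed
  have vl: "v x i \<lesssim> mm i" for x i
  proof -
    define F where "F z = app e (the1 (\<lambda>y. y \<epsilon> C i \<and> z = col (C i) (memr (C i)) y))" for z
    have F: "F (col (C i) (memr (C i)) y) = app e y" if y: "y \<epsilon> C i" for y
    proof -
      have "the1 (\<lambda>y'. y' \<epsilon> C i \<and> col (C i) (memr (C i)) y = col (C i) (memr (C i)) y') = y"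
        by (rule the1_equality) (use y oc3[of _ i] in auto)
      then show ?thesis by (simp add: F_def)
    qed
    show ?thesis
    proof (rule lepI[of F])
      show "dft (\<lambda>s. F (s 0))" unfolding F_def by (intro dfns)
      show "F z \<epsilon> mm i" if "z \<epsilon> v x i" for z using that F C by (auto simp: v)
      show "z = w" if "z \<epsilon> v x i" "w \<epsilon> v x i" "F z = F w" for z w
        using that by (auto simp: v F C injf_eq[OF e])
    qed
  qed
  have vm: "v x i \<epsilon> mu" if "ordinal x" "i \<epsilon> kap" for x i
  proof (rule ccontr)
    assume "\<not> v x i \<epsilon> mu"
    then have "subset_of mu (v x i)" using ord_not_mem vo[OF that(1)] ord_mu by blast
    then have "mu \<lesssim> mm i" using vl subset_lep lep_trans by blast
    then show False using mu_not_lep mm_mu that(2) by blast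
  qed
  define ff where "ff x = lam kap (v x)" for x
  have [dfns]: "dft (\<lambda>s. ff (t s))" if "dft t" for t
    using _ that by (rule tsubst1[where F = ff]) (unfold ff_def, intro dfns)
  have ff: "ff x \<epsilon> F0" "\<And>i. i \<epsilon> kap \<Longrightarrow> app (ff x) i = v x i" if "ordinal x" for x
  proof -
    have "dft (\<lambda>s. v x (s 0))" by (intro dfns)
    note L = F0_lam[of "v x", OF this vm[OF that] vl]
    show "ff x \<epsilon> F0" "\<And>i. i \<epsilon> kap \<Longrightarrow> app (ff x) i = v x i" unfolding ff_def using L by auto
  qed
  have less: "nl (ff x) (ff y) \<epsilon> NS" if xy: "x \<epsilon> y" "ordinal y" "x \<epsilon> d" for x y
  proof -
    have ox: "ordinal x" using xy ord_elem by blast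
    \<comment> \<open>Beyond \<open>i0\<close> the point \<open>x\<close> belongs to
      \<open>C i\<close> and is counted for \<open>y\<close> but not for \<open>x\<close>.\<close>
    obtain i0 where i0: "i0 \<epsilon> kap" "app e x \<epsilon> app c i0" using c_cofinal injf_mem[OF e xy(3)] by blast
    have "i \<epsilon> suc i0" if i: "i \<epsilon> kap" "\<not> app (ff x) i \<epsilon> app (ff y) i" for i
    proof (rule ccontr)
      assume "\<not> i \<epsilon> suc i0"
      then have "i0 \<epsilon> i" using ord_cases[OF kap_ord[OF i(1)] kap_ord[OF i0(1)]] by auto
      then have x: "x \<epsilon> C i" using xy(3) i0 C mm_iff by blast
      have "v x i = col (C i) (memr (C i)) x" by (rule ext) (simp add: v cm[OF x])
      then have "v x i \<epsilon> v y i" using v x xy(1) by auto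
      then show False using i ff(2)[OF ox] ff(2)[OF xy(2)] by simp
    qed
    then have "subset_of (nl (ff x) (ff y)) (suc i0)" by (simp add: subset_of_def nl_iff)
    then show ?thesis using normalD(2,3)[OF NS_normal] suc_kap i0(1) by blast
  qed
  have "ordinal x \<Longrightarrow> x \<epsilon> suc d \<longrightarrow> subset_of x (rk NS (ff x))" for x
  proof (induction x rule: ord_induct)
    case dfn
    show ?case by (intro dfns)
  next
    case (step x)
    show ?case
    proof
      assume x: "x \<epsilon> suc d"
      show "subset_of x (rk NS (ff x))"
        unfolding subset_of_def
      proof (intro allI impI)
        fix y assume y: "y \<epsilon> x"
        then have yd: "y \<epsilon> d" using x ord_trans[OF d(1) y] by auto
        have oy: "ordinal y" using y step.hyps ord_elem by blast
        have "subset_of y (rk NS (ff y))" using step.IH[OF y] yd by simp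
        moreover have "rk NS (ff y) \<epsilon> rk NS (ff x)"
          using rk_less[OF NS_ip ff(1)[OF step.hyps] ff(1)[OF oy] less[OF y step.hyps yd]] .
        ultimately show "y \<epsilon> rk NS (ff x)"
          using ord_sub_mem[OF rk_ord[OF NS_ip ff(1)[OF step.hyps]] oy] by blast
      qed
    qed
  qed
  then have "subset_of d (rk NS (ff d))" using d(1) by simp
  \<comment> \<open>The rank of \<open>ff d\<close> may exceed \<open>d\<close>; then
    \<open>d\<close>, an element of this rank, is itself the rank of some function.\<close>
  then have "d = rk NS (ff d) \<or> d \<epsilon> rk NS (ff d)"
    using ord_subset_iff d(1) rk_ord[OF NS_ip ff(1)] by blast
  then show ?thesis
  proof
    assume "d = rk NS (ff d)"
    then show ?thesis using ff(1)[OF d(1)] by metis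
  next
    assume "d \<epsilon> rk NS (ff d)"
    then show ?thesis using rk_iff[OF NS_ip ff(1)[OF d(1)]] by metis
  qed
qed

text \<open>Choice in the metalogic fixes one element of the model here, which then occurs as a
  parameter in formulas. No choice function inside the model is produced by this.\<close>

definition iota :: 'a where "iota = (SOME i. injf i (pow (pow kap)) mu)"

lemma iota: "injf iota (pow (pow kap)) mu"
  unfolding iota_def using pow_pow_lep unfolding lep_def by (rule someI_ex)

definition leastN :: "('a \<Rightarrow> bool) \<Rightarrow> 'a" where
  "leastN P = the1 (\<lambda>x. x \<epsilon> pow (pow kap) \<and> P x \<and>
     (\<forall>y. y \<epsilon> pow (pow kap) \<and> P y \<longrightarrow> app iota x = app iota y \<or> app iota x \<epsilon> app iota y))"

lemma dft_leastN [dfns]: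
  assumes "dfn (\<lambda>s. P (\<lambda>n. s (Suc n)) (s 0))" shows "dft (\<lambda>s. leastN (P s))"
  unfolding leastN_def
  by (intro dfns dfn_body[of P "\<lambda>n. Suc (Suc n)" 0] assms) (simp_all add: inj_def)

lemma leastN:
  assumes "dfn (\<lambda>s. P (s 0))" "x \<epsilon> pow (pow kap)" "P x" shows "P (leastN P)"
proof -
  obtain m where "P m" "leastN P = m"
    using least_via_injf[where P = P, OF assms iota ord_mu] unfolding leastN_def by blast
  then show ?thesis by simp
qed

text \<open>From a nonempty set \<open>S\<close> of functions one cannot choose an element, but one can choose an ideal
  and an element modulo this ideal.\<close>

definition minrk :: "'a \<Rightarrow> 'a \<Rightarrow> 'a" where
  "minrk I S = leastO (\<lambda>a. \<exists>f. f \<epsilon> S \<and> rk I f = a)"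

definition Jc :: "'a \<Rightarrow> 'a \<Rightarrow> 'a" where
  "Jc I S = leastN (\<lambda>J. \<exists>f. f \<epsilon> S \<and> rk I f = minrk I S \<and> JJ I f = J)"

definition Lc :: "'a \<Rightarrow> 'a \<Rightarrow> 'a" where
  "Lc I S = Sep S (\<lambda>f. rk I f = minrk I S \<and> JJ I f = Jc I S)"

lemma dft_minrk [dfns]: "dft t \<Longrightarrow> dft u \<Longrightarrow> dft (\<lambda>s. minrk (t s) (u s))"
  by (rule tsubst2[where F = minrk], unfold minrk_def, intro dfns)

lemma dft_Jc [dfns]: "dft t \<Longrightarrow> dft u \<Longrightarrow> dft (\<lambda>s. Jc (t s) (u s))"
  by (rule tsubst2[where F = Jc], unfold Jc_def, intro dfns)

lemma dft_Lc [dfns]: "dft t \<Longrightarrow> dft u \<Longrightarrow> dft (\<lambda>s. Lc (t s) (u s))"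
  by (rule tsubst2[where F = Lc], unfold Lc_def, intro dfns)

lemma Lc_iff: "f \<epsilon> Lc I S \<longleftrightarrow> f \<epsilon> S \<and> rk I f = minrk I S \<and> JJ I f = Jc I S"
  unfolding Lc_def by (rule Sep_iff) (intro dfns)

lemma Lc_ex:
  assumes I: "ip I" and S: "subset_of S F0" "f \<epsilon> S" shows "\<exists>g. g \<epsilon> Lc I S"
proof -
  have d: "dfn (\<lambda>s. \<exists>f. f \<epsilon> S \<and> rk I f = s 0)" by (intro dfns)
  have o: "ordinal (rk I f)" using rk_ord I S subset_ofD by blast
  have "\<exists>g. g \<epsilon> S \<and> rk I g = minrk I S"
    unfolding minrk_def by (rule leastO(2)[where P = "\<lambda>a. \<exists>f. f \<epsilon> S \<and> rk I f = a", OF d o]) (use S in blast)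
  then obtain g where g: "g \<epsilon> S" "rk I g = minrk I S" by blast
  have d2: "dfn (\<lambda>s. \<exists>f. f \<epsilon> S \<and> rk I f = minrk I S \<and> JJ I f = s 0)" by (intro dfns)
  have "JJ I g \<epsilon> pow (pow kap)" by (simp add: JJ_iff subset_of_def[of "JJ I g"])
  then have "\<exists>f. f \<epsilon> S \<and> rk I f = minrk I S \<and> JJ I f = Jc I S"
    unfolding Jc_def
    by (rule leastN[where P = "\<lambda>J. \<exists>f. f \<epsilon> S \<and> rk I f = minrk I S \<and> JJ I f = J", OF d2]) (use g in blast)
  then show ?thesis unfolding Lc_iff by blast
qed

lemma Lc:
  assumes I: "ip I" and S: "subset_of S F0" and f: "f \<epsilon> Lc I S"
  shows "f \<epsilon> F0" "ip (Jc I S)" "subset_of I (Jc I S)"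
    "\<And>g. g \<epsilon> Lc I S \<Longrightarrow> Sep kap (\<lambda>i. app f i \<noteq> app g i) \<epsilon> Jc I S"
proof -
  have F: "g \<epsilon> F0 \<and> rk I g = minrk I S \<and> JJ I g = Jc I S" if "g \<epsilon> Lc I S" for g
    using that S subset_ofD unfolding Lc_iff by blast
  show "f \<epsilon> F0" using F f by blast
  show "ip (Jc I S)" using JJ_ip[OF I] F[OF f] by metis
  show "subset_of I (Jc I S)" using JJ_super F[OF f] I ip_def by metis
  show "Sep kap (\<lambda>i. app f i \<noteq> app g i) \<epsilon> Jc I S" if "g \<epsilon> Lc I S" for g
    using JJ_unique[OF I, of f g] F[OF f] F[OF that] by metis
qed

section \<open>Coding the ordinals below \<open>d\<close> in \<open>mu\<close>\<close>

definition Sb :: "'a \<Rightarrow> 'a" where "Sb x = Sep F0 (\<lambda>g. rk NS g = x)"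
definition Ib :: "'a \<Rightarrow> 'a" where "Ib x = Jc NS (Sb x)"
text \<open>All members have rank \<open>x\<close> modulo \<open>NS\<close> and agree pairwise
  modulo \<open>Ib x\<close>, so \<open>x\<close> determines a function up to this ideal.\<close>

definition Kb :: "'a \<Rightarrow> 'a" where "Kb x = Lc NS (Sb x)"

text \<open>Common upper bounds are formed separately for each ideal, since the functions belonging
  to \<open>x\<close> are controlled only modulo \<open>Ib x\<close>.\<close>

definition Tb :: "'a \<Rightarrow> 'a \<Rightarrow> 'a" where
  "Tb d I = Sep F0 (\<lambda>f. \<forall>x g. x \<epsilon> d \<and> Ib x = I \<and> g \<epsilon> Kb x \<longrightarrow> nl g f \<epsilon> I)"

text \<open>Quantifying over \<open>f\<close> and \<open>g\<close> keeps this free of choices: both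
  are determined modulo the ideal \<open>Jc (Ib x) (Tb d (Ib x))\<close>, which contains
  \<open>Ib x\<close>. The set \<open>X\<close> has to be positive for this ideal, as otherwise the
  agreement on \<open>X\<close> would say nothing.\<close>

definition codes_in :: "'a \<Rightarrow> 'a \<Rightarrow> 'a \<Rightarrow> 'a \<Rightarrow> bool" where
  "codes_in d x X h \<longleftrightarrow> subset_of X kap \<and> \<not> X \<epsilon> Jc (Ib x) (Tb d (Ib x)) \<and>
     (\<exists>f g. f \<epsilon> Lc (Ib x) (Tb d (Ib x)) \<and> g \<epsilon> Kb x \<and>
        Sep X (\<lambda>i. app (Dec f h) i \<noteq> app g i) \<epsilon> Jc (Ib x) (Tb d (Ib x)))"

definition Xc :: "'a \<Rightarrow> 'a \<Rightarrow> 'a" where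
  "Xc d x = leastH (\<lambda>X. \<exists>h. h \<epsilon> H \<and> codes_in d x X h)"

definition hc :: "'a \<Rightarrow> 'a \<Rightarrow> 'a" where "hc d x = leastH (codes_in d x (Xc d x))"

text \<open>The code consists of the ideal, a positive set and a bounded code function on it. For
  fixed \<open>d\<close> the ideal alone determines the upper bound, up to a null set, against which
  the rest is decoded.\<close>

definition EE :: "'a \<Rightarrow> 'a \<Rightarrow> 'a" where
  "EE d x = pp (app iota (Ib x)) (pp (app b (Xc d x)) (app b (hc d x)))"

lemma dft_Sb [dfns]: "dft t \<Longrightarrow> dft (\<lambda>s. Sb (t s))"
  by (rule tsubst1[where F = Sb], unfold Sb_def, intro dfns)

lemma dft_Ib [dfns]: "dft t \<Longrightarrow> dft (\<lambda>s. Ib (t s))"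
  by (rule tsubst1[where F = Ib], unfold Ib_def, intro dfns)

lemma dft_Kb [dfns]: "dft t \<Longrightarrow> dft (\<lambda>s. Kb (t s))"
  by (rule tsubst1[where F = Kb], unfold Kb_def, intro dfns)

lemma dft_Tb [dfns]: "dft t \<Longrightarrow> dft u \<Longrightarrow> dft (\<lambda>s. Tb (t s) (u s))"
  by (rule tsubst2[where F = Tb], unfold Tb_def, intro dfns)

lemma dfn_codes_in [dfns]:
  "dft t \<Longrightarrow> dft u \<Longrightarrow> dft v \<Longrightarrow> dft w \<Longrightarrow> dfn (\<lambda>s. codes_in (t s) (u s) (v s) (w s))"
  by (rule subst4[where P = codes_in], unfold codes_in_def, intro dfns)

lemma dft_Xc [dfns]: "dft t \<Longrightarrow> dft u \<Longrightarrow> dft (\<lambda>s. Xc (t s) (u s))"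
  by (rule tsubst2[where F = Xc], unfold Xc_def, intro dfns)

lemma dft_hc [dfns]: "dft t \<Longrightarrow> dft u \<Longrightarrow> dft (\<lambda>s. hc (t s) (u s))"
  by (rule tsubst2[where F = hc], unfold hc_def, intro dfns)

lemma dft_EE [dfns]: "dft t \<Longrightarrow> dft u \<Longrightarrow> dft (\<lambda>s. EE (t s) (u s))"
  by (rule tsubst2[where F = EE], unfold EE_def, intro dfns)

lemma Sb_iff: "g \<epsilon> Sb x \<longleftrightarrow> g \<epsilon> F0 \<and> rk NS g = x"
  unfolding Sb_def by (rule Sep_iff) (intro dfns)

lemma Kb:
  assumes "g \<epsilon> Kb x"
  shows "g \<epsilon> F0" "rk NS g = x" "JJ NS g = Ib x" "ip (Ib x)"
proof -
  show *: "g \<epsilon> F0" "rk NS g = x" "JJ NS g = Ib x"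
    using assms unfolding Kb_def Lc_iff Sb_iff Ib_def by auto
  show "ip (Ib x)" using JJ_ip[OF NS_ip *(1)] *(3) by simp
qed

lemma Kb_ex: "ordinal x \<Longrightarrow> x \<lesssim> mu \<Longrightarrow> \<exists>g. g \<epsilon> Kb x"
  using rk_onto Lc_ex[OF NS_ip, of "Sb x"] unfolding Kb_def subset_of_def Sb_iff by blast

text \<open>\<open>Ib x\<close> is the ideal attached to \<open>g\<close> modulo \<open>NS\<close>,
  so a function of larger rank lies above \<open>g\<close> modulo it.\<close>

lemma Kb_less: "g \<epsilon> Kb x \<Longrightarrow> f \<epsilon> F0 \<Longrightarrow> x \<epsilon> rk NS f \<Longrightarrow> nl g f \<epsilon> Ib x"
  using rk_less_JJ[OF NS_ip] Kb by metis

lemma Tb_iff: "f \<epsilon> Tb d I \<longleftrightarrow> f \<epsilon> F0 \<and> (\<forall>x g. x \<epsilon> d \<and> Ib x = I \<and> g \<epsilon> Kb x \<longrightarrow> nl g f \<epsilon> I)"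
  unfolding Tb_def by (rule Sep_iff) (intro dfns)

lemma Tb_F0: "subset_of (Tb d I) F0" by (simp add: subset_of_def Tb_iff)

text \<open>Any function of rank \<open>d\<close> is an upper bound, whichever ideal is
  considered.\<close>

lemma Tb_ex: "ordinal d \<Longrightarrow> d \<lesssim> mu \<Longrightarrow> \<exists>f. f \<epsilon> Tb d I"
  using rk_onto Kb_less unfolding Tb_iff by metis

text \<open>Decoding is pointwise in the upper bound; changing the bound on a null set changes the
  decoded function only there.\<close>

lemma Dec_cong: "i \<epsilon> kap \<Longrightarrow> app f i = app g i \<Longrightarrow> app (Dec f h) i = app (Dec g h) i"
proof -
  assume i: "i \<epsilon> kap" "app f i = app g i"
  have "app (Dec f h) i = (if \<exists>x. x \<epsilon> app f i \<and> app (ei i (app f i)) x = app h i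
     then the1 (\<lambda>x. x \<epsilon> app f i \<and> app (ei i (app f i)) x = app h i) else emp)" for f
    unfolding Dec_def by (rule app_lam) (intro dfns, rule i)
  from this[of f] this[of g] show ?thesis unfolding i(2) by (simp only:)
qed

lemma below: "ordinal d \<Longrightarrow> d \<lesssim> mu \<Longrightarrow> x \<epsilon> d \<Longrightarrow> ordinal x \<and> x \<lesssim> mu"
  using ord_elem ord_mem_subset subset_lep lep_trans by blast

lemma codes_in_ex:
  assumes d: "ordinal d" "d \<lesssim> mu" and x: "x \<epsilon> d"
  shows "Xc d x \<epsilon> H" "hc d x \<epsilon> H" "codes_in d x (Xc d x) (hc d x)"
proof -
  define I where "I = Ib x"
  define J where "J = Jc I (Tb d I)"
  obtain g where g: "g \<epsilon> Kb x" using Kb_ex below[OF d x] by blast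
  have I: "ip I" using Kb(4)[OF g] by (simp add: I_def)
  obtain f where f: "f \<epsilon> Lc I (Tb d I)" using Lc_ex[OF I Tb_F0] Tb_ex[OF d] by blast
  note L = Lc[OF I Tb_F0 f, folded J_def]
  have "nl g f \<epsilon> I" using f x g unfolding Lc_iff Tb_iff I_def by blast
  then have fJ: "nl g f \<epsilon> J" using L(3) subset_ofD by blast
  have n: "normal J" "\<not> kap \<epsilon> J" using L(2) by (auto simp: ip_def)
  obtain q where q: "q \<epsilon> H" "regressive q kap"
    "\<And>k. k \<epsilon> kap \<Longrightarrow> \<exists>h. h \<epsilon> H \<and> (\<forall>i. i \<epsilon> fib kap q k \<and> app g i \<epsilon> app f i \<longrightarrow>
        app h i = app (ei i (app f i)) (app g i) \<and> app (Dec f h) i = app g i)"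
    by (rule codes[OF L(1) Kb(1)[OF g] subset_of_refl]) blast
  \<comment> \<open>Since \<open>kap\<close> is positive, normality yields a positive fibre of the
    regressive function; this fibre is the set \<open>X\<close>.\<close>
  obtain k where k: "k \<epsilon> kap" "\<not> fib kap q k \<epsilon> J"
    using normalD(4)[OF n(1) subset_of_refl q(2)] n(2) by blast
  obtain h where h: "h \<epsilon> H" "\<And>i. i \<epsilon> fib kap q k \<Longrightarrow> app g i \<epsilon> app f i \<Longrightarrow> app (Dec f h) i = app g i"
    using q(3)[OF k(1)] by blast
  define X where "X = fib kap q k"
  have X: "subset_of X kap" by (simp add: X_def subset_of_def)
  have S: "i \<epsilon> Sep X (\<lambda>i. app (Dec f h) i \<noteq> app g i) \<longleftrightarrow> i \<epsilon> X \<and> app (Dec f h) i \<noteq> app g i" for i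
    by (rule Sep_iff) (intro dfns)
  have "subset_of (Sep X (\<lambda>i. app (Dec f h) i \<noteq> app g i)) (nl g f)"
    unfolding subset_of_def S nl_iff using h(2) X subset_ofD unfolding X_def by blast
  then have "Sep X (\<lambda>i. app (Dec f h) i \<noteq> app g i) \<epsilon> J" using normalD(3)[OF n(1) fJ] by blast
  then have c: "codes_in d x X h"
    unfolding codes_in_def I_def[symmetric] J_def[symmetric] using X k(2) f g X_def by blast
  have XH: "X \<epsilon> H" using H_subset[OF X kap_mu] .
  have d1: "dfn (\<lambda>s. \<exists>h. h \<epsilon> H \<and> codes_in d x (s 0) h)" by (intro dfns)
  have "\<exists>h. h \<epsilon> H \<and> codes_in d x X h" using h(1) c by blast
  note l1 = leastH[where P = "\<lambda>X. \<exists>h. h \<epsilon> H \<and> codes_in d x X h", OF d1 XH this, folded Xc_def]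
  then obtain h' where h': "h' \<epsilon> H" "codes_in d x (Xc d x) h'" by blast
  have d2: "dfn (\<lambda>s. codes_in d x (Xc d x) (s 0))" by (intro dfns)
  note l2 = leastH[where P = "codes_in d x (Xc d x)", OF d2 h', folded hc_def]
  show "Xc d x \<epsilon> H" "hc d x \<epsilon> H" "codes_in d x (Xc d x) (hc d x)" using l1 l2 by auto
qed

text \<open>If the code were shared, \<open>X\<close> would be covered by four null sets: where
  either decoding fails, where the two upper bounds differ, and where \<open>g\<close> is not below
  \<open>g'\<close>. At any other point \<open>g\<close> and \<open>g'\<close> would be equal and
  \<open>g\<close> strictly smaller.\<close>

lemma codes_in_unique:
  assumes d: "ordinal d" "d \<lesssim> mu" and xy: "x \<epsilon> d" "y \<epsilon> d" "x \<epsilon> y" "Ib x = Ib y"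
    and c: "codes_in d x X h" "codes_in d y X h"
  shows False
proof -
  define I where "I = Ib x"
  define J where "J = Jc I (Tb d I)"
  have Iy: "Ib y = I" using xy by (simp add: I_def)
  obtain f g where f: "f \<epsilon> Lc I (Tb d I)" and g: "g \<epsilon> Kb x"
    and 1: "Sep X (\<lambda>i. app (Dec f h) i \<noteq> app g i) \<epsilon> J" and X: "subset_of X kap" "\<not> X \<epsilon> J"
    using c(1) unfolding codes_in_def I_def[symmetric] J_def[symmetric] by blast
  obtain f' g' where f': "f' \<epsilon> Lc I (Tb d I)" and g': "g' \<epsilon> Kb y"
    and 2: "Sep X (\<lambda>i. app (Dec f' h) i \<noteq> app g' i) \<epsilon> J"
    using c(2) unfolding codes_in_def Iy J_def[symmetric] by blast
  have I: "ip I" using Kb(4)[OF g] by (simp add: I_def)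
  note L = Lc[OF I Tb_F0 f, folded J_def]
  have n: "normal J" using L(2) by (simp add: ip_def)
  have 3: "Sep kap (\<lambda>i. app f i \<noteq> app f' i) \<epsilon> J" using L(4)[OF f'] .
  have "nl g g' \<epsilon> I" using Kb_less[OF g Kb(1)[OF g']] Kb(2)[OF g'] xy(3) by (simp add: I_def)
  then have 4: "nl g g' \<epsilon> J" using L(3) subset_ofD by blast
  have S: "i \<epsilon> Sep X (\<lambda>i. app u i \<noteq> app w i) \<longleftrightarrow> i \<epsilon> X \<and> app u i \<noteq> app w i" for X u w i
    by (rule Sep_iff) (intro dfns)
  have "subset_of X (un (un (Sep X (\<lambda>i. app (Dec f h) i \<noteq> app g i)) (Sep X (\<lambda>i. app (Dec f' h) i \<noteq> app g' i)))
      (un (Sep kap (\<lambda>i. app f i \<noteq> app f' i)) (nl g g')))"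
    unfolding subset_of_def[of X] un_iff S nl_iff
    using subset_ofD[OF X(1)] Dec_cong[of _ f f' h] mem_irrefl by metis
  moreover have "un (un (Sep X (\<lambda>i. app (Dec f h) i \<noteq> app g i)) (Sep X (\<lambda>i. app (Dec f' h) i \<noteq> app g' i)))
      (un (Sep kap (\<lambda>i. app f i \<noteq> app f' i)) (nl g g')) \<epsilon> J"
    by (intro normal_un n 1 2 3 4)
  ultimately show False using normalD(3)[OF n] X(2) by blast
qed

theorem EE:
  assumes d: "ordinal d" "d \<lesssim> mu"
  shows "x \<epsilon> d \<Longrightarrow> EE d x \<epsilon> mu" "x \<epsilon> d \<Longrightarrow> y \<epsilon> d \<Longrightarrow> EE d x = EE d y \<Longrightarrow> x = y"
proof -
  have i: "Ib x \<epsilon> pow (pow kap)" if x: "x \<epsilon> d" for x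
  proof -
    obtain g where "g \<epsilon> Kb x" using Kb_ex below[OF d x] by blast
    then show ?thesis using Kb(4) unfolding ip_def normal_def by auto
  qed
  note im = injf_mem[OF iota i] and C = codes_in_ex[OF d]
  have bm: "app b (Xc d x) \<epsilon> mu" "app b (hc d x) \<epsilon> mu" if "x \<epsilon> d" for x
    using injf_mem[OF b] C[OF that] by auto
  show "x \<epsilon> d \<Longrightarrow> EE d x \<epsilon> mu" unfolding EE_def using im bm pp_mu by blast
  show "x = y" if x: "x \<epsilon> d" and y: "y \<epsilon> d" and e: "EE d x = EE d y"
  proof -
    have "app iota (Ib x) = app iota (Ib y)" "app b (Xc d x) = app b (Xc d y)" "app b (hc d x) = app b (hc d y)"
      using e pp_eq im[OF x] im[OF y] bm[OF x] bm[OF y] pp_mu unfolding EE_def by metis+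
    then have *: "Ib x = Ib y" "Xc d x = Xc d y" "hc d x = hc d y"
      using injf_eq[OF iota i[OF x] i[OF y]] injf_eq[OF b] C(1,2)[OF x] C(1,2)[OF y] by auto
    have "\<not> x \<epsilon> y" using codes_in_unique[OF d x y _ *(1), of "Xc d x" "hc d x"] C(3)[OF x] C(3)[OF y] * by auto
    moreover have "\<not> y \<epsilon> x" using codes_in_unique[OF d y x _ *(1)[symmetric], of "Xc d x" "hc d x"] C(3)[OF x] C(3)[OF y] * by auto
    ultimately show ?thesis using ord_cases below[OF d x] below[OF d y] by metis
  qed
qed

end

section \<open>The successor of \<open>mu\<close>\<close>

context singular_aleph
begin

text \<open>This is the Hartogs number of \<open>mu\<close>. It is a set because all these ordinals
  are ranks of members of \<open>F0\<close>.\<close>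

definition succ_mu :: 'a where
  "succ_mu = Sep (Rep F0 (rk NS)) (\<lambda>a. ordinal a \<and> a \<lesssim> mu)"

lemma succ_mu_iff: "a \<epsilon> succ_mu \<longleftrightarrow> ordinal a \<and> a \<lesssim> mu"
proof -
  have "a \<epsilon> Rep F0 (rk NS) \<longleftrightarrow> (\<exists>f. f \<epsilon> F0 \<and> a = rk NS f)"
    by (rule Rep_iff) (intro dfns)
  moreover have "a \<epsilon> succ_mu \<longleftrightarrow> a \<epsilon> Rep F0 (rk NS) \<and> ordinal a \<and> a \<lesssim> mu"
    unfolding succ_mu_def by (rule Sep_iff) (intro dfns)
  ultimately show ?thesis using rk_onto by blast
qed

lemma succ_mu_ord: "ordinal succ_mu"
proof (rule ordI)
  show "transitive_set succ_mu"
    unfolding transitive_set_def subset_of_def succ_mu_iff using below by blast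
qed (simp add: succ_mu_iff)

lemma succ_mu_not_lep: "\<not> succ_mu \<lesssim> mu"
  using succ_mu_iff succ_mu_ord mem_irrefl by blast

lemma mu_less_succ_mu: "mu \<epsilon> succ_mu"
  unfolding succ_mu_iff using ord_mu subset_lep by simp

lemma succ_mu_aleph: "aleph succ_mu"
  unfolding aleph_iff using succ_mu_ord succ_mu_not_lep succ_mu_iff lep_trans by blast

lemma succ_mu_card_succ: "is_card_succ mu succ_mu"
  unfolding is_card_succ_def
proof (intro conjI allI impI)
  fix v assume v: "aleph v \<and> mu \<epsilon> v"
  then have "\<not> v \<epsilon> succ_mu" using succ_mu_iff aleph_iff by blast
  then show "succ_mu = v \<or> succ_mu \<epsilon> v" using ord_cases[OF succ_mu_ord] v aleph_iff by blast
qed (rule succ_mu_aleph mu_less_succ_mu)+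

lemmas succ_mu_suc = aleph_suc[OF succ_mu_aleph ord_trans[OF succ_mu_ord om_mu mu_less_succ_mu]]

lemma EE_succ_mu:
  assumes "d \<epsilon> succ_mu"
  shows "x \<epsilon> d \<Longrightarrow> EE d x \<epsilon> mu" "x \<epsilon> d \<Longrightarrow> y \<epsilon> d \<Longrightarrow> EE d x = EE d y \<longleftrightarrow> x = y"
  using EE[of d] assms succ_mu_iff by auto

lemma succ_mu_regular: "regular succ_mu"
  unfolding regular_def singular_def
proof (intro conjI notI, rule succ_mu_aleph, elim conjE exE)
  fix t assume "is_cf succ_mu t" and t: "t \<epsilon> succ_mu"
  then obtain A f where A: "unbounded_in A succ_mu" and f: "is_bij f t A"
    unfolding is_cf_def has_order_type_def by blast
  note f = bij_app[OF f]
  have to: "ordinal t" using t succ_mu_iff by blast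
  \<comment> \<open>The least index of a member of the cofinal set above \<open>x\<close>.\<close>
  define p where "p x = leastO (\<lambda>z. z \<epsilon> t \<and> x \<epsilon> app f z)" for x
  have [dfns]: "dft (\<lambda>s. p (u s))" if "dft u" for u
    using _ that by (rule tsubst1[where F = p]) (unfold p_def, intro dfns)
  have p: "p x \<epsilon> t" "x \<epsilon> app f (p x)" "app f (p x) \<epsilon> succ_mu" if x: "x \<epsilon> succ_mu" for x
  proof -
    \<comment> \<open>Unboundedness only gives a member at or above a given point; applying it to
      \<open>suc x\<close> makes it exceed \<open>x\<close>.\<close>
    obtain y where y: "y \<epsilon> A" "suc x = y \<or> suc x \<epsilon> y" using A succ_mu_suc[OF x] unfolding unbounded_in_def by blast
    have yl: "y \<epsilon> succ_mu" if "y \<epsilon> A" for y using A that subset_ofD unfolding unbounded_in_def by blast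
    have "ordinal y" using yl[OF y(1)] succ_mu_iff by blast
    then have "x \<epsilon> y" using y(2) ord_trans[of y x "suc x"] suc_iff by metis
    moreover obtain z where z: "z \<epsilon> t" "app f z = y" using f(3) y(1) by blast
    moreover have "ordinal z" using z(1) to ord_elem by blast
    moreover have "dfn (\<lambda>s. s 0 \<epsilon> t \<and> x \<epsilon> app f (s 0))" by (intro dfns)
    ultimately show "p x \<epsilon> t" "x \<epsilon> app f (p x)"
      unfolding p_def using leastO(2)[where P = "\<lambda>z. z \<epsilon> t \<and> x \<epsilon> app f z", of z] by auto
    then show "app f (p x) \<epsilon> succ_mu" using f(1) yl by blast
  qed
  note E = EE_succ_mu[OF t] EE_succ_mu[OF p(3)]
  \<comment> \<open>An ordinal \<open>x\<close> is coded by the place of \<open>p x\<close> in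
    \<open>t\<close> and by its own place below \<open>app f (p x)\<close>. The uniform family
    supplies the second injection for all \<open>x\<close> at once.\<close>
  have "succ_mu \<lesssim> mu"
  proof (rule lepI[of "\<lambda>x. pp (EE t (p x)) (EE (app f (p x)) x)"])
    show "dft (\<lambda>s. pp (EE t (p (s 0))) (EE (app f (p (s 0))) (s 0)))" by (intro dfns)
    show "pp (EE t (p x)) (EE (app f (p x)) x) \<epsilon> mu" if "x \<epsilon> succ_mu" for x
      using E(1)[OF p(1)[OF that]] E(3)[OF that p(2)[OF that]] pp_mu by blast
    show "x = y" if x: "x \<epsilon> succ_mu" and y: "y \<epsilon> succ_mu"
      and e: "pp (EE t (p x)) (EE (app f (p x)) x) = pp (EE t (p y)) (EE (app f (p y)) y)" for x y
    proof -
      have *: "EE t (p x) = EE t (p y)" "EE (app f (p x)) x = EE (app f (p y)) y"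
        using e pp_eq E(1)[OF p(1)] E(3)[OF _ p(2)] x y by metis+
      then have "p x = p y" using E(2) p(1) x y by blast
      with *(2) show ?thesis using E(4)[OF x p(2)[OF x], of y] p(2)[OF y] by simp
    qed
  qed
  then show False using succ_mu_not_lep by blast
qed

text \<open>Ulam's argument: a measure on the successor would make \<open>d \<mapsto> EE d x\<close> constant almost everywhere
  for each \<open>x\<close>, and these constants would inject the successor into \<open>mu\<close>.\<close>

lemma succ_mu_not_measurable: "\<not> measurable succ_mu"
proof
  assume "measurable succ_mu"
  then obtain U where u: "ultrafilter_on U succ_mu" and np: "\<not> principal_on U succ_mu"
    and cp: "complete_filter succ_mu U" unfolding measurable_def by blast
  note u = u[unfolded ultrafilter_on_def]
  have sub: "subset_of X succ_mu" if "X \<epsilon> U" for X using u that by blast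
  have ne: "\<not> is_empty X" if "X \<epsilon> U" for X using u that by blast
  have up: "Y \<epsilon> U" if "X \<epsilon> U" "subset_of X Y" "subset_of Y succ_mu" for X Y using u that by blast
  have cap: "int X Y \<epsilon> U" if "X \<epsilon> U" "Y \<epsilon> U" for X Y
    using u[THEN conjunct2, THEN conjunct2, THEN conjunct2, THEN conjunct2, THEN conjunct1, rule_format, of X Y "int X Y"] that by simp
  have co: "X \<epsilon> U \<or> Sep succ_mu (\<lambda>z. \<not> z \<epsilon> X) \<epsilon> U" if "subset_of X succ_mu" for X
  proof -
    have "z \<epsilon> Sep succ_mu (\<lambda>z. \<not> z \<epsilon> X) \<longleftrightarrow> z \<epsilon> succ_mu \<and> \<not> z \<epsilon> X" for z by (rule Sep_iff) (intro dfns)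
    then show ?thesis
      using u[THEN conjunct2, THEN conjunct2, THEN conjunct2, THEN conjunct2, THEN conjunct2, rule_format, of X "Sep succ_mu (\<lambda>z. \<not> z \<epsilon> X)"] that by simp
  qed
  \<comment> \<open>Completeness speaks of sets of members of \<open>U\<close>; an indexed family of
    at most \<open>mu\<close> of them is such a set by Replacement, of size at most
    \<open>mu\<close>.\<close>
  have cpl: "Z \<epsilon> U" if G: "dft (\<lambda>s. G (s 0))" and X: "X \<lesssim> mu" "x0 \<epsilon> X" "\<And>x. x \<epsilon> X \<Longrightarrow> G x \<epsilon> U"
    and Z: "\<And>z. z \<epsilon> Z \<longleftrightarrow> (\<forall>x. x \<epsilon> X \<longrightarrow> z \<epsilon> G x)" for G X Z x0
  proof -
    have R: "y \<epsilon> Rep X G \<longleftrightarrow> (\<exists>x. x \<epsilon> X \<and> y = G x)" for y by (rule Rep_iff[OF G])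
    have "subset_of (Rep X G) U" using X(3) by (auto simp: subset_of_def R)
    moreover have "\<not> is_empty (Rep X G)" unfolding is_empty_def R using X(2) by blast
    moreover have "Rep X G \<lesssim> mu" by (rule Rep_lep[OF G X(1) ord_mu])
    then have "card_less (Rep X G) succ_mu" using card_less_iff[OF succ_mu_ord] mu_less_succ_mu by blast
    moreover have "\<forall>z. z \<epsilon> Z \<longleftrightarrow> (\<forall>Y. Y \<epsilon> Rep X G \<longrightarrow> z \<epsilon> Y)" unfolding Z R by blast
    ultimately show ?thesis using cp unfolding complete_filter_def by blast
  qed
  \<comment> \<open>Non-principality puts the complement of each singleton into \<open>U\<close>;
    intersecting those for the points of \<open>suc x\<close> gives a member of \<open>U\<close>
    disjoint from \<open>suc x\<close>.\<close>
  have small: "\<not> suc x \<epsilon> U" if x: "x \<epsilon> succ_mu" for x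
  proof
    assume xU: "suc x \<epsilon> U"
    have sx: "subset_of (suc x) succ_mu" using sub xU .
    define G where "G y = Sep succ_mu (\<lambda>z. z \<noteq> y)" for y
    have dG: "dft (\<lambda>s. G (s 0))" unfolding G_def by (intro dfns)
    have G: "z \<epsilon> G y \<longleftrightarrow> z \<epsilon> succ_mu \<and> z \<noteq> y" for z y unfolding G_def by (rule Sep_iff) (intro dfns)
    have "G y \<epsilon> U" if y: "y \<epsilon> suc x" for y
    proof (rule ccontr)
      assume n: "\<not> G y \<epsilon> U"
      have yl: "y \<epsilon> succ_mu" using y sx subset_ofD by blast
      have sy: "subset_of (upr y y) succ_mu" using yl by (simp add: subset_of_def)
      have "Sep succ_mu (\<lambda>z. \<not> z \<epsilon> upr y y) = G y" unfolding G_def by simp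
      then have yU: "upr y y \<epsilon> U" using co[OF sy] n by simp
      have "X \<epsilon> U \<longleftrightarrow> subset_of X succ_mu \<and> y \<epsilon> X" for X
      proof
        assume X: "X \<epsilon> U"
        have "\<not> is_empty (int X (upr y y))" using ne cap X yU by blast
        then show "subset_of X succ_mu \<and> y \<epsilon> X" using sub[OF X] by (auto simp: is_empty_def)
      next
        assume "subset_of X succ_mu \<and> y \<epsilon> X"
        then show "X \<epsilon> U" using up[OF yU, of X] by (auto simp: subset_of_def)
      qed
      then show False using np yl unfolding principal_on_def by blast
    qed
    note GU = this
    define Z where "Z = Sep succ_mu (\<lambda>z. \<not> z \<epsilon> suc x)"
    have Z: "z \<epsilon> Z \<longleftrightarrow> z \<epsilon> succ_mu \<and> \<not> z \<epsilon> suc x" for z unfolding Z_def by (rule Sep_iff) (intro dfns)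
    have "Z \<epsilon> U"
    proof (rule cpl[OF dG _ _ GU])
      show "suc x \<lesssim> mu" using succ_mu_suc[OF x] succ_mu_iff by blast
      show "x \<epsilon> suc x" by simp
      show "z \<epsilon> Z \<longleftrightarrow> (\<forall>y. y \<epsilon> suc x \<longrightarrow> z \<epsilon> G y)" for z
        unfolding Z G using suc_iff by blast
    qed
    from cap[OF xU this] have "\<not> is_empty (int (suc x) Z)" by (rule ne)
    then show False by (auto simp: is_empty_def Z)
  qed
  define M where "M x v = Sep succ_mu (\<lambda>d. x \<epsilon> d \<and> EE d x = v)" for x v
  have [dfns]: "dft (\<lambda>s. M (t s) (w s))" if "dft t" "dft w" for t w
    using _ that by (rule tsubst2[where F = M]) (unfold M_def, intro dfns)
  have M: "d \<epsilon> M x v \<longleftrightarrow> d \<epsilon> succ_mu \<and> x \<epsilon> d \<and> EE d x = v" for d x v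
    unfolding M_def by (rule Sep_iff) (intro dfns)
  have ex: "\<exists>v. v \<epsilon> mu \<and> M x v \<epsilon> U" if x: "x \<epsilon> succ_mu" for x
  proof (rule ccontr)
    assume n: "\<not> (\<exists>v. v \<epsilon> mu \<and> M x v \<epsilon> U)"
    define G where "G v = Sep succ_mu (\<lambda>z. \<not> z \<epsilon> M x v)" for v
    have dG: "dft (\<lambda>s. G (s 0))" unfolding G_def by (intro dfns)
    have G: "z \<epsilon> G v \<longleftrightarrow> z \<epsilon> succ_mu \<and> \<not> z \<epsilon> M x v" for z v unfolding G_def by (rule Sep_iff) (intro dfns)
    have GU: "G v \<epsilon> U" if "v \<epsilon> mu" for v
    proof -
      have "subset_of (M x v) succ_mu" by (simp add: subset_of_def M)
      from co[OF this] show ?thesis using n that unfolding G_def by blast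
    qed
    \<comment> \<open>If none of the at most \<open>mu\<close> classes were in \<open>U\<close>, the
      remaining \<open>d\<close> would be, namely those not above \<open>x\<close>; but they form a
      bounded set.\<close>
    define Z where "Z = Sep succ_mu (\<lambda>z. \<not> x \<epsilon> z)"
    have Z: "z \<epsilon> Z \<longleftrightarrow> z \<epsilon> succ_mu \<and> \<not> x \<epsilon> z" for z unfolding Z_def by (rule Sep_iff) (intro dfns)
    have e: "emp \<epsilon> mu" using ord_trans[OF ord_mu om_emp om_mu] .
    have "Z \<epsilon> U"
    proof (rule cpl[OF dG _ e GU])
      show "mu \<lesssim> mu" by (simp add: subset_lep)
      show "z \<epsilon> Z \<longleftrightarrow> (\<forall>v. v \<epsilon> mu \<longrightarrow> z \<epsilon> G v)" for z
        unfolding Z G M using EE_succ_mu(1)[of z x] e by blast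
    qed
    moreover have "subset_of Z (suc x)"
      unfolding subset_of_def Z suc_iff using ord_cases[of _ x] succ_mu_iff x by metis
    moreover have "subset_of (suc x) succ_mu" using succ_mu_suc[OF x] succ_mu_ord ord_mem_subset by blast
    ultimately show False using up small[OF x] by blast
  qed
  define p where "p x = leastO (\<lambda>v. v \<epsilon> mu \<and> M x v \<epsilon> U)" for x
  have p: "p x \<epsilon> mu" "M x (p x) \<epsilon> U" if x: "x \<epsilon> succ_mu" for x
  proof -
    obtain v where v: "v \<epsilon> mu" "M x v \<epsilon> U" using ex x by blast
    have "ordinal v" using v(1) ord_mu ord_elem by blast
    moreover have "dfn (\<lambda>s. s 0 \<epsilon> mu \<and> M x (s 0) \<epsilon> U)" by (intro dfns)
    ultimately show "p x \<epsilon> mu" "M x (p x) \<epsilon> U"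
      unfolding p_def using leastO(2)[where P = "\<lambda>v. v \<epsilon> mu \<and> M x v \<epsilon> U", of v] v by auto
  qed
  have "succ_mu \<lesssim> mu"
  proof (rule lepI[of p])
    show "dft (\<lambda>s. p (s 0))" unfolding p_def by (intro dfns)
    show "p x \<epsilon> mu" if "x \<epsilon> succ_mu" for x using p(1) that .
    show "x = y" if xy: "x \<epsilon> succ_mu" "y \<epsilon> succ_mu" "p x = p y" for x y
    proof -
      have "\<not> is_empty (int (M x (p x)) (M y (p y)))" using ne cap p(2) xy by blast
      then obtain d where "d \<epsilon> succ_mu" "x \<epsilon> d" "y \<epsilon> d" "EE d x = EE d y"
        using xy(3) by (auto simp: is_empty_def M)
      then show ?thesis using EE_succ_mu(2) by blast
    qed
  qed
  then show False using succ_mu_not_lep by blast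
qed

end

section \<open>Cofinality, and passage from the hypotheses\<close>

context ZF_DC
begin

text \<open>Minimality of the cofinality: the values of a map at its record points have order type at most
  the domain of the map, so an unbounded map from a smaller ordinal would give a smaller
  unbounded subset.\<close>

lemma cf_bounded:
  assumes cf: "is_cf mu kap" and f: "is_bij f kap A"
    and fm: "\<And>x x'. x \<epsilon> kap \<Longrightarrow> x' \<epsilon> kap \<Longrightarrow> x \<epsilon> x' \<longleftrightarrow> app f x \<epsilon> app f x'"
    and A: "unbounded_in A mu" and mu: "ordinal mu" and kap: "ordinal kap"
    and t: "t \<epsilon> kap" and g: "\<And>x. x \<epsilon> t \<Longrightarrow> app g x \<epsilon> kap"
  shows "\<exists>d. d \<epsilon> kap \<and> (\<forall>x. x \<epsilon> t \<longrightarrow> app g x \<epsilon> d)"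
proof (rule ccontr)
  assume n: "\<not> (\<exists>d. d \<epsilon> kap \<and> (\<forall>x. x \<epsilon> t \<longrightarrow> app g x \<epsilon> d))"
  note fb = bij_app[OF f]
  have to: "ordinal t" using t kap ord_elem by blast
  have ko: "ordinal x" if "x \<epsilon> kap" for x using that kap ord_elem by blast
  have t_ord: "ordinal x" if "x \<epsilon> t" for x using that to ord_elem by blast
  \<comment> \<open>The record points of \<open>g\<close>, at which it exceeds all its earlier
    values; on them \<open>g\<close> is strictly increasing.\<close>
  define B where "B = Sep t (\<lambda>x. \<forall>y. y \<epsilon> x \<longrightarrow> app g y \<epsilon> app g x)"
  have B: "x \<epsilon> B \<longleftrightarrow> x \<epsilon> t \<and> (\<forall>y. y \<epsilon> x \<longrightarrow> app g y \<epsilon> app g x)" for x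
    unfolding B_def by (rule Sep_iff) (intro dfns)
  have Bo: "ordinal x" if "x \<epsilon> B" for x using that B t_ord by blast
  define C where "C = Rep B (\<lambda>x. app f (app g x))"
  have C: "y \<epsilon> C \<longleftrightarrow> (\<exists>x. x \<epsilon> B \<and> y = app f (app g x))" for y
    unfolding C_def by (rule Rep_iff) (intro dfns)
  have Am: "y \<epsilon> mu" if "y \<epsilon> A" for y using A that subset_ofD unfolding unbounded_in_def by blast
  have "unbounded_in C mu"
    unfolding unbounded_in_def
  proof (intro conjI allI impI)
    show "subset_of C mu" using Am fb(1) g B by (auto simp: subset_of_def C)
    fix z assume "z \<epsilon> mu"
    then obtain y where y: "y \<epsilon> A" "z = y \<or> z \<epsilon> y" using A unfolding unbounded_in_def by blast
    obtain i where i: "i \<epsilon> kap" "app f i = y" using fb(3) y(1) by blast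
    obtain x0 where x0: "x0 \<epsilon> t" "\<not> app g x0 \<epsilon> i" using n i(1) by blast
    have d: "dfn (\<lambda>s. s 0 \<epsilon> t \<and> \<not> app g (s 0) \<epsilon> i)" by (intro dfns)
    \<comment> \<open>The least point at which \<open>g\<close> reaches \<open>i\<close> is a
      record, because all earlier values are below \<open>i\<close>.\<close>
    from ord_min[where P = "\<lambda>x. x \<epsilon> t \<and> \<not> app g x \<epsilon> i", OF d t_ord[OF x0(1)]] x0
    obtain x where x: "x \<epsilon> t" "\<not> app g x \<epsilon> i" "\<And>y. y \<epsilon> x \<Longrightarrow> y \<epsilon> t \<Longrightarrow> app g y \<epsilon> i" by metis
    have le: "i = app g x \<or> i \<epsilon> app g x" using ord_cases[OF ko[OF i(1)] ko[OF g[OF x(1)]]] x(2) by blast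
    have "app g y \<epsilon> app g x" if "y \<epsilon> x" for y
      using x(3)[OF that ord_trans[OF to that x(1)]] le ord_trans[OF ko[OF g[OF x(1)]]] by blast
    then have xB: "x \<epsilon> B" using x(1) B by blast
    have "y = app f (app g x) \<or> y \<epsilon> app f (app g x)" using le i fm[OF i(1) g[OF x(1)]] by auto
    then have "z = app f (app g x) \<or> z \<epsilon> app f (app g x)"
      using y(2) ord_trans[OF ord_elem[OF mu Am[OF fb(1)[OF g[OF x(1)]]]]] by blast
    then show "\<exists>y. y \<epsilon> C \<and> (z = y \<or> z \<epsilon> y)" using C xB by blast
  qed
  moreover have "has_order_type C (otp B)"
  proof -
    obtain h where h: "is_bij h (otp B) B"
      and hm: "\<And>x x' y y'. related h x y \<Longrightarrow> related h x' y' \<Longrightarrow> x \<epsilon> x' \<longleftrightarrow> y \<epsilon> y'"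
      using otp_order_type[of B] Bo unfolding has_order_type_def by blast
    note hb = bij_app[OF h]
    have hf: "is_fun h (otp B) B" using h unfolding is_bij_def is_inj_def by blast
    have hm': "x \<epsilon> x' \<longleftrightarrow> app h x \<epsilon> app h x'" if "x \<epsilon> otp B" "x' \<epsilon> otp B" for x x'
      using hm[of x "app h x" x' "app h x'"] is_fun_related[OF hf] that by simp
    have gm: "x \<epsilon> y \<longleftrightarrow> app g x \<epsilon> app g y" if "x \<epsilon> B" "y \<epsilon> B" for x y
      using that B ord_cases[OF Bo[OF that(1)] Bo[OF that(2)]] mem_asym mem_irrefl by metis
    define F where "F x = app f (app g (app h x))" for x
    have dF: "dft (\<lambda>s. F (s 0))" unfolding F_def by (intro dfns)
    have gk: "app g x \<epsilon> kap" if "x \<epsilon> B" for x using that B g by blast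
    have Fm: "x \<epsilon> x' \<longleftrightarrow> F x \<epsilon> F x'" if "x \<epsilon> otp B" "x' \<epsilon> otp B" for x x'
      using hm'[OF that] gm[OF hb(1)[OF that(1)] hb(1)[OF that(2)]]
        fm[OF gk[OF hb(1)[OF that(1)]] gk[OF hb(1)[OF that(2)]]] unfolding F_def by simp
    have Fi: "x = x'" if "x \<epsilon> otp B" "x' \<epsilon> otp B" "F x = F x'" for x x'
    proof -
      have "ordinal x" "ordinal x'" using that otp_ord[of B] Bo ord_elem by blast+
      then show ?thesis using Fm[OF that(1,2)] Fm[OF that(2,1)] that(3) mem_irrefl by (metis ord_cases)
    qed
    have FC: "F x \<epsilon> C" if "x \<epsilon> otp B" for x unfolding C F_def using hb(1)[OF that] by blast
    have Fs: "\<exists>x. x \<epsilon> otp B \<and> y = F x" if "y \<epsilon> C" for y using that hb(3) unfolding C F_def by metis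
    have l: "is_fun (lam (otp B) F) (otp B) C" by (rule lam_is_fun[OF dF FC])
    have r: "related (lam (otp B) F) x y \<longleftrightarrow> x \<epsilon> otp B \<and> y = F x" for x y
      unfolding is_fun_related[OF l] using app_lam[OF dF] by auto
    have "is_bij (lam (otp B) F) (otp B) C"
      unfolding is_bij_def is_inj_def r using l Fi Fs by metis
    moreover have "x \<epsilon> x' \<longleftrightarrow> y \<epsilon> y'" if "related (lam (otp B) F) x y" "related (lam (otp B) F) x' y'" for x x' y y'
      using that Fm unfolding r by blast
    ultimately show ?thesis unfolding has_order_type_def using otp_ord[of B] Bo by blast
  qed
  ultimately have "kap = otp B \<or> kap \<epsilon> otp B" using cf unfolding is_cf_def by blast
  moreover have "subset_of (otp B) t"
    by (rule otp_subset[OF _ to]) (use Bo B in \<open>auto simp: subset_of_def\<close>)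
  ultimately show False using t mem_irrefl mem_asym subset_ofD by metis
qed

lemma singular_aleph_ex:
  assumes "singular mu" "\<exists>kap. is_cf mu kap \<and> \<not> countable_set kap"
    and "\<exists>h. is_H mu h \<and> has_card h mu"
  obtains kap H b c where "singular_aleph mem mu kap H b c"
proof -
  obtain k where k: "is_cf mu k" "k \<epsilon> mu" and am: "aleph mu" using assms(1) unfolding singular_def by blast
  obtain kap where kap: "is_cf mu kap" "\<not> countable_set kap" using assms(2) by blast
  have "k = kap" using k(1) kap(1) mem_asym unfolding is_cf_def by blast
  then have km: "kap \<epsilon> mu" using k by simp
  have mu: "ordinal mu" and nl: "\<And>x. x \<epsilon> mu \<Longrightarrow> \<not> mu \<lesssim> x" using am aleph_iff by auto
  have ko: "ordinal kap" using mu km ord_elem by blast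
  obtain A c where A: "unbounded_in A mu" and c: "is_bij c kap A"
    and cm: "\<And>x x' y y'. related c x y \<Longrightarrow> related c x' y' \<Longrightarrow> x \<epsilon> x' \<longleftrightarrow> y \<epsilon> y'"
    using kap(1) unfolding is_cf_def has_order_type_def by blast
  have cf: "is_fun c kap A" using c unfolding is_bij_def is_inj_def by blast
  have cm': "x \<epsilon> x' \<longleftrightarrow> app c x \<epsilon> app c x'" if "x \<epsilon> kap" "x' \<epsilon> kap" for x x'
    using cm[of x "app c x" x' "app c x'"] is_fun_related[OF cf] that by simp
  note cb = bij_app[OF c]
  have Am: "y \<epsilon> mu" if "y \<epsilon> A" for y using A that subset_ofD unfolding unbounded_in_def by blast
  \<comment> \<open>An ordinal not above \<open>om\<close> injects into \<open>om\<close> and would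
    be countable.\<close>
  have ok: "om \<epsilon> kap"
  proof (rule ccontr)
    assume "\<not> om \<epsilon> kap"
    then have "subset_of kap om" using ord_not_mem ord_om ko by blast
    then obtain f where "injf f kap om" using subset_lep unfolding lep_def by blast
    then have "is_inj (lam kap (app f)) kap om" by (rule injf_is_inj)
    then show False using kap(2) is_omega_iff unfolding countable_set_def by blast
  qed
  have om: "om \<epsilon> mu" using ok km mu ord_trans by blast
  note lim = aleph_suc[OF am om]
  obtain H where H: "is_H mu H" "has_card H mu" using assms(3) by blast
  then obtain b where b: "injf b H mu" using equipollent_lep unfolding has_card_def lep_def by blast
  have "singular_aleph mem mu kap H b c"
  proof (unfold_locales; (rule am ok km H(1) b)?)
    show "app c i \<epsilon> mu" if "i \<epsilon> kap" for i using cb(1) Am that by blast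
    show "app c i \<epsilon> app c j" if "i \<epsilon> j" "j \<epsilon> kap" for i j
      using cm'[of i j] that ord_trans[OF ko that] by blast
    show "\<exists>i. i \<epsilon> kap \<and> x \<epsilon> app c i" if x: "x \<epsilon> mu" for x
    proof -
      \<comment> \<open>As unboundedness is not strict, it is applied to \<open>suc x\<close>, which
        is still below the limit ordinal \<open>mu\<close>.\<close>
      obtain y where y: "y \<epsilon> A" "suc x = y \<or> suc x \<epsilon> y" using A lim[OF x] unfolding unbounded_in_def by blast
      have "ordinal y" using Am[OF y(1)] mu ord_elem by blast
      then have "x \<epsilon> y" using y(2) ord_trans[of y x "suc x"] suc_iff by metis
      then show ?thesis using cb(3)[OF y(1)] by blast
    qed
    show "\<exists>d. d \<epsilon> kap \<and> (\<forall>x. x \<epsilon> t \<longrightarrow> app g x \<epsilon> d)"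
      if "t \<epsilon> kap" "\<And>x. x \<epsilon> t \<Longrightarrow> app g x \<epsilon> kap" for t g
      by (rule cf_bounded[OF kap(1) c cm' A mu ko that])
  qed
  then show ?thesis by (rule that)
qed

end

theorem theorem0p1:
  fixes mem :: "'a \<Rightarrow> 'a \<Rightarrow> bool" and \<mu> :: 'a
  assumes "ZF_DC mem"
    and "membership.singular mem \<mu>"
    and "\<exists>\<kappa>. membership.is_cf mem \<mu> \<kappa> \<and> \<not> membership.countable_set mem \<kappa>"
    and "\<exists>h. membership.is_H mem \<mu> h \<and> membership.has_card mem h \<mu>"
  shows "\<exists>\<kappa>. membership.is_card_succ mem \<mu> \<kappa> \<and> membership.regular mem \<kappa> \<and>
              \<not> membership.measurable mem \<kappa>"
proof -
  interpret ZF_DC mem by fact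
  obtain kap H b c where "singular_aleph mem \<mu> kap H b c"
    using singular_aleph_ex assms(2-4) by blast
  then interpret singular_aleph mem \<mu> kap H b c .
  show ?thesis using succ_mu_card_succ succ_mu_regular succ_mu_not_measurable by blast
qed

end
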